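(* The 2-mixed volume $\mathrm{MV}_2$ is symmetric and multilinear with respect to Minkowski summation of its polytope arguments. That is, let $n\ge1$ and $\zeta\in\mathbb{Z}^n$. (1) If $(P_1,\ldots,P_n)$ is a tuple of convex lattice polytopes in $\mathbb{R}^n$ that is 2-developed with respect to $\zeta$, then $\mathrm{MV}_2(P_{s(1)},\ldots,P_{s(n)};\zeta)=\mathrm{MV}_2(P_1,\ldots,P_n;\zeta)$ for every permutation $s$ of $\{1,\ldots,n\}$. (2) If $P,Q,P_2,\ldots,P_n$ are convex lattice polytopes in $\mathbb{R}^n$ such that $(P,P_2,\ldots,P_n)$ and $(Q,P_2,\ldots,P_n)$ are both 2-developed with respect to $\zeta$, then $\mathrm{MV}_2(P+Q,P_2,\ldots,P_n;\zeta)$ is defined and $$\mathrm{MV}_2(P+Q,P_2,\ldots,P_n;\zeta)=\mathrm{MV}_2(P,P_2,\ldots,P_n;\zeta)+\mathrm{MV}_2(Q,P_2,\ldots,P_n;\zeta)\quad\text{in }\mathbb{F}_2,$$ and likewise in each of the other polytope arguments.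
   Context: Tropical polynomials and hypersurfaces. For a finite nonempty set $A\subset\mathbb{Z}^n$, a tropical polynomial with support $A$ is a function $\varphi(x)=\max_{a\in A}(c_a+a\cdot x)$, $x\in\mathbb{R}^n$, with real coefficients $c_a$, $a\in A$. For $x\in\mathbb{R}^n$ the local support set $\mathrm{supp}_x(\varphi)$ is the set of all $a\in A$ with $c_a+a\cdot x=\varphi(x)$, and the local Newton polytope is its convex hull. The tropical hypersurface $H$ defined by $\varphi$ is the set of all $x\in\mathbb{R}^n$ with $|\mathrm{supp}_x(\varphi)|\ge 2$; its local Newton polytope at $x$ is denoted $\mathcal{N}_x(H)$. A point $x\in H$ is smooth if $|\mathrm{supp}_x(\varphi)|=2$. A tuple $(H_1,\ldots,H_n)$ is transverse if $H_1\cap\ldots\cap H_n$ is finite and each of its points is a smooth point of every $H_i$. 2-determinant. For $k_1,\ldots,k_{n+1}$ in an $n$-dimensional vector space over $\mathbb{F}_2$, $\det_2(k_1,\ldots,k_{n+1})\in\mathbb{F}_2$ is $0$ if the rank of $k_1,\ldots,k_{n+1}$ is less than $n$, and is $\lambda^1+\ldots+\lambda^{n+1}+1$ if the vectors satisfy a unique nontrivial linear relation $\lambda^1k_1+\ldots+\lambda^{n+1}k_{n+1}=0$. 2-intersection number. For a transverse tuple and $\zeta\in\mathbb{Z}^n$, $\iota_2(H_1,\ldots,H_n;\zeta)=\sum_{x\in H_1\cap\ldots\cap H_n}\det_2(\mathcal{N}_x(H_1),\ldots,\mathcal{N}_x(H_n),\zeta)\in\mathbb{F}_2$, where each segment $\mathcal{N}_x(H_i)$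 is replaced by the mod 2 reduction of the difference of its endpoints, and $\zeta$ by its mod 2 reduction. 2-developed tuples. For a convex polytope $P$ and a covector $v$, $P^v$ is the face of $P$ on which $v|_P$ attains its maximum. A lattice polytope is a 2-vertex if any two of its vertices are congruent modulo 2 coordinatewise. A tuple $(P_1,\ldots,P_n)$ of convex lattice polytopes is 2-developed with respect to $\zeta$ if for every $v\in(\mathbb{Z}^n)^*$ with $v(\zeta)$ odd there exists $i$ such that $P_i^v$ is a 2-vertex. 2-mixed volume. For a tuple $(P_1,\ldots,P_n)$ that is 2-developed with respect to $\zeta$, $\mathrm{MV}_2(P_1,\ldots,P_n;\zeta)\in\mathbb{F}_2$ is defined as $\iota_2(H_1,\ldots,H_n;\zeta)$ for any generic (in particular transverse) tuple of tropical hypersurfaces $H_i$ defined by tropical polynomials whose support is the set of vertices of $P_i$; this value does not depend on the choice of the $H_i$. *)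

theory Defs
  imports "HOL-Analysis.Analysis" "HOL-Library.Z2" "HOL-Library.Set_Algebras"
begin

text \<open>
  Throughout, the dimension \<open>n \<ge> 1\<close> is \<open>CARD('n)\<close> for a finite index type \<open>'n\<close>.
  The same type indexes the \<open>n\<close> members of a tuple of polytopes or of tropical
  hypersurfaces. The field \<open>\<F>\<^sub>2\<close> is the type \<^typ>\<open>bit\<close>.
\<close>

definition real_vec :: "int ^ 'n \<Rightarrow> real ^ 'n" where
  "real_vec a = (\<chi> i. real_of_int (a $ i))"

definition mod2_vec :: "int ^ 'n \<Rightarrow> bit ^ 'n" where
  "mod2_vec a = (\<chi> i. of_int (a $ i))"


subsection \<open>Tropical polynomials and hypersurfaces\<close>

text \<open>
  A tropical polynomial is a pair of its support \<open>A\<close> and a coefficient function \<open>c\<close>;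
  the values of \<open>c\<close> outside \<open>A\<close> play no role.
\<close>

type_synonym 'n trop_poly = "(int ^ 'n) set \<times> (int ^ 'n \<Rightarrow> real)"

abbreviation trop_support :: "'n trop_poly \<Rightarrow> (int ^ 'n) set" where
  "trop_support \<equiv> fst"

abbreviation trop_coeff :: "'n trop_poly \<Rightarrow> int ^ 'n \<Rightarrow> real" where
  "trop_coeff \<equiv> snd"

definition trop_eval :: "'n::finite trop_poly \<Rightarrow> real ^ 'n \<Rightarrow> real" where
  "trop_eval \<phi> x = Max ((\<lambda>a. trop_coeff \<phi> a + real_vec a \<bullet> x) ` trop_support \<phi>)"

definition local_support :: "'n::finite trop_poly \<Rightarrow> real ^ 'n \<Rightarrow> (int ^ 'n) set" where
  "local_support \<phi> x =
     {a \<in> trop_support \<phi>. trop_coeff \<phi> a + real_vec a \<bullet> x = trop_eval \<phi> x}"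

definition local_newton :: "'n::finite trop_poly \<Rightarrow> real ^ 'n \<Rightarrow> (real ^ 'n) set" where
  "local_newton \<phi> x = convex hull (real_vec ` local_support \<phi> x)"

definition trop_hypersurface :: "'n::finite trop_poly \<Rightarrow> (real ^ 'n) set" where
  "trop_hypersurface \<phi> = {x. card (local_support \<phi> x) \<ge> 2}"

definition smooth_point :: "'n::finite trop_poly \<Rightarrow> real ^ 'n \<Rightarrow> bool" where
  "smooth_point \<phi> x \<longleftrightarrow> x \<in> trop_hypersurface \<phi> \<and> card (local_support \<phi> x) = 2"

definition transverse :: "('n::finite \<Rightarrow> 'n trop_poly) \<Rightarrow> bool" where
  "transverse F \<longleftrightarrow>
     finite (\<Inter>i. trop_hypersurface (F i)) \<and>
     (\<forall>x \<in> (\<Inter>i. trop_hypersurface (F i)). \<forall>i. smooth_point (F i) x)"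


subsection \<open>The 2-determinant and the 2-intersection number\<close>

text \<open>
  The \<open>n + 1\<close> vectors are indexed by \<^typ>\<open>'n option\<close>. Vectors of rank \<open>n\<close> satisfy exactly
  one nontrivial linear relation over \<open>\<F>\<^sub>2\<close>, so the description below is then proper.
\<close>

definition det2 :: "('n::finite option \<Rightarrow> bit ^ 'n) \<Rightarrow> bit" where
  "det2 k =
     (if vec.dim (range k) < CARD('n) then 0
      else (\<Sum>j\<in>UNIV. (THE l. l \<noteq> (\<lambda>_. 0) \<and> (\<Sum>j\<in>UNIV. l j *s k j) = 0) j) + 1)"

text \<open>
  The mod 2 reduction of the difference of the endpoints of a lattice segment; it does not
  depend on the order of the endpoints, as \<open>- 1 = 1\<close> in \<open>\<F>\<^sub>2\<close>.
\<close>

definition segment_mod2 :: "(real ^ 'n::finite) set \<Rightarrow> bit ^ 'n" where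
  "segment_mod2 N =
     (THE k. \<exists>a b. N = closed_segment (real_vec a) (real_vec b) \<and> k = mod2_vec (a - b))"

definition iota2 :: "('n::finite \<Rightarrow> 'n trop_poly) \<Rightarrow> int ^ 'n \<Rightarrow> bit" where
  "iota2 F \<zeta> =
     (\<Sum>x \<in> (\<Inter>i. trop_hypersurface (F i)).
        det2 (\<lambda>j. case j of
                    None \<Rightarrow> mod2_vec \<zeta>
                  | Some i \<Rightarrow> segment_mod2 (local_newton (F i) x)))"


subsection \<open>2-developed tuples of lattice polytopes\<close>

definition lattice_polytope :: "(real ^ 'n::finite) set \<Rightarrow> bool" where
  "lattice_polytope P \<longleftrightarrow>
     (\<exists>S :: (int ^ 'n) set. finite S \<and> S \<noteq> {} \<and> P = convex hull (real_vec ` S))"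

definition lattice_vertices :: "(real ^ 'n::finite) set \<Rightarrow> (int ^ 'n) set" where
  "lattice_vertices P = {a. real_vec a extreme_point_of P}"

definition max_face :: "int ^ 'n::finite \<Rightarrow> (real ^ 'n) set \<Rightarrow> (real ^ 'n) set" where
  "max_face v P = {x \<in> P. \<forall>y \<in> P. real_vec v \<bullet> y \<le> real_vec v \<bullet> x}"

definition two_vertex :: "(real ^ 'n::finite) set \<Rightarrow> bool" where
  "two_vertex P \<longleftrightarrow>
     lattice_polytope P \<and>
     (\<forall>a \<in> lattice_vertices P. \<forall>b \<in> lattice_vertices P. \<forall>i. a $ i mod 2 = b $ i mod 2)"

definition two_developed :: "('n::finite \<Rightarrow> (real ^ 'n) set) \<Rightarrow> int ^ 'n \<Rightarrow> bool" where
  "two_developed P \<zeta> \<longleftrightarrow>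
     (\<forall>i. lattice_polytope (P i)) \<and>
     (\<forall>v :: int ^ 'n. odd (scalar_product v \<zeta>) \<longrightarrow> (\<exists>i. two_vertex (max_face v (P i))))"


subsection \<open>The 2-mixed volume\<close>

text \<open>
  A value \<open>b\<close> of the 2-mixed volume is the common 2-intersection number of all transverse
  tuples of tropical hypersurfaces supported at the vertices of the polytopes. At least one
  such tuple is required, so there is at most one value.
\<close>

definition is_MV2 :: "('n::finite \<Rightarrow> (real ^ 'n) set) \<Rightarrow> int ^ 'n \<Rightarrow> bit \<Rightarrow> bool" where
  "is_MV2 P \<zeta> b \<longleftrightarrow>
     (\<exists>F. transverse F \<and> (\<forall>i. trop_support (F i) = lattice_vertices (P i))) \<and>
     (\<forall>F. transverse F \<and> (\<forall>i. trop_support (F i) = lattice_vertices (P i))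
        \<longrightarrow> iota2 F \<zeta> = b)"

definition MV2_defined :: "('n::finite \<Rightarrow> (real ^ 'n) set) \<Rightarrow> int ^ 'n \<Rightarrow> bool" where
  "MV2_defined P \<zeta> \<longleftrightarrow> two_developed P \<zeta> \<and> (\<exists>b. is_MV2 P \<zeta> b)"

definition MV2 :: "('n::finite \<Rightarrow> (real ^ 'n) set) \<Rightarrow> int ^ 'n \<Rightarrow> bit" where
  "MV2 P \<zeta> = (THE b. is_MV2 P \<zeta> b)"

end

theory Submission
  imports Defs "HOL-Computational_Algebra.Polynomial"
begin

text \<open>
  The key point is that \<^const>\<open>det2\<close> is multilinear over \<open>\<F>\<^sub>2\<close>. Fix an index \<open>j\<close>. The hypersurfaces
  with index \<open>i \<noteq> j\<close> cut out a tropical curve, and along each of its edges the breakpoints of the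
  \<open>j\<close>-th polynomial telescope. At a vertex of the curve the three adjacent edges cancel, again by
  linearity, so the 2-intersection number is a sum over the unbounded rays of the curve, in which the
  \<open>j\<close>-th polynomial enters only through the exponent \<open>a\<close> that dominates along the ray. Let \<open>u\<close> be the
  primitive direction of the ray. The exponents maximizing \<open>u\<close> on \<open>P\<close> all have the same pairing
  with \<open>u\<close>, and those for \<open>P + Q\<close> are sums of those for \<open>P\<close> and \<open>Q\<close>. If \<open>u(\<zeta>)\<close> is even, then the
  difference of two competing choices of \<open>a\<close> lies with all other vectors in the hyperplane \<open>u = 0\<close>
  modulo 2 and contributes 0; if it is odd, then one of the vectors vanishes modulo 2, because the
  tuple is 2-developed. This yields both the independence of the \<open>j\<close>-th polynomial and additivity.

  Transverse tuples are first perturbed to generic ones, which does not change the 2-intersection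
  number, in order that all mixtures of two tuples be transverse.
\<close>

subsection \<open>Linear relations\<close>

text \<open>Cells are never handled geometrically: a cell is represented by its label, the tuple of
  local supports, so all sums run over finitely many labels, and a larger label means a smaller
  cell. Under \<open>indep_tuple\<close> the cell labelled \<open>V\<close> has codimension
  \<Sum>(card (V i) - 1), so that edges of the curve have n - 1 here and vertices n. Transversality
  constrains only the common points of all n hypersurfaces and says nothing about the curve cut out
  by n - 1 of them; hence the passage to generic tuples. The curve is subdivided at the j-th
  hypersurface. With a single exponent instead of a segment in slot j, an edge gets a weight by the
  same formula as a point. Every edge has two ends, so modulo 2 the weights summed over incidences
  of edges with vertices equal the weights summed over unbounded ends. At a vertex the weights add
  up to m + 1 times the weight of the vertex, with m = 2 at an intersection point and m = 3 at a
  vertex of the curve. All perturbations use one parameter t and different powers of it, so only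
  finitely many t are bad for each tuple and one t serves several tuples at once.\<close>

lemma nontrivial_relation:
  fixes w :: "'i \<Rightarrow> 'a::field ^ 'n"
  assumes I: "finite I" and less: "vec.dim (w ` I) < card I"
  obtains \<mu> where "\<exists>i\<in>I. \<mu> i \<noteq> 0" "(\<Sum>i\<in>I. \<mu> i *s w i) = 0"
proof (cases "inj_on w I")
  case False
  then obtain a b where ab: "a \<in> I" "b \<in> I" "a \<noteq> b" "w a = w b"
    by (auto simp: inj_on_def)
  \<comment> \<open>A repeated vector is already a relation within the family, with coefficients 1
    and -1 in the two places.\<close>
  define \<mu> where "\<mu> = (\<lambda>i. if i = a then 1 else if i = b then - 1 else (0::'a))"
  have "(\<Sum>i\<in>I. \<mu> i *s w i) = (\<Sum>i\<in>{a, b}. \<mu> i *s w i)"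
    using I ab by (intro sum.mono_neutral_right) (auto simp: \<mu>_def)
  also have "\<dots> = 0"
    using ab by (simp add: \<mu>_def)
  finally show ?thesis
    using ab(1) by (intro that[of \<mu>]) (auto simp: \<mu>_def)
next
  case True
  have "\<not> vec.independent (w ` I)"
    using less vec.dim_eq_card_independent[of "w ` I"] card_image[OF True] by auto
  then obtain u where u: "(\<Sum>v\<in>w ` I. u v *s v) = 0" "\<exists>v\<in>w ` I. u v \<noteq> 0"
    using I by (auto simp: vec.dependent_finite)
  show ?thesis
    using u by (intro that[of "u \<circ> w"]) (auto simp: sum.reindex[OF True] o_def)
qed

text \<open>A nonzero coefficient would express \<open>w i\<close> through the other members, and
  then \<open>CARD('n) - 1\<close> vectors would span the whole space.\<close>

lemma spanning_family_independent:
  fixes w :: "'i \<Rightarrow> 'a::field ^ 'n"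
  assumes I: "finite I" "card I = CARD('n)" and span: "vec.span (w ` I) = UNIV"
    and rel: "(\<Sum>i\<in>I. l i *s w i) = 0" and i: "i \<in> I"
  shows "l i = 0"
proof (rule ccontr)
  assume li: "l i \<noteq> 0"
  have "w i = (\<Sum>m\<in>I - {i}. (- l m / l i) *s w m)"
  proof -
    have "l i *s w i = - (\<Sum>m\<in>I - {i}. l m *s w m)"
      using rel I i by (simp add: sum.remove eq_neg_iff_add_eq_0)
    then have "(1 / l i) *s (l i *s w i) = (1 / l i) *s (- (\<Sum>m\<in>I - {i}. l m *s w m))"
      by simp
    then show ?thesis
      using li by (simp add: vec.scale_sum_right sum_negf[symmetric])
  qed
  then have "w i \<in> vec.span (w ` (I - {i}))"
    by (metis (mono_tags, lifting) imageI vec.span_base vec.span_scale vec.span_sum)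
  then have "vec.span (w ` (I - {i})) = UNIV"
    using span i by (metis image_insert insert_Diff vec.span_redundant)
  then have "CARD('n) \<le> card (w ` (I - {i}))"
    using I by (metis vec_dim_card vec.dim_span vec.dim_le_card' finite_Diff finite_imageI)
  also have "\<dots> \<le> card (I - {i})"
    using I by (intro card_image_le) auto
  also have "\<dots> < card I"
    using I i by (intro psubset_card_mono) auto
  finally show False
    using I by simp
qed

lemma in_span_image_sum:
  fixes w :: "'i \<Rightarrow> 'a::field ^ 'n"
  assumes "finite I" "a \<in> vec.span (w ` I)"
  obtains \<mu> where "a = (\<Sum>i\<in>I. \<mu> i *s w i)"
proof -
  have "\<exists>\<mu>. a = (\<Sum>i\<in>I. \<mu> i *s w i)"
    using assms(2)
  proof (induction rule: vec.span_induct_alt)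
    case base
    show ?case by (intro exI[of _ "\<lambda>_. 0"]) simp
  next
    case (step c x y)
    then obtain \<mu> i where \<mu>: "y = (\<Sum>i\<in>I. \<mu> i *s w i)" "i \<in> I" "x = w i" by auto
    have "c *s x + y = (\<Sum>m\<in>I. ((if m = i then c else 0) + \<mu> m) *s w m)"
      using \<mu> assms(1)
      by (simp add: vec.scale_left_distrib sum.distrib if_distrib[of "\<lambda>c. c *s _"] cong: if_cong)
    then show ?case by (rule exI[of _ "\<lambda>m. (if m = i then c else 0) + \<mu> m"])
  qed
  then show ?thesis using that by blast
qed

lemma bit_vec_minus: "x - y = x + y" for x y :: "bit ^ 'n"
  by (simp only: vec_eq_iff vector_minus_component vector_add_component minus_bit_def) simp

lemma bit_vec_add_eq_0_iff: "x + y = 0 \<longleftrightarrow> x = y" for x y :: "bit ^ 'n"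
  by (simp only: bit_vec_minus[symmetric] right_minus_eq)

subsection \<open>The 2-determinant is symmetric and multilinear\<close>

lemma dim_less_iff_span: "vec.dim S < CARD('n) \<longleftrightarrow> vec.span S \<noteq> UNIV"
  for S :: "('a::field ^ 'n) set"
  using vec.dim_eq_full[of S] dim_subset_UNIV_cart_gen[of S]
  by (metis order_le_less vec_dim_card less_irrefl vec.dim_UNIV vec.dimension_def)

definition nontriv_rel :: "('n::finite option \<Rightarrow> bit ^ 'n) \<Rightarrow> ('n option \<Rightarrow> bit) \<Rightarrow> bool" where
  "nontriv_rel k l \<longleftrightarrow> l \<noteq> (\<lambda>_. 0) \<and> (\<Sum>j\<in>UNIV. l j *s k j) = 0"

lemma det2_alt:
  "det2 k = (if vec.span (range k) \<noteq> UNIV then 0 else (\<Sum>j\<in>UNIV. (THE l. nontriv_rel k l) j) + 1)"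
  unfolding det2_def nontriv_rel_def dim_less_iff_span by simp

lemma det2_eqI:
  assumes "vec.span (range k) = UNIV" "nontriv_rel k l" "\<And>l'. nontriv_rel k l' \<Longrightarrow> l' = l"
  shows "det2 k = (\<Sum>j\<in>UNIV. l j) + 1"
proof -
  have "(THE l. nontriv_rel k l) = l"
    using assms(2,3) by (rule the_equality)
  then show ?thesis using assms(1) by (simp add: det2_alt)
qed

lemma card_option_remove: "card (UNIV - {j :: 'n::finite option}) = CARD('n)"
  by (simp add: card_Diff_singleton card_UNIV_option)

lemma range_fun_upd_image: "range (k(j := a)) = insert a (k ` (UNIV - {j}))"
  by (auto simp: fun_upd_image)

lemma sum_fun_upd_split:
  "(\<Sum>m\<in>UNIV. l m *s (k(j := a)) m) = l j *s a + (\<Sum>m\<in>UNIV - {j}. l m *s k m)"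
  for k :: "'n::finite option \<Rightarrow> bit ^ 'n"
proof -
  have "(\<Sum>m\<in>UNIV - {j}. l m *s (k(j := a)) m) = (\<Sum>m\<in>UNIV - {j}. l m *s k m)"
    by (rule sum.cong) auto
  then show ?thesis
    using sum.remove[of UNIV j "\<lambda>m. l m *s (k(j := a)) m"]
    by (simp only: finite_class.finite_UNIV UNIV_I fun_upd_same)
qed

text \<open>The vectors outside slot \<open>j\<close> form a basis, so a nontrivial relation has
  coefficient 1 at \<open>j\<close>. Two such relations add up to a relation with coefficient 0 at
  \<open>j\<close>, that is, to one among basis vectors.\<close>

lemma nontriv_rel_upd_unique:
  fixes k :: "'n::finite option \<Rightarrow> bit ^ 'n"
  assumes span: "vec.span (k ` (UNIV - {j})) = UNIV" and a: "a = (\<Sum>m\<in>UNIV - {j}. \<mu> m *s k m)"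
  shows "nontriv_rel (k(j := a)) (\<mu>(j := 1))"
    and "nontriv_rel (k(j := a)) l \<Longrightarrow> l = \<mu>(j := 1)"
proof -
  have "(\<Sum>m\<in>UNIV - {j}. (\<mu>(j := 1)) m *s k m) = a"
    unfolding a by (intro sum.cong) auto
  then have rel: "(\<Sum>m\<in>UNIV. (\<mu>(j := 1)) m *s (k(j := a)) m) = 0"
    unfolding sum_fun_upd_split by (simp only: bit_vec_add_eq_0_iff fun_upd_same vec.scale_one)
  moreover have "\<mu>(j := 1) \<noteq> (\<lambda>_. 0)" by (metis fun_upd_same zero_neq_one)
  ultimately show "nontriv_rel (k(j := a)) (\<mu>(j := 1))"
    unfolding nontriv_rel_def by blast
  have zero: "l m = 0"
    if "l j = 0" "(\<Sum>m\<in>UNIV. l m *s (k(j := a)) m) = 0" for l m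
  proof (cases "m = j")
    case False
    have "(\<Sum>m\<in>UNIV - {j}. l m *s k m) = 0"
      using that unfolding sum_fun_upd_split by simp
    then show ?thesis
      using spanning_family_independent[OF _ card_option_remove span, of l m] False by auto
  qed (use that in simp)
  assume l: "nontriv_rel (k(j := a)) l"
  then have "l j \<noteq> 0"
    using zero[of l] unfolding nontriv_rel_def by blast
  then have lj: "l j = 1" by simp
  define d where "d = (\<lambda>m. l m + (\<mu>(j := 1)) m)"
  have "d m = 0" for m
  proof (rule zero)
    show "d j = 0" using lj by (simp add: d_def)
    have "(\<Sum>m\<in>UNIV. d m *s (k(j := a)) m)
        = (\<Sum>m\<in>UNIV. l m *s (k(j := a)) m) + (\<Sum>m\<in>UNIV. (\<mu>(j := 1)) m *s (k(j := a)) m)"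
      by (simp only: d_def vec.scale_left_distrib sum.distrib)
    then show "(\<Sum>m\<in>UNIV. d m *s (k(j := a)) m) = 0"
      using l rel unfolding nontriv_rel_def by simp
  qed
  then show "l = \<mu>(j := 1)"
    unfolding d_def fun_eq_iff by (metis bit_not_zero_iff add.right_neutral add_0)
qed

text \<open>The coefficient 1 of slot \<open>j\<close> in the only relation cancels the summand 1 in
  the definition of \<open>det2\<close>. What is left is the coordinate sum of \<open>a\<close>,
  which is linear in \<open>a\<close>.\<close>

lemma det2_upd_spanning:
  fixes k :: "'n::finite option \<Rightarrow> bit ^ 'n"
  assumes span: "vec.span (k ` (UNIV - {j})) = UNIV" and a: "a = (\<Sum>m\<in>UNIV - {j}. \<mu> m *s k m)"
  shows "det2 (k(j := a)) = (\<Sum>m\<in>UNIV - {j}. \<mu> m)"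
proof -
  have "vec.span (range (k(j := a))) = UNIV"
    unfolding range_fun_upd_image using span
    by (metis subset_insertI top.extremum_uniqueI vec.span_mono)
  then have "det2 (k(j := a)) = (\<Sum>m\<in>UNIV. (\<mu>(j := 1)) m) + 1"
    by (rule det2_eqI[OF _ nontriv_rel_upd_unique[OF assms]])
  also have "\<dots> = (\<Sum>m\<in>UNIV - {j}. \<mu> m)"
    by (subst sum.remove[of UNIV j]) (auto intro!: sum.cong)
  finally show ?thesis .
qed

text \<open>A vector outside the span of the others has coefficient 0 in every relation. The set of
  relations is therefore the same for \<open>a\<close> and \<open>b\<close>.\<close>

lemma det2_upd_cong:
  fixes k :: "'n::finite option \<Rightarrow> bit ^ 'n"
  assumes "a \<notin> vec.span (k ` (UNIV - {j}))" "b \<notin> vec.span (k ` (UNIV - {j}))"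
    and "vec.span (insert a (k ` (UNIV - {j}))) = UNIV \<longleftrightarrow> vec.span (insert b (k ` (UNIV - {j}))) = UNIV"
  shows "det2 (k(j := a)) = det2 (k(j := b))"
proof -
  have "nontriv_rel (k(j := c)) l \<longleftrightarrow>
      l \<noteq> (\<lambda>_. 0) \<and> l j = 0 \<and> (\<Sum>m\<in>UNIV - {j}. l m *s k m) = 0"
    if c: "c \<notin> vec.span (k ` (UNIV - {j}))" for c l
  proof -
    define S where "S = (\<Sum>m\<in>UNIV - {j}. l m *s k m)"
    have S: "S \<in> vec.span (k ` (UNIV - {j}))"
      unfolding S_def by (intro vec.span_sum vec.span_scale vec.span_base) auto
    have "l j = 0" if "l j *s c + S = 0"
    proof (rule ccontr)
      assume "l j \<noteq> 0"
      then have "l j = 1" by simp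
      then have "c = S"
        using that by (simp only: vec.scale_one bit_vec_add_eq_0_iff)
      then show False
        using c S by metis
    qed
    then have "l j *s c + S = 0 \<longleftrightarrow> l j = 0 \<and> S = 0"
      by (metis vec.scale_zero_left add_0)
    then have "(\<Sum>m\<in>UNIV. l m *s (k(j := c)) m) = 0 \<longleftrightarrow>
        l j = 0 \<and> (\<Sum>m\<in>UNIV - {j}. l m *s k m) = 0"
      unfolding sum_fun_upd_split S_def .
    then show ?thesis
      unfolding nontriv_rel_def by blast
  qed
  then have "nontriv_rel (k(j := a)) = nontriv_rel (k(j := b))"
    unfolding fun_eq_iff[of "nontriv_rel _"] using assms(1,2) by blast
  then show ?thesis
    using assms(3) unfolding det2_alt range_fun_upd_image by simp
qed

lemma det2_upd_in_span:
  fixes k :: "'n::finite option \<Rightarrow> bit ^ 'n"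
  assumes "vec.span (k ` (UNIV - {j})) \<noteq> UNIV" "a \<in> vec.span (k ` (UNIV - {j}))"
  shows "det2 (k(j := a)) = 0"
  using assms unfolding det2_alt range_fun_upd_image by (simp add: vec.span_redundant)

lemma det2_upd_not_full:
  fixes k :: "'n::finite option \<Rightarrow> bit ^ 'n"
  assumes "vec.span (insert a (k ` (UNIV - {j}))) \<noteq> UNIV"
  shows "det2 (k(j := a)) = 0"
  using assms unfolding det2_alt range_fun_upd_image by simp

text \<open>Here \<open>M\<close> spans a hyperplane. Modulo 2 its complement is a single coset,
  which contains both \<open>a\<close> and \<open>b\<close>.\<close>

lemma span_insert_UNIV_exchange:
  fixes a b :: "bit ^ 'n"
  assumes a: "vec.span (insert a M) = UNIV" and b: "b \<notin> vec.span M"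
  shows "vec.span (insert b M) = UNIV" "a + b \<in> vec.span M"
proof -
  have "b \<in> vec.span (insert a M)" using a by simp
  then obtain c where c: "b - c *s a \<in> vec.span M"
    by (auto simp: vec.span_breakdown_eq)
  then have "c = 1" using b by (cases c) auto
  then have "b - a \<in> vec.span M" using c by simp
  then show ab: "a + b \<in> vec.span M" by (simp add: bit_vec_minus add.commute)
  have "a \<in> vec.span (insert b M)"
  proof -
    have "a + b \<in> vec.span (insert b M)"
      using ab by (meson subsetD subset_insertI vec.span_mono)
    moreover have "b \<in> vec.span (insert b M)" by (simp add: vec.span_base)
    ultimately show ?thesis
      by (metis add_diff_cancel_right' vec.span_diff)
  qed
  then have "insert a M \<subseteq> vec.span (insert b M)"
    by (auto simp: vec.span_base)
  then show "vec.span (insert b M) = UNIV"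
    by (metis a vec.span_mono vec.span_span top.extremum_uniqueI)
qed

text \<open>
  As a function of one argument, \<^const>\<open>det2\<close> is the sum of the coordinates with respect to the other
  arguments if these form a basis, and otherwise it is constant outside their span and 0 on it.
\<close>

lemma det2_add:
  fixes k :: "'n::finite option \<Rightarrow> bit ^ 'n"
  shows "det2 (k(j := a + b)) = det2 (k(j := a)) + det2 (k(j := b))"
proof (cases "vec.span (k ` (UNIV - {j})) = UNIV")
  case True
  obtain \<mu> where \<mu>: "a = (\<Sum>m\<in>UNIV - {j}. \<mu> m *s k m)"
    using in_span_image_sum[of "UNIV - {j}" a k] True by auto
  obtain \<nu> where \<nu>: "b = (\<Sum>m\<in>UNIV - {j}. \<nu> m *s k m)"
    using in_span_image_sum[of "UNIV - {j}" b k] True by auto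
  have "a + b = (\<Sum>m\<in>UNIV - {j}. (\<mu> m + \<nu> m) *s k m)"
    unfolding \<mu> \<nu> by (simp only: vec.scale_left_distrib sum.distrib)
  from det2_upd_spanning[OF True this] det2_upd_spanning[OF True \<mu>] det2_upd_spanning[OF True \<nu>]
  show ?thesis by (simp only: sum.distrib)
next
  case False
  define M where "M = k ` (UNIV - {j})"
  define D where "D = (\<lambda>c. det2 (k(j := c)))"
  note defs = M_def[symmetric] D_def[symmetric]
  have D_in: "D c = 0" if "c \<in> vec.span M" for c
    using det2_upd_in_span[OF False] that unfolding M_def D_def by blast
  have D_full: "D c = 0" if "vec.span (insert c M) \<noteq> UNIV" for c
    using det2_upd_not_full that unfolding M_def D_def by blast
  have full_iff: "vec.span (insert c M) = UNIV \<longleftrightarrow> vec.span (insert d M) = UNIV"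
    if "c \<notin> vec.span M" "d \<notin> vec.span M" for c d
    using span_insert_UNIV_exchange(1) that by blast
  have D_cong: "D c = D d" if "c \<notin> vec.span M" "d \<notin> vec.span M" for c d
    using det2_upd_cong[of c k j d] full_iff[OF that] that unfolding M_def D_def by blast
  have add_iff: "a + b \<in> vec.span M \<longleftrightarrow> b \<in> vec.span M" if "a \<in> vec.span M" for a b
    using that by (metis add_diff_cancel_left' vec.span_add vec.span_diff)
  have "D (a + b) = D a + D b"
  proof (cases "a \<in> vec.span M \<or> b \<in> vec.span M")
    case True
    then show ?thesis
      using add_iff[of a b] add_iff[of b a] D_in D_cong by (metis add.commute add_0)
  next
    case ab: False
    \<comment> \<open>Both vectors now lie outside the span of \<open>M\<close>. If this span is a
      hyperplane, their sum lies in it and the equal values \<open>D a\<close> and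
      \<open>D b\<close> cancel; otherwise the rank stays below the dimension and all three values
      are 0.\<close>
    show ?thesis
    proof (cases "vec.span (insert a M) = UNIV")
      case True
      then show ?thesis
        using span_insert_UNIV_exchange[of a M b] ab D_in D_cong[of a b]
        by (metis bit_2_eq_0 mult_2 mult_zero_left)
    next
      case f: False
      then show ?thesis
        using full_iff ab D_full D_in[of "a + b"] by (metis add_0)
    qed
  qed
  then show ?thesis by (simp add: D_def)
qed

lemma det2_zero: "k j = 0 \<Longrightarrow> det2 k = 0"
  for k :: "'n::finite option \<Rightarrow> bit ^ 'n"
proof -
  assume "k j = 0"
  then have "k(j := 0) = k" by (metis fun_upd_triv)
  then have "det2 k = det2 k + det2 k"
    using det2_add[of k j 0 0] by (simp only: add_0)
  then show ?thesis by (metis add_cancel_right_right)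
qed

lemma det2_sum:
  fixes k :: "'n::finite option \<Rightarrow> bit ^ 'n"
  assumes "finite I"
  shows "det2 (k(j := (\<Sum>i\<in>I. w i))) = (\<Sum>i\<in>I. det2 (k(j := w i)))"
  using assms
proof (induction I rule: finite_induct)
  case empty
  show ?case unfolding sum.empty by (rule det2_zero[of _ j]) (rule fun_upd_same)
next
  case (insert x F)
  then show ?case by (simp only: sum.insert[OF insert.hyps] det2_add)
qed

lemma det2_orthogonal_eq_0:
  fixes k :: "'n::finite option \<Rightarrow> bit ^ 'n"
  assumes "u \<noteq> 0" "\<And>j. (\<Sum>i\<in>UNIV. u $ i * k j $ i) = 0"
  shows "det2 k = 0"
proof -
  let ?H = "{x. (\<Sum>i\<in>UNIV. u $ i * x $ i) = 0}"
  have "vec.subspace ?H"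
  proof (rule vec.subspaceI; unfold mem_Collect_eq)
    fix x y c
    assume x: "(\<Sum>i\<in>UNIV. u $ i * x $ i) = 0"
    have "(\<Sum>i\<in>UNIV. u $ i * (c *s x) $ i) = c * (\<Sum>i\<in>UNIV. u $ i * x $ i)"
      by (simp only: sum_distrib_left vector_smult_component mult.left_commute)
    then show "(\<Sum>i\<in>UNIV. u $ i * (c *s x) $ i) = 0"
      unfolding x by simp
    assume y: "(\<Sum>i\<in>UNIV. u $ i * y $ i) = 0"
    show "(\<Sum>i\<in>UNIV. u $ i * (x + y) $ i) = 0"
      unfolding vector_add_component distrib_left sum.distrib x y by simp
  qed simp
  then have sub: "vec.span (range k) \<subseteq> ?H"
    using assms(2) by (intro vec.span_minimal) auto
  obtain i where i: "u $ i \<noteq> 0" using assms(1) by (auto simp: vec_eq_iff)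
  have "axis i 1 \<notin> ?H"
    using i by (simp add: axis_def if_distrib[of "\<lambda>z. _ * z"] cong: if_cong)
  then have "vec.span (range k) \<noteq> UNIV" using sub by blast
  then show ?thesis by (simp add: det2_alt)
qed

text \<open>There is one vector more than the dimension, hence a relation. A slot with nonzero
  coefficient is redundant, so the other slots form a basis and the uniqueness for an updated slot
  applies.\<close>

lemma nontriv_rel_exists_unique:
  fixes k :: "'n::finite option \<Rightarrow> bit ^ 'n"
  assumes span: "vec.span (range k) = UNIV"
  shows "\<exists>!l. nontriv_rel k l"
proof -
  have "vec.dim (range k) < CARD('n option)"
    using dim_subset_UNIV_cart_gen[of "range k"] by (simp add: card_UNIV_option)
  then obtain l where l: "\<exists>i. l i \<noteq> 0" "(\<Sum>i\<in>UNIV. l i *s k i) = 0"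
    using nontrivial_relation[of UNIV k] by auto
  then obtain j where j: "l j \<noteq> 0" by blast
  have kj: "k j = (\<Sum>m\<in>UNIV - {j}. l m *s k m)"
  proof -
    have "k j + (\<Sum>m\<in>UNIV - {j}. l m *s k m) = 0"
      using l(2) j by (simp add: sum.remove[of UNIV j])
    then show ?thesis
      by (simp only: bit_vec_add_eq_0_iff)
  qed
  then have "k j \<in> vec.span (k ` (UNIV - {j}))"
    by (metis (mono_tags, lifting) imageI vec.span_base vec.span_scale vec.span_sum)
  then have "vec.span (k ` (UNIV - {j})) = UNIV"
    using span by (metis image_insert insert_Diff UNIV_I vec.span_redundant)
  from nontriv_rel_upd_unique[OF this kj] show ?thesis
    by (metis fun_upd_triv)
qed

text \<open>Composition with \<pi> carries the unique relation of \<open>k\<close> to that of the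
  permuted family and keeps the sum of its coefficients.\<close>

lemma det2_permute:
  fixes k :: "'n::finite option \<Rightarrow> bit ^ 'n"
  assumes \<pi>: "bij \<pi>"
  shows "det2 (k \<circ> \<pi>) = det2 k"
proof (cases "vec.span (range k) = UNIV")
  case True
  have range: "range (k \<circ> \<pi>) = range k"
    using \<pi> by (metis bij_is_surj fun.set_map image_comp)
  from nontriv_rel_exists_unique[OF True] obtain l where
    l: "nontriv_rel k l" "\<And>l'. nontriv_rel k l' \<Longrightarrow> l' = l" by blast
  have shift: "nontriv_rel k l' \<longleftrightarrow> nontriv_rel (k \<circ> \<pi>) (l' \<circ> \<pi>)" for l'
  proof -
    have "(\<Sum>j\<in>UNIV. l' j *s k j) = (\<Sum>j\<in>UNIV. (l' \<circ> \<pi>) j *s (k \<circ> \<pi>) j)"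
      unfolding o_def by (rule sum.reindex_bij_betw[OF \<pi>, symmetric])
    moreover have "l' = (\<lambda>_. 0) \<longleftrightarrow> l' \<circ> \<pi> = (\<lambda>_. 0)"
      using \<pi> by (metis (mono_tags, lifting) bij_pointE comp_apply ext)
    ultimately show ?thesis unfolding nontriv_rel_def by simp
  qed
  have "det2 (k \<circ> \<pi>) = (\<Sum>j\<in>UNIV. (l \<circ> \<pi>) j) + 1"
  proof (rule det2_eqI)
    show "vec.span (range (k \<circ> \<pi>)) = UNIV" using True range by simp
    show "nontriv_rel (k \<circ> \<pi>) (l \<circ> \<pi>)" using l shift by blast
    fix l' assume l': "nontriv_rel (k \<circ> \<pi>) l'"
    have "l' = (l' \<circ> inv \<pi>) \<circ> \<pi>"
      using \<pi> by (simp add: o_assoc[symmetric] bij_is_inj)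
    then show "l' = l \<circ> \<pi>" using l' l(2) shift by metis
  qed
  also have "(\<Sum>j\<in>UNIV. (l \<circ> \<pi>) j) = (\<Sum>j\<in>UNIV. l j)"
    unfolding o_def by (rule sum.reindex_bij_betw[OF \<pi>])
  also have "(\<Sum>j\<in>UNIV. l j) + 1 = det2 k"
    using det2_eqI[OF True l] by simp
  finally show ?thesis .
next
  case False
  have "range (k \<circ> \<pi>) = range k"
    using \<pi> by (metis bij_is_surj fun.set_map image_comp)
  then show ?thesis using False by (simp add: det2_alt)
qed

subsection \<open>Integer vectors\<close>

lemma real_vec_add: "real_vec (a + b) = real_vec a + real_vec b"
  by (simp add: real_vec_def vec_eq_iff)

lemma real_vec_eq_iff: "real_vec a = real_vec b \<longleftrightarrow> a = b"
  by (simp add: real_vec_def vec_eq_iff)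

lemma inner_real_vec: "real_vec a \<bullet> real_vec b = of_int (scalar_product a b)"
  by (simp add: real_vec_def inner_vec_def scalar_product_def)

lemma mod2_vec_add: "mod2_vec (a + b) = mod2_vec a + mod2_vec b"
  by (simp only: mod2_vec_def vec_eq_iff vec_lambda_beta vector_add_component of_int_add) simp

lemma mod2_vec_diff: "mod2_vec (a - b) = mod2_vec a + mod2_vec b"
  by (simp only: mod2_vec_def vec_eq_iff vec_lambda_beta vector_add_component vector_minus_component
      of_int_diff minus_bit_def) simp

lemma of_nat_bit_eq: "(of_nat m :: bit) = of_bool (odd m)"
  by (induction m) auto

lemma of_int_bit_eq_0_iff: "(of_int z :: bit) = 0 \<longleftrightarrow> even z"
proof -
  have "even z" if "(of_int z :: bit) = 0"
  proof (rule ccontr)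
    assume "odd z"
    then obtain w where "z = 2 * w + 1" by (rule oddE)
    then show False using that by simp
  qed
  then show ?thesis by auto
qed

lemma mod2_vec_eq_iff: "mod2_vec a = mod2_vec b \<longleftrightarrow> (\<forall>i. a $ i mod 2 = b $ i mod 2)"
proof -
  have "(of_int x :: bit) = of_int y \<longleftrightarrow> x mod 2 = y mod 2" for x y
  proof -
    have "(of_int x :: bit) = of_int y \<longleftrightarrow> (of_int (x - y) :: bit) = 0"
      by (simp only: of_int_diff right_minus_eq)
    also have "\<dots> \<longleftrightarrow> x mod 2 = y mod 2"
      unfolding of_int_bit_eq_0_iff by presburger
    finally show ?thesis .
  qed
  then show ?thesis by (simp add: mod2_vec_def vec_eq_iff)
qed

lemma inner_mod2_vec: "(\<Sum>i\<in>UNIV. mod2_vec a $ i * mod2_vec b $ i) = of_int (scalar_product a b)"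
  by (simp only: mod2_vec_def scalar_product_def vec_lambda_beta of_int_sum of_int_mult)

subsection \<open>Independent tuples\<close>

text \<open>For finite blocks this is linear independence of the vectors (e_i, a) with
  \<open>a\<close> in \<open>V i\<close>, as in the Cayley trick. It says that every block is
  affinely independent and that the blocks are independent of each other.\<close>

definition indep_tuple :: "('n::finite \<Rightarrow> (int ^ 'n) set) \<Rightarrow> bool" where
  "indep_tuple V \<longleftrightarrow>
     (\<forall>\<mu>. (\<forall>i. (\<Sum>a\<in>V i. \<mu> i a) = 0) \<and> (\<Sum>i\<in>UNIV. \<Sum>a\<in>V i. \<mu> i a *\<^sub>R real_vec a) = 0
        \<longrightarrow> (\<forall>i. \<forall>a\<in>V i. \<mu> i a = (0::real)))"

definition diff_index :: "('n \<Rightarrow> 'a set) \<Rightarrow> ('n \<Rightarrow> 'a) \<Rightarrow> ('n \<times> 'a) set" where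
  "diff_index V p = (SIGMA i:UNIV. V i - {p i})"

definition diff_vec :: "('n \<Rightarrow> int ^ 'n) \<Rightarrow> 'n \<times> (int ^ 'n) \<Rightarrow> real ^ 'n::finite" where
  "diff_vec p m = real_vec (snd m) - real_vec (p (fst m))"

lemma finite_diff_index: "(\<And>i. finite (V i)) \<Longrightarrow> finite (diff_index V p)" for V :: "'n::finite \<Rightarrow> _"
  by (auto simp: diff_index_def)

lemma card_diff_index:
  fixes V :: "'n::finite \<Rightarrow> 'a set"
  assumes "\<And>i. finite (V i)" "\<And>i. p i \<in> V i"
  shows "card (diff_index V p) = (\<Sum>i\<in>UNIV. card (V i) - 1)"
  using assms by (simp add: diff_index_def card_Diff_singleton)

text \<open>A relation among differences to base points becomes one of the kind in
  \<open>indep_tuple\<close> when \<open>p i\<close> receives minus the sum of the other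
  coefficients of its block.\<close>

lemma indep_tuple_diff:
  assumes V: "indep_tuple V" and fin: "\<And>i. finite (V i)" and p: "\<And>i. p i \<in> V i"
    and rel: "(\<Sum>m\<in>diff_index V p. \<nu> m *\<^sub>R diff_vec p m) = 0" and m: "m \<in> diff_index V p"
  shows "\<nu> m = 0"
proof -
  define \<mu> where "\<mu> = (\<lambda>i a. if a = p i then - (\<Sum>b\<in>V i - {p i}. \<nu> (i, b)) else \<nu> (i, a))"
  have split: "(\<Sum>a\<in>V i. g a) = g (p i) + (\<Sum>a\<in>V i - {p i}. g a)" for i and g :: "_ \<Rightarrow> 'b::ab_group_add"
    by (rule sum.remove[OF fin p])
  have sum0: "(\<Sum>a\<in>V i. \<mu> i a) = 0" for i
    unfolding split by (simp add: \<mu>_def)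
  have "(\<Sum>a\<in>V i. \<mu> i a *\<^sub>R real_vec a) = (\<Sum>a\<in>V i - {p i}. \<nu> (i, a) *\<^sub>R diff_vec p (i, a))" for i
    unfolding split
    by (simp add: \<mu>_def diff_vec_def scaleR_right_diff_distrib sum_subtractf scaleR_sum_left)
  then have "(\<Sum>i\<in>UNIV. \<Sum>a\<in>V i. \<mu> i a *\<^sub>R real_vec a) = (\<Sum>m\<in>diff_index V p. \<nu> m *\<^sub>R diff_vec p m)"
    using fin by (simp add: diff_index_def sum.Sigma split_def)
  then have "\<forall>i. \<forall>a\<in>V i. \<mu> i a = 0"
    using V sum0 rel unfolding indep_tuple_def by simp
  then show ?thesis
    using m by (cases m) (force simp: diff_index_def \<mu>_def)
qed

lemma real_relation:
  fixes w :: "'i \<Rightarrow> real ^ 'n"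
  assumes "finite I" "dim (w ` I) < card I"
  obtains \<mu> where "\<exists>i\<in>I. \<mu> i \<noteq> 0" "(\<Sum>i\<in>I. \<mu> i *\<^sub>R w i) = 0"
proof -
  have "vec.dim (w ` I) < card I" using assms(2) by (simp add: dim_vec_eq)
  from nontrivial_relation[OF assms(1) this] show ?thesis
    using that by (auto simp: scalar_mult_eq_scaleR)
qed

lemma dim_orthogonal_less:
  fixes u :: "real ^ 'n"
  assumes "u \<noteq> 0" "\<And>w. w \<in> S \<Longrightarrow> u \<bullet> w = 0"
  shows "dim S < CARD('n)"
proof -
  have "dim S \<le> dim {x. u \<bullet> x = 0}"
    using assms by (intro dim_subset) auto
  also have "\<dots> = CARD('n) - 1"
    using assms(1) by (simp add: dim_hyperplane)
  finally show ?thesis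
    using zero_less_card_finite[where 'a = 'n] by linarith
qed

text \<open>These are the directions in which a point can move while the ties inside each block
  persist: the linear space parallel to the cell labelled \<open>V\<close>.\<close>

definition orth_tuple :: "real ^ 'n \<Rightarrow> ('n::finite \<Rightarrow> (int ^ 'n) set) \<Rightarrow> bool" where
  "orth_tuple u V \<longleftrightarrow> (\<forall>i. \<forall>a\<in>V i. \<forall>b\<in>V i. u \<bullet> real_vec a = u \<bullet> real_vec b)"

lemma orth_tuple_diff_vec:
  "orth_tuple u V \<Longrightarrow> (\<And>i. p i \<in> V i) \<Longrightarrow> m \<in> diff_index V p \<Longrightarrow> u \<bullet> diff_vec p m = 0"
  unfolding orth_tuple_def diff_index_def diff_vec_def inner_diff_right
  by (cases m) (auto)

text \<open>The sum counts linearly independent difference vectors in a space of dimension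
  \<open>CARD('n)\<close>. The next lemma is the same count inside the hyperplane orthogonal to
  \<open>u\<close>.\<close>

lemma indep_tuple_card_le:
  fixes V :: "'n::finite \<Rightarrow> (int ^ 'n) set"
  assumes V: "indep_tuple V" and fin: "\<And>i. finite (V i)" and ne: "\<And>i. V i \<noteq> {}"
  shows "(\<Sum>i\<in>UNIV. card (V i) - 1) \<le> CARD('n)"
proof (rule ccontr)
  assume less: "\<not> ?thesis"
  obtain p where p: "\<And>i. p i \<in> V i"
    using that[of "\<lambda>i. SOME a. a \<in> V i"] ne by (simp add: some_in_eq)
  have "dim (diff_vec p ` diff_index V p) < card (diff_index V p)"
    using less dim_subset_UNIV_cart[of "diff_vec p ` diff_index V p"]
    unfolding card_diff_index[OF fin p] by linarith
  from real_relation[OF finite_diff_index[OF fin] this] obtain \<nu>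
    where "\<exists>m\<in>diff_index V p. \<nu> m \<noteq> 0" "(\<Sum>m\<in>diff_index V p. \<nu> m *\<^sub>R diff_vec p m) = 0" .
  then show False using indep_tuple_diff[OF V fin p] by blast
qed

lemma indep_tuple_card_less:
  fixes V :: "'n::finite \<Rightarrow> (int ^ 'n) set"
  assumes V: "indep_tuple V" and fin: "\<And>i. finite (V i)" and ne: "\<And>i. V i \<noteq> {}"
    and u: "u \<noteq> 0" "orth_tuple u V"
  shows "(\<Sum>i\<in>UNIV. card (V i) - 1) < CARD('n)"
proof (rule ccontr)
  assume less: "\<not> ?thesis"
  obtain p where p: "\<And>i. p i \<in> V i"
    using that[of "\<lambda>i. SOME a. a \<in> V i"] ne by (simp add: some_in_eq)
  have "dim (diff_vec p ` diff_index V p) < CARD('n)"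
    using u(1) orth_tuple_diff_vec[OF u(2) p] by (intro dim_orthogonal_less) auto
  then have "dim (diff_vec p ` diff_index V p) < card (diff_index V p)"
    using less unfolding card_diff_index[OF fin p] by linarith
  from real_relation[OF finite_diff_index[OF fin] this] obtain \<nu>
    where "\<exists>m\<in>diff_index V p. \<nu> m \<noteq> 0" "(\<Sum>m\<in>diff_index V p. \<nu> m *\<^sub>R diff_vec p m) = 0" .
  then show False using indep_tuple_diff[OF V fin p] by blast
qed

text \<open>At least \<open>CARD('n) - 1\<close> independent differences leave at most a line of
  directions orthogonal to all of them. This is what makes edges of the curve
  one-dimensional.\<close>

lemma indep_tuple_orth_unique:
  fixes V :: "'n::finite \<Rightarrow> (int ^ 'n) set"
  assumes V: "indep_tuple V" and fin: "\<And>i. finite (V i)" and ne: "\<And>i. V i \<noteq> {}"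
    and card: "CARD('n) \<le> Suc (\<Sum>i\<in>UNIV. card (V i) - 1)"
    and v: "v \<noteq> 0" "orth_tuple v V" and y: "orth_tuple y V"
  obtains c where "y = c *\<^sub>R v"
proof -
  obtain p where p: "\<And>i. p i \<in> V i"
    using that[of "\<lambda>i. SOME a. a \<in> V i"] ne by (simp add: some_in_eq)
  let ?D = "diff_index V p"
  define c where "c = (y \<bullet> v) / (v \<bullet> v)"
  \<comment> \<open>The component of \<open>y\<close> orthogonal to \<open>v\<close>. If it were
    nonzero, \<open>v\<close> and all the differences would lie in its orthogonal hyperplane, too
    many independent vectors for it.\<close>
  define z where "z = y - c *\<^sub>R v"
  have zv: "z \<bullet> v = 0" using v(1) by (simp add: z_def c_def inner_diff_left)
  have zd: "z \<bullet> diff_vec p m = 0" if "m \<in> ?D" for m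
    using orth_tuple_diff_vec[OF v(2) p that] orth_tuple_diff_vec[OF y p that]
    by (simp add: z_def inner_diff_left)
  have "z = 0"
  proof (rule ccontr)
    assume z: "z \<noteq> 0"
    define w where "w = (\<lambda>m. case m of None \<Rightarrow> v | Some m \<Rightarrow> diff_vec p m)"
    have finD: "finite ?D" by (rule finite_diff_index[OF fin])
    let ?I = "insert None (Some ` ?D)"
    have "dim (w ` ?I) < CARD('n)"
      using z zv zd by (intro dim_orthogonal_less[of z]) (auto simp: w_def)
    also have "CARD('n) \<le> card ?I"
      using card finD by (simp add: card_image card_diff_index[OF fin p])
    finally obtain \<mu> where \<mu>: "\<exists>i\<in>?I. \<mu> i \<noteq> 0" "(\<Sum>i\<in>?I. \<mu> i *\<^sub>R w i) = 0"
      using real_relation[of ?I w] finD by blast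
    have rel: "\<mu> None *\<^sub>R v + (\<Sum>m\<in>?D. \<mu> (Some m) *\<^sub>R diff_vec p m) = 0"
      using \<mu>(2) finD by (simp add: sum.reindex w_def)
    have "\<mu> None * (v \<bullet> v) + (\<Sum>m\<in>?D. \<mu> (Some m) * (v \<bullet> diff_vec p m)) = 0"
      using arg_cong[OF rel, of "\<lambda>x. v \<bullet> x"] by (simp add: inner_add_right inner_sum_right)
    then have none: "\<mu> None = 0"
      using v(1) orth_tuple_diff_vec[OF v(2) p] by simp
    then have "\<mu> (Some m) = 0" if "m \<in> ?D" for m
      using indep_tuple_diff[OF V fin p, of "\<lambda>m. \<mu> (Some m)"] rel that by simp
    then show False using \<mu>(1) none by auto
  qed
  then show ?thesis using that[of c] by (simp add: z_def)
qed

text \<open>The difference belonging to \<open>b\<close> is not in the span of the others. Minus its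
  component orthogonal to that span is a direction that keeps all other ties and makes
  \<open>b\<close> fall behind the rest of its block.\<close>

lemma indep_tuple_separate:
  fixes V :: "'n::finite \<Rightarrow> (int ^ 'n) set"
  assumes V: "indep_tuple V" and fin: "\<And>i. finite (V i)" and ne: "\<And>i. V i \<noteq> {}"
    and b: "b \<in> V i" and two: "V i - {b} \<noteq> {}"
  obtains y where "orth_tuple y (V(i := V i - {b}))"
    "\<And>a. a \<in> V i - {b} \<Longrightarrow> y \<bullet> real_vec b < y \<bullet> real_vec a"
proof -
  \<comment> \<open>The base point of block \<open>i\<close> is chosen different from
    \<open>b\<close>, so that \<open>b\<close> occurs among the differences.\<close>
  have "\<exists>p. \<forall>m. p m \<in> (V(i := V i - {b})) m"
    using ne two by (intro choice) auto
  then obtain p where P: "\<And>m. p m \<in> (V(i := V i - {b})) m" by blast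
  have p: "p m \<in> V m" for m using P[of m] by (cases "m = i") auto
  have pb: "p i \<noteq> b" using P[of i] by auto
  let ?D = "diff_index V p"
  have finD: "finite ?D" by (rule finite_diff_index[OF fin])
  have ib: "(i, b) \<in> ?D" using b pb by (auto simp: diff_index_def)
  let ?S = "diff_vec p ` (?D - {(i, b)})"
  have notin: "diff_vec p (i, b) \<notin> span ?S"
  proof
    assume "diff_vec p (i, b) \<in> span ?S"
    then have "diff_vec p (i, b) \<in> vec.span ?S" by (simp add: span_vec_eq)
    then obtain \<mu> where "diff_vec p (i, b) = (\<Sum>m\<in>?D - {(i, b)}. \<mu> m *\<^sub>R diff_vec p m)"
      using in_span_image_sum[of "?D - {(i, b)}" "diff_vec p (i, b)" "diff_vec p"] finD
      by (auto simp: scalar_mult_eq_scaleR)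
    then have "(\<Sum>m\<in>?D. (\<mu>((i, b) := - 1)) m *\<^sub>R diff_vec p m) = 0"
      by (simp add: sum.remove[OF finD ib])
    from indep_tuple_diff[OF V fin p this ib] show False by simp
  qed
  obtain q z where q: "q \<in> span ?S" and z: "\<And>w. w \<in> span ?S \<Longrightarrow> orthogonal z w"
    and qz: "diff_vec p (i, b) = q + z"
    using orthogonal_subspace_decomp_exists[of ?S "diff_vec p (i, b)"] by metis
  have "z \<noteq> 0" using q qz notin by auto
  have zb: "z \<bullet> diff_vec p (i, b) > 0"
    using z[OF q] \<open>z \<noteq> 0\<close> by (simp add: qz inner_add_right orthogonal_def)
  have zp: "z \<bullet> real_vec a = z \<bullet> real_vec (p m)" if "a \<in> V m" "(m, a) \<noteq> (i, b)" for m a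
  proof (cases "a = p m")
    case False
    then have "diff_vec p (m, a) \<in> span ?S"
      using that by (intro span_base imageI) (auto simp: diff_index_def)
    from z[OF this] show ?thesis by (simp add: orthogonal_def diff_vec_def inner_diff_right)
  qed simp
  show ?thesis
  proof (rule that[of "- z"])
    show "orth_tuple (- z) (V(i := V i - {b}))"
      unfolding orth_tuple_def
    proof (intro allI ballI)
      fix m a c assume "a \<in> (V(i := V i - {b})) m" "c \<in> (V(i := V i - {b})) m"
      then have "a \<in> V m" "(m, a) \<noteq> (i, b)" "c \<in> V m" "(m, c) \<noteq> (i, b)"
        by (auto split: if_splits)
      then show "- z \<bullet> real_vec a = - z \<bullet> real_vec c" using zp by simp
    qed
    show "- z \<bullet> real_vec b < - z \<bullet> real_vec a" if "a \<in> V i - {b}" for a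
      using that zb zp[of a i] by (simp add: diff_vec_def inner_diff_right)
  qed
qed

text \<open>A common nonzero integral normal of n - 1 vectors exists by linear algebra over the
  rationals. One of least l1-norm has an odd entry, since otherwise it could be halved. The odd
  entry keeps the normal nonzero modulo 2.\<close>

lemma primitive_normal:
  fixes k :: "'n::finite \<Rightarrow> int ^ 'n"
  obtains v where "\<exists>i. odd (v $ i)" "\<And>i. i \<noteq> j \<Longrightarrow> scalar_product v (k i) = 0"
proof -
  \<comment> \<open>The zero row in place \<open>j\<close> makes the matrix singular; a kernel
    vector is orthogonal to the remaining rows.\<close>
  define M :: "rat ^ 'n ^ 'n" where "M = (\<chi> i m. if i = j then 0 else of_int (k i $ m))"
  have "row j M = 0" by (simp add: M_def row_def vec_eq_iff)
  then have "det M = 0" by (rule det_zero_row(1))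
  then have "\<not> invertible M" by (simp add: invertible_det_nz)
  then obtain x where x: "M *v x = 0" "x \<noteq> 0"
    unfolding invertible_left_inverse matrix_left_invertible_ker by blast
  \<comment> \<open>The product of all denominators of the kernel vector, so that scaling by it
    gives an integral vector.\<close>
  define d where "d = (\<Prod>i\<in>UNIV. snd (quotient_of (x $ i)))"
  have dpos: "d > 0" unfolding d_def by (intro prod_pos) (simp add: quotient_of_denom_pos')
  have "\<exists>z. of_int d * x $ i = of_int z" for i
  proof -
    have "d = snd (quotient_of (x $ i)) * (\<Prod>m\<in>UNIV - {i}. snd (quotient_of (x $ m)))"
      unfolding d_def by (rule prod.remove) auto
    moreover have "of_int (snd (quotient_of (x $ i))) * x $ i = of_int (fst (quotient_of (x $ i)))"
      using quotient_of_div[of "x $ i" "fst (quotient_of (x $ i))" "snd (quotient_of (x $ i))"]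
        quotient_of_denom_pos'[of "x $ i"] by (simp add: field_simps)
    ultimately show ?thesis
      by (metis (no_types, lifting) mult.assoc mult.commute of_int_mult)
  qed
  then obtain w where w: "\<And>i. of_int d * x $ i = of_int (w i)" by metis
  let ?good = "\<lambda>v :: int ^ 'n. v \<noteq> 0 \<and> (\<forall>i. i \<noteq> j \<longrightarrow> scalar_product v (k i) = 0)"
  have "?good (\<chi> i. w i)"
  proof (intro conjI allI impI)
    obtain i where "x $ i \<noteq> 0" using x(2) by (auto simp: vec_eq_iff)
    then have "of_int (w i) \<noteq> (0::rat)" using w[of i] dpos by (metis mult_eq_0_iff of_int_eq_0_iff less_irrefl)
    then show "(\<chi> i. w i) \<noteq> 0" by (auto simp: vec_eq_iff)
    fix i assume "i \<noteq> j"
    then have "(\<Sum>m\<in>UNIV. of_int (k i $ m) * x $ m) = 0"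
      using arg_cong[OF x(1), of "\<lambda>y. y $ i"] by (simp add: matrix_vector_mult_def M_def)
    then have "0 = (\<Sum>m\<in>UNIV. of_int d * (of_int (k i $ m) * x $ m))"
      by (simp flip: sum_distrib_left)
    also have "\<dots> = (\<Sum>m\<in>UNIV. of_int (w m) * of_int (k i $ m))"
      by (simp flip: w add: mult_ac)
    also have "\<dots> = of_int (scalar_product (\<chi> i. w i) (k i))"
      by (simp add: scalar_product_def)
    finally show "scalar_product (\<chi> i. w i) (k i) = 0" by (metis of_int_0_eq_iff)
  qed
  then obtain v where v: "?good v"
    and min: "\<And>u. ?good u \<Longrightarrow> (\<Sum>i\<in>UNIV. nat \<bar>v $ i\<bar>) \<le> (\<Sum>i\<in>UNIV. nat \<bar>u $ i\<bar>)"
    using ex_has_least_nat[of ?good "\<chi> i. w i" "\<lambda>v. \<Sum>i\<in>UNIV. nat \<bar>v $ i\<bar>"] by blast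
  have "\<exists>i. odd (v $ i)"
  proof (rule ccontr)
    assume "\<not> ?thesis"
    then have ev: "v $ i = 2 * (v $ i div 2)" for i by simp
    define u where "u = (\<chi> i. v $ i div 2)"
    have vu: "v $ i = 2 * u $ i" for i using ev[of i] by (simp add: u_def)
    have "scalar_product v a = 2 * scalar_product u a" for a
      by (simp add: scalar_product_def vu sum_distrib_left mult.assoc)
    then have "?good u" using v vu by (auto simp: vec_eq_iff)
    then have "(\<Sum>i\<in>UNIV. nat \<bar>v $ i\<bar>) \<le> (\<Sum>i\<in>UNIV. nat \<bar>u $ i\<bar>)" by (rule min)
    also have "\<dots> < (\<Sum>i\<in>UNIV. nat \<bar>v $ i\<bar>)"
    proof (rule sum_strict_mono_ex1)
      obtain i where "v $ i \<noteq> 0" using v by (auto simp: vec_eq_iff)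
      then show "\<exists>i\<in>UNIV. nat \<bar>u $ i\<bar> < nat \<bar>v $ i\<bar>"
        using vu[of i] by (intro bexI[of _ i]) auto
    qed (use vu in auto)
    finally show False by simp
  qed
  then show ?thesis using that v by blast
qed

subsection \<open>Local supports\<close>

definition trop_val :: "'n::finite trop_poly \<Rightarrow> int ^ 'n \<Rightarrow> real ^ 'n \<Rightarrow> real" where
  "trop_val \<phi> a x = trop_coeff \<phi> a + real_vec a \<bullet> x"

lemma trop_val_line: "trop_val \<phi> a (x + s *\<^sub>R y) = trop_val \<phi> a x + s * (y \<bullet> real_vec a)"
  by (simp add: trop_val_def inner_add_right inner_commute)

lemma trop_val_diff: "trop_val \<phi> a x - trop_val \<phi> a y = (x - y) \<bullet> real_vec a"
  by (simp add: trop_val_def inner_diff_left inner_diff_right inner_commute)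

lemma local_support_subset: "local_support \<phi> x \<subseteq> trop_support \<phi>"
  by (auto simp: local_support_def)

lemma in_local_support_iff:
  assumes "finite (trop_support \<phi>)"
  shows "a \<in> local_support \<phi> x \<longleftrightarrow>
    a \<in> trop_support \<phi> \<and> (\<forall>b\<in>trop_support \<phi>. trop_val \<phi> b x \<le> trop_val \<phi> a x)"
proof (cases "a \<in> trop_support \<phi>")
  case True
  let ?f = "\<lambda>a. trop_coeff \<phi> a + real_vec a \<bullet> x"
  have "?f a = Max (?f ` trop_support \<phi>) \<longleftrightarrow> (\<forall>b\<in>trop_support \<phi>. ?f b \<le> ?f a)"
    using assms True by (subst eq_commute, subst Max_eq_iff) auto
  then show ?thesis
    using True by (simp add: local_support_def trop_eval_def trop_val_def)
qed (auto simp: local_support_def)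

lemma local_support_nonempty:
  assumes "finite (trop_support \<phi>)" "trop_support \<phi> \<noteq> {}"
  shows "local_support \<phi> x \<noteq> {}"
proof -
  let ?M = "Max ((\<lambda>a. trop_val \<phi> a x) ` trop_support \<phi>)"
  have "?M \<in> (\<lambda>a. trop_val \<phi> a x) ` trop_support \<phi>"
    using assms by (intro Max_in) auto
  then obtain a where a: "a \<in> trop_support \<phi>" "?M = trop_val \<phi> a x" by auto
  have "trop_val \<phi> b x \<le> trop_val \<phi> a x" if "b \<in> trop_support \<phi>" for b
    using Max_ge[of "(\<lambda>a. trop_val \<phi> a x) ` trop_support \<phi>" "trop_val \<phi> b x"] assms(1) that a(2)
    by auto
  then have "a \<in> local_support \<phi> x" using a(1) assms(1) by (simp add: in_local_support_iff)
  then show ?thesis by blast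
qed

lemma local_support_val_eq:
  assumes "finite (trop_support \<phi>)" "a \<in> local_support \<phi> x" "b \<in> local_support \<phi> x"
  shows "trop_val \<phi> a x = trop_val \<phi> b x"
  using assms by (force simp: in_local_support_iff)

lemma local_support_val_less:
  assumes "finite (trop_support \<phi>)" "a \<in> local_support \<phi> x" "b \<in> trop_support \<phi> - local_support \<phi> x"
  shows "trop_val \<phi> b x < trop_val \<phi> a x"
  using assms by (simp add: in_local_support_iff) (meson less_le_trans not_less order_trans)

lemma local_support_eqI:
  assumes "finite (trop_support \<phi>)" "V \<subseteq> trop_support \<phi>" "V \<noteq> {}"
    and "\<And>a b. a \<in> V \<Longrightarrow> b \<in> V \<Longrightarrow> trop_val \<phi> a x = trop_val \<phi> b x"
    and "\<And>a b. a \<in> V \<Longrightarrow> b \<in> trop_support \<phi> - V \<Longrightarrow> trop_val \<phi> b x < trop_val \<phi> a x"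
  shows "local_support \<phi> x = V"
proof
  show "V \<subseteq> local_support \<phi> x"
  proof
    fix a assume a: "a \<in> V"
    have "trop_val \<phi> b x \<le> trop_val \<phi> a x" if "b \<in> trop_support \<phi>" for b
      using assms(4)[OF a, of b] assms(5)[OF a, of b] that by (cases "b \<in> V") auto
    then show "a \<in> local_support \<phi> x"
      using a assms(1,2) by (auto simp: in_local_support_iff)
  qed
  show "local_support \<phi> x \<subseteq> V"
  proof (rule ccontr)
    assume "\<not> ?thesis"
    then obtain b where b: "b \<in> local_support \<phi> x" "b \<notin> V" by blast
    obtain a where a: "a \<in> V" using assms(3) by blast
    have "trop_val \<phi> b x < trop_val \<phi> a x"
      using assms(5)[OF a, of b] b local_support_subset by blast
    moreover have "a \<in> trop_support \<phi>" using a assms(2) by blast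
    ultimately show False
      using b assms(1) by (meson in_local_support_iff not_less)
  qed
qed

text \<open>Only finitely many comparisons are involved, so they hold simultaneously. Both the
  polynomial and the point may vary with \<open>t\<close>: this covers a moving point of a fixed
  tuple as well as perturbed coefficients.\<close>

lemma eventually_local_support_eq:
  assumes fin: "finite A" and sub: "V \<subseteq> A" "V \<noteq> {}" and A: "\<And>t. trop_support (\<phi> t) = A"
    and eq: "\<And>a b. a \<in> V \<Longrightarrow> b \<in> V \<Longrightarrow> \<forall>\<^sub>F t in G. trop_val (\<phi> t) a (x t) = trop_val (\<phi> t) b (x t)"
    and less: "\<And>a b. a \<in> V \<Longrightarrow> b \<in> A - V \<Longrightarrow> \<forall>\<^sub>F t in G. trop_val (\<phi> t) b (x t) < trop_val (\<phi> t) a (x t)"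
  shows "\<forall>\<^sub>F t in G. local_support (\<phi> t) (x t) = V"
proof -
  have finV: "finite V" using fin sub finite_subset by blast
  have "\<forall>\<^sub>F t in G. \<forall>a\<in>V. \<forall>b\<in>V. trop_val (\<phi> t) a (x t) = trop_val (\<phi> t) b (x t)"
    using finV eq by (intro eventually_ball_finite ballI) auto
  moreover have "\<forall>\<^sub>F t in G. \<forall>a\<in>V. \<forall>b\<in>A - V. trop_val (\<phi> t) b (x t) < trop_val (\<phi> t) a (x t)"
    using finV fin less by (intro eventually_ball_finite ballI) auto
  ultimately show ?thesis
  proof eventually_elim
    case (elim t)
    show ?case
    proof (rule local_support_eqI)
      show "finite (trop_support (\<phi> t))" "V \<subseteq> trop_support (\<phi> t)" "V \<noteq> {}"
        using fin sub A by simp_all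
      show "trop_val (\<phi> t) a (x t) = trop_val (\<phi> t) b (x t)" if "a \<in> V" "b \<in> V" for a b
        using elim that by blast
      show "trop_val (\<phi> t) b (x t) < trop_val (\<phi> t) a (x t)"
        if "a \<in> V" "b \<in> trop_support (\<phi> t) - V" for a b
        using elim that A by blast
    qed
  qed
qed

definition proper_tuple :: "('n::finite \<Rightarrow> 'n trop_poly) \<Rightarrow> bool" where
  "proper_tuple F \<longleftrightarrow> (\<forall>i. finite (trop_support (F i)) \<and> trop_support (F i) \<noteq> {})"

text \<open>The values label the cells of the subdivision of the space that all the hypersurfaces
  produce together.\<close>

definition supp_tuple :: "('n::finite \<Rightarrow> 'n trop_poly) \<Rightarrow> real ^ 'n \<Rightarrow> 'n \<Rightarrow> (int ^ 'n) set" where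
  "supp_tuple F x = (\<lambda>i. local_support (F i) x)"

lemma supp_tuple_apply: "supp_tuple F x i = local_support (F i) x"
  by (simp add: supp_tuple_def)

lemma finite_supp_tuple: "proper_tuple F \<Longrightarrow> finite (supp_tuple F x i)"
  unfolding proper_tuple_def supp_tuple_def by (meson finite_subset local_support_subset)

lemma supp_tuple_nonempty: "proper_tuple F \<Longrightarrow> supp_tuple F x i \<noteq> {}"
  unfolding proper_tuple_def supp_tuple_def using local_support_nonempty by blast

lemma finite_range_supp_tuple:
  assumes "proper_tuple F"
  shows "finite (range (supp_tuple F))"
proof (rule finite_subset)
  show "range (supp_tuple F) \<subseteq> (\<Pi>\<^sub>E i\<in>UNIV. Pow (trop_support (F i)))"
    using local_support_subset by (fastforce simp: supp_tuple_def)
  show "finite (\<Pi>\<^sub>E i\<in>UNIV. Pow (trop_support (F i)))"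
    using assms by (intro finite_PiE) (auto simp: proper_tuple_def)
qed

text \<open>Independence is demanded at every point, and not only at common points of all
  hypersurfaces, so that the edges and vertices of every curve cut out by n - 1 of them are
  controlled too.\<close>

definition generic_tuple :: "('n::finite \<Rightarrow> 'n trop_poly) \<Rightarrow> bool" where
  "generic_tuple F \<longleftrightarrow> proper_tuple F \<and> (\<forall>x. indep_tuple (supp_tuple F x))"

lemma generic_tuple_proper: "generic_tuple F \<Longrightarrow> proper_tuple F"
  by (simp add: generic_tuple_def)

lemma orth_tuple_translate:
  assumes F: "proper_tuple F" and sub: "\<And>i. V i \<subseteq> supp_tuple F x i" "\<And>i. V i \<subseteq> supp_tuple F y i"
  shows "orth_tuple (x - y) V"
  unfolding orth_tuple_def
proof (intro allI ballI)
  fix i a b assume ab: "a \<in> V i" "b \<in> V i"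
  have "trop_val (F i) a x = trop_val (F i) b x" "trop_val (F i) a y = trop_val (F i) b y"
    using ab sub[of i] F unfolding supp_tuple_def proper_tuple_def
    by (metis local_support_val_eq subsetD)+
  then show "(x - y) \<bullet> real_vec a = (x - y) \<bullet> real_vec b"
    using trop_val_diff[of "F i" a x y] trop_val_diff[of "F i" b x y] by linarith
qed

subsection \<open>The 2-intersection number as a sum over local supports\<close>

text \<open>On a two-element block the sum is the reduced difference of the endpoints, as signs
  vanish modulo 2. On other blocks it extends this additively, which gives edges and vertices of the
  curve a weight as well.\<close>

definition kvec :: "int ^ 'n \<Rightarrow> ('n::finite \<Rightarrow> (int ^ 'n) set) \<Rightarrow> 'n option \<Rightarrow> bit ^ 'n" where
  "kvec \<zeta> V = (\<lambda>j. case j of None \<Rightarrow> mod2_vec \<zeta> | Some i \<Rightarrow> (\<Sum>a\<in>V i. mod2_vec a))"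

definition weight :: "int ^ 'n \<Rightarrow> ('n::finite \<Rightarrow> (int ^ 'n) set) \<Rightarrow> bit" where
  "weight \<zeta> V = det2 (kvec \<zeta> V)"

lemma kvec_upd: "kvec \<zeta> (V(i := S)) = (kvec \<zeta> V)(Some i := (\<Sum>a\<in>S. mod2_vec a))"
proof
  show "kvec \<zeta> (V(i := S)) m = ((kvec \<zeta> V)(Some i := (\<Sum>a\<in>S. mod2_vec a))) m" for m
    by (cases m) (simp_all add: kvec_def)
qed

lemma weight_upd: "weight \<zeta> (V(i := S)) = det2 ((kvec \<zeta> V)(Some i := (\<Sum>a\<in>S. mod2_vec a)))"
  by (simp only: weight_def kvec_upd)

definition all_segments :: "('n \<Rightarrow> 'a set) \<Rightarrow> bool" where
  "all_segments V \<longleftrightarrow> (\<forall>i. card (V i) = 2)"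

definition point_tuples :: "('n::finite \<Rightarrow> 'n trop_poly) \<Rightarrow> ('n \<Rightarrow> (int ^ 'n) set) set" where
  "point_tuples F = {V \<in> range (supp_tuple F). all_segments V}"

text \<open>A segment determines its endpoints up to order, and modulo 2 the order does not affect
  their difference; so the description in \<open>segment_mod2\<close> is proper.\<close>

lemma segment_mod2_closed_segment:
  "segment_mod2 (closed_segment (real_vec a) (real_vec b)) = mod2_vec a + mod2_vec b"
  unfolding segment_mod2_def
proof (rule the_equality)
  show "\<exists>c d. closed_segment (real_vec a) (real_vec b) = closed_segment (real_vec c) (real_vec d) \<and>
      mod2_vec a + mod2_vec b = mod2_vec (c - d)"
    by (metis mod2_vec_diff)
  fix k
  assume "\<exists>c d. closed_segment (real_vec a) (real_vec b) = closed_segment (real_vec c) (real_vec d) \<and>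
      k = mod2_vec (c - d)"
  then obtain c d where cd: "closed_segment (real_vec a) (real_vec b) = closed_segment (real_vec c) (real_vec d)"
    and k: "k = mod2_vec c + mod2_vec d"
    by (metis mod2_vec_diff)
  from cd have "{a, b} = {c, d}"
    by (simp add: real_vec_eq_iff doubleton_eq_iff)
  then show "k = mod2_vec a + mod2_vec b"
    unfolding k by (metis add.commute doubleton_eq_iff)
qed

lemma segment_mod2_local_newton:
  assumes "card (local_support \<phi> x) = 2"
  shows "segment_mod2 (local_newton \<phi> x) = (\<Sum>a\<in>local_support \<phi> x. mod2_vec a)"
proof -
  obtain a b where ab: "local_support \<phi> x = {a, b}" "a \<noteq> b"
    using assms by (auto simp: card_2_iff)
  then show ?thesis
    using segment_mod2_closed_segment[of a b]
    by (simp add: local_newton_def segment_convex_hull)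
qed

lemma transverse_supp_tuple:
  assumes F: "transverse F" "proper_tuple F"
  shows "x \<in> (\<Inter>i. trop_hypersurface (F i)) \<longleftrightarrow> all_segments (supp_tuple F x)"
proof
  assume "x \<in> (\<Inter>i. trop_hypersurface (F i))"
  then have "\<forall>i. smooth_point (F i) x" using F(1) unfolding transverse_def by blast
  then show "all_segments (supp_tuple F x)"
    unfolding smooth_point_def all_segments_def supp_tuple_def by blast
next
  assume "all_segments (supp_tuple F x)"
  then show "x \<in> (\<Inter>i. trop_hypersurface (F i))"
    by (simp add: all_segments_def supp_tuple_def trop_hypersurface_def)
qed

text \<open>Along the segment every affine function is the convex combination of its two end values,
  which preserves ties and strict inequalities holding at both ends.\<close>

lemma supp_tuple_segment:
  assumes F: "proper_tuple F" and eq: "supp_tuple F x = supp_tuple F y" and s: "0 \<le> s" "s \<le> 1"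
  shows "supp_tuple F (x + s *\<^sub>R (y - x)) = supp_tuple F x"
proof
  fix i
  have fin: "finite (trop_support (F i))" using F by (simp add: proper_tuple_def)
  have supp: "local_support (F i) x = local_support (F i) y"
    using eq by (metis supp_tuple_apply)
  have val: "trop_val (F i) a (x + s *\<^sub>R (y - x)) = (1 - s) * trop_val (F i) a x + s * trop_val (F i) a y" for a
    unfolding trop_val_line trop_val_diff[of "F i", symmetric] by (simp add: algebra_simps)
  have "local_support (F i) (x + s *\<^sub>R (y - x)) = local_support (F i) x"
  proof (rule local_support_eqI[OF fin local_support_subset])
    show "local_support (F i) x \<noteq> {}" using supp_tuple_nonempty[OF F, of x i] by (simp add: supp_tuple_def)
    show "trop_val (F i) a (x + s *\<^sub>R (y - x)) = trop_val (F i) b (x + s *\<^sub>R (y - x))"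
      if "a \<in> local_support (F i) x" "b \<in> local_support (F i) x" for a b
      unfolding val using that supp local_support_val_eq[OF fin] by metis
    show "trop_val (F i) b (x + s *\<^sub>R (y - x)) < trop_val (F i) a (x + s *\<^sub>R (y - x))"
      if "a \<in> local_support (F i) x" "b \<in> trop_support (F i) - local_support (F i) x" for a b
    proof -
      have 1: "trop_val (F i) b x < trop_val (F i) a x" "trop_val (F i) b y < trop_val (F i) a y"
        using local_support_val_less[OF fin] that supp by auto
      show ?thesis
      proof (cases "s = 0")
        case False
        then have "s * trop_val (F i) b y < s * trop_val (F i) a y" using 1 s by simp
        moreover have "(1 - s) * trop_val (F i) b x \<le> (1 - s) * trop_val (F i) a x"
          using 1 s by (intro mult_left_mono) auto
        ultimately show ?thesis unfolding val by linarith
      qed (use 1 in \<open>simp add: val\<close>)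
    qed
  qed
  then show "supp_tuple F (x + s *\<^sub>R (y - x)) i = supp_tuple F x i" by (simp add: supp_tuple_def)
qed

text \<open>Two common points with the same label would put the whole segment between them into the
  intersection, which is finite by transversality.\<close>

lemma inj_on_supp_tuple:
  assumes F: "transverse F" "proper_tuple F"
  shows "inj_on (supp_tuple F) (\<Inter>i. trop_hypersurface (F i))"
proof (rule inj_onI)
  fix x y assume x: "x \<in> (\<Inter>i. trop_hypersurface (F i))" and eq: "supp_tuple F x = supp_tuple F y"
  show "x = y"
  proof (rule ccontr)
    assume ne: "x \<noteq> y"
    have "inj_on (\<lambda>s. x + s *\<^sub>R (y - x)) {0..1}"
      using ne by (auto simp: inj_on_def)
    then have "infinite ((\<lambda>s. x + s *\<^sub>R (y - x)) ` {0..1::real})"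
      by (simp add: finite_image_iff infinite_Icc)
    moreover have "(\<lambda>s. x + s *\<^sub>R (y - x)) ` {0..1::real} \<subseteq> (\<Inter>i. trop_hypersurface (F i))"
    proof (rule image_subsetI)
      fix s :: real assume "s \<in> {0..1}"
      then have "supp_tuple F (x + s *\<^sub>R (y - x)) = supp_tuple F x"
        using supp_tuple_segment[OF F(2) eq, of s] by simp
      then show "x + s *\<^sub>R (y - x) \<in> (\<Inter>i. trop_hypersurface (F i))"
        using x unfolding transverse_supp_tuple[OF F] by simp
    qed
    ultimately show False
      using F(1) finite_subset by (auto simp: transverse_def)
  qed
qed

lemma iota2_eq_sum_point_tuples:
  assumes F: "transverse F" "proper_tuple F"
  shows "iota2 F \<zeta> = (\<Sum>V\<in>point_tuples F. weight \<zeta> V)"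
proof -
  let ?X = "\<Inter>i. trop_hypersurface (F i)"
  have "iota2 F \<zeta> = (\<Sum>x\<in>?X. weight \<zeta> (supp_tuple F x))"
    unfolding iota2_def
  proof (rule sum.cong)
    fix x assume "x \<in> ?X"
    then have x: "card (local_support (F i) x) = 2" for i
      using transverse_supp_tuple[OF F] by (auto simp: all_segments_def supp_tuple_def)
    have "(\<lambda>j. case j of None \<Rightarrow> mod2_vec \<zeta> | Some i \<Rightarrow> segment_mod2 (local_newton (F i) x))
        = kvec \<zeta> (supp_tuple F x)"
      unfolding kvec_def supp_tuple_def segment_mod2_local_newton[OF x] ..
    then show "det2 (\<lambda>j. case j of None \<Rightarrow> mod2_vec \<zeta> | Some i \<Rightarrow> segment_mod2 (local_newton (F i) x))
        = weight \<zeta> (supp_tuple F x)"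
      by (simp only: weight_def)
  qed simp
  also have "\<dots> = (\<Sum>V\<in>supp_tuple F ` ?X. weight \<zeta> V)"
    by (rule sum.reindex[OF inj_on_supp_tuple[OF F], unfolded o_def, symmetric])
  also have "supp_tuple F ` ?X = point_tuples F"
    unfolding point_tuples_def using transverse_supp_tuple[OF F] by blast
  finally show ?thesis .
qed

lemma card_eq_2_if_sum_card_le:
  fixes V :: "'n::finite \<Rightarrow> 'a set"
  assumes "\<And>i. 2 \<le> card (V i)" "(\<Sum>i\<in>UNIV. card (V i) - 1) \<le> CARD('n)"
  shows "card (V i) = 2"
proof (rule ccontr)
  assume "card (V i) \<noteq> 2"
  then have "1 < card (V i) - 1" using assms(1)[of i] by linarith
  moreover have "1 \<le> card (V m) - 1" for m using assms(1)[of m] by linarith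
  ultimately have "(\<Sum>i\<in>(UNIV::'n set). 1) < (\<Sum>i\<in>UNIV. card (V i) - 1)"
    by (intro sum_strict_mono_ex1) auto
  then show False using assms(2) by simp
qed

text \<open>At a common point the n numbers \<open>card (V i) - 1\<close> are at least 1 and add up
  to at most n, so all equal 1. Two such points with one label would differ by a direction
  orthogonal to n independent differences; hence there are no more points than labels.\<close>

lemma generic_tuple_transverse:
  assumes F: "generic_tuple F"
  shows "transverse F"
proof -
  have P: "proper_tuple F" using F by (rule generic_tuple_proper)
  have ind: "indep_tuple (supp_tuple F x)" for x using F by (simp add: generic_tuple_def)
  note fin = finite_supp_tuple[OF P] and ne = supp_tuple_nonempty[OF P]
  let ?X = "\<Inter>i. trop_hypersurface (F i)"
  have two: "card (supp_tuple F x i) = 2" if "x \<in> ?X" for x i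
    using that indep_tuple_card_le[OF ind fin ne, of x]
    by (intro card_eq_2_if_sum_card_le) (auto simp: trop_hypersurface_def supp_tuple_def)
  have "inj_on (supp_tuple F) ?X"
  proof (rule inj_onI)
    fix x y assume x: "x \<in> ?X" and eq: "supp_tuple F x = supp_tuple F y"
    have "orth_tuple (x - y) (supp_tuple F x)"
      by (rule orth_tuple_translate[OF P]) (auto simp: eq)
    then show "x = y"
      using indep_tuple_card_less[OF ind fin ne, of "x - y" x] two[OF x] by auto
  qed
  moreover have "finite (supp_tuple F ` ?X)"
    using finite_range_supp_tuple[OF P] by (rule finite_subset[rotated]) auto
  ultimately have "finite ?X" by (rule finite_imageD[rotated])
  then show ?thesis
    using two by (auto simp: transverse_def smooth_point_def supp_tuple_def)
qed

subsection \<open>Edges and rays of the tropical curve\<close>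

definition curve_segments :: "'n \<Rightarrow> ('n \<Rightarrow> 'a set) \<Rightarrow> bool" where
  "curve_segments j V \<longleftrightarrow> (\<forall>i. i \<noteq> j \<longrightarrow> card (V i) = 2)"

text \<open>Slot \<open>j\<close> holds the one exponent of the \<open>j\<close>-th polynomial that
  dominates there: these are the pieces into which the \<open>j\<close>-th hypersurface cuts the
  edges of the curve.\<close>

definition edge_tuples :: "'n::finite \<Rightarrow> ('n \<Rightarrow> 'n trop_poly) \<Rightarrow> ('n \<Rightarrow> (int ^ 'n) set) set" where
  "edge_tuples j F = {V \<in> range (supp_tuple F). curve_segments j V \<and> card (V j) = 1}"

text \<open>The member \<open>e j\<close> is irrelevant here, so that a normal vector belongs to an edge of the curve
  cut out by the \<open>F i\<close> with \<open>i \<noteq> j\<close>.\<close>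

definition edge_normal :: "'n::finite \<Rightarrow> ('n \<Rightarrow> (int ^ 'n) set) \<Rightarrow> int ^ 'n" where
  "edge_normal j e = (SOME v. (\<exists>i. odd (v $ i)) \<and>
     (\<forall>i. i \<noteq> j \<longrightarrow> (\<forall>a\<in>e i. \<forall>b\<in>e i. scalar_product v a = scalar_product v b)))"

definition edge_dirs :: "'n::finite \<Rightarrow> ('n \<Rightarrow> (int ^ 'n) set) \<Rightarrow> (int ^ 'n) set" where
  "edge_dirs j e = {edge_normal j e, - edge_normal j e}"

definition maximal_on :: "int ^ 'n::finite \<Rightarrow> (int ^ 'n) set \<Rightarrow> int ^ 'n \<Rightarrow> bool" where
  "maximal_on u A a \<longleftrightarrow> a \<in> A \<and> (\<forall>r\<in>A. scalar_product u r \<le> scalar_product u a)"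

text \<open>The edge is unbounded in direction \<open>u\<close> when no exponent grows faster along
  \<open>u\<close> than those attaining the maximum on the edge, since then nothing can overtake
  them.\<close>

definition edge_ends ::
  "'n::finite \<Rightarrow> ('n \<Rightarrow> 'n trop_poly) \<Rightarrow> ('n \<Rightarrow> (int ^ 'n) set) \<Rightarrow> (int ^ 'n) set" where
  "edge_ends j F S = {u \<in> edge_dirs j S. \<forall>i. \<forall>p\<in>S i. maximal_on u (trop_support (F i)) p}"

text \<open>Slot \<open>j\<close> is normalised to the empty set and all conditions on
  \<open>F\<close> concern the other indices. Tuples that differ only in slot \<open>j\<close> thus
  have the same rays, and their sums can be compared term by term.\<close>

definition curve_rays ::
  "'n::finite \<Rightarrow> ('n \<Rightarrow> 'n trop_poly) \<Rightarrow> (('n \<Rightarrow> (int ^ 'n) set) \<times> (int ^ 'n)) set" where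
  "curve_rays j F = {(e, u). e j = {} \<and> curve_segments j e \<and> u \<in> edge_dirs j e \<and>
     (\<exists>x. \<forall>i. i \<noteq> j \<longrightarrow> local_support (F i) x = e i) \<and>
     (\<forall>i. i \<noteq> j \<longrightarrow> (\<forall>p\<in>e i. maximal_on u (trop_support (F i)) p))}"

lemma maximal_on_exists:
  assumes "finite A" "A \<noteq> {}"
  obtains a where "maximal_on u A a"
proof -
  have "Max (scalar_product u ` A) \<in> scalar_product u ` A"
    using assms by (intro Max_in) auto
  then obtain a where "a \<in> A" "Max (scalar_product u ` A) = scalar_product u a" by auto
  then have "maximal_on u A a"
    unfolding maximal_on_def using assms by (metis Max_ge finite_imageI imageI)
  then show ?thesis by (rule that)
qed

lemma curve_rays_upd: "curve_rays j (F(j := \<phi>)) = curve_rays j F"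
  unfolding curve_rays_def by simp

lemma scalar_product_diff_right: "scalar_product v (a - b) = scalar_product v a - scalar_product v b"
  for v :: "int ^ 'n"
  by (simp add: scalar_product_def right_diff_distrib sum_subtractf)

lemma scalar_product_minus_left: "scalar_product (- v) a = - scalar_product v a"
  for v :: "int ^ 'n"
  by (simp add: scalar_product_def sum_negf)

lemma edge_normal:
  assumes "curve_segments j e"
  shows "\<exists>i. odd (edge_normal j e $ i)"
    and "i \<noteq> j \<Longrightarrow> a \<in> e i \<Longrightarrow> b \<in> e i \<Longrightarrow>
      scalar_product (edge_normal j e) a = scalar_product (edge_normal j e) b"
proof -
  have "\<exists>p. \<forall>i. i \<noteq> j \<longrightarrow> e i = {fst (p i), snd (p i)}"
    using assms unfolding curve_segments_def card_2_iff
    by (intro choice allI) (metis fst_conv snd_conv)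
  then obtain p where p: "\<And>i. i \<noteq> j \<Longrightarrow> e i = {fst (p i), snd (p i)}" by blast
  obtain v where v: "\<exists>i. odd (v $ i)" "\<And>i. i \<noteq> j \<Longrightarrow> scalar_product v (fst (p i) - snd (p i)) = 0"
    using primitive_normal[of j "\<lambda>i. fst (p i) - snd (p i)"] by blast
  have "(\<exists>i. odd (v $ i)) \<and>
     (\<forall>i. i \<noteq> j \<longrightarrow> (\<forall>a\<in>e i. \<forall>b\<in>e i. scalar_product v a = scalar_product v b))"
    using v by (auto simp: p scalar_product_diff_right)
  from someI[where P = "\<lambda>v. (\<exists>i. odd (v $ i)) \<and>
     (\<forall>i. i \<noteq> j \<longrightarrow> (\<forall>a\<in>e i. \<forall>b\<in>e i. scalar_product v a = scalar_product v b))", OF this]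
  have *: "(\<exists>i. odd (edge_normal j e $ i)) \<and>
     (\<forall>i. i \<noteq> j \<longrightarrow> (\<forall>a\<in>e i. \<forall>b\<in>e i. scalar_product (edge_normal j e) a = scalar_product (edge_normal j e) b))"
    unfolding edge_normal_def .
  show "\<exists>i. odd (edge_normal j e $ i)" using * by blast
  show "i \<noteq> j \<Longrightarrow> a \<in> e i \<Longrightarrow> b \<in> e i \<Longrightarrow>
      scalar_product (edge_normal j e) a = scalar_product (edge_normal j e) b"
    using * by blast
qed

lemma edge_normal_upd: "edge_normal j (e(j := S)) = edge_normal j e"
  unfolding edge_normal_def by (rule arg_cong[where f = Eps]) (auto simp: fun_eq_iff)

lemma edge_dirs_upd: "edge_dirs j (e(j := S)) = edge_dirs j e"
  by (simp only: edge_dirs_def edge_normal_upd)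

lemma edge_dirs:
  assumes "curve_segments j e" "u \<in> edge_dirs j e"
  shows "\<exists>i. odd (u $ i)"
    and "i \<noteq> j \<Longrightarrow> a \<in> e i \<Longrightarrow> b \<in> e i \<Longrightarrow> scalar_product u a = scalar_product u b"
proof -
  have u: "u = edge_normal j e \<or> u = - edge_normal j e"
    using assms(2) by (simp add: edge_dirs_def)
  obtain m where "odd (edge_normal j e $ m)" using edge_normal(1)[OF assms(1)] ..
  then have "odd (u $ m)" using u by auto
  then show "\<exists>i. odd (u $ i)" ..
  assume "i \<noteq> j" "a \<in> e i" "b \<in> e i"
  then have "scalar_product (edge_normal j e) a = scalar_product (edge_normal j e) b"
    by (rule edge_normal(2)[OF assms(1)])
  then show "scalar_product u a = scalar_product u b"
    using u by (auto simp: scalar_product_minus_left)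
qed

lemma odd_vec_nonzero: "\<exists>i. odd (u $ i) \<Longrightarrow> real_vec u \<noteq> 0"
  by (simp add: real_vec_def vec_eq_iff) (metis even_zero)

lemma card_edge_dirs:
  assumes "curve_segments j e"
  shows "card (edge_dirs j e) = 2"
proof -
  have "edge_normal j e \<noteq> - edge_normal j e"
  proof
    assume eq: "edge_normal j e = - edge_normal j e"
    have "edge_normal j e $ i = 0" for i
      using arg_cong[OF eq, of "\<lambda>v. v $ i"] by simp
    then show False using edge_normal(1)[OF assms] by simp
  qed
  then show ?thesis by (simp add: edge_dirs_def)
qed

section \<open>Edges of the subdivided curve and their endpoints\<close>

locale generic_curve =
  fixes F :: "'n::finite \<Rightarrow> 'n trop_poly" and j :: 'n
  assumes generic: "generic_tuple F"
begin

abbreviation "A i \<equiv> trop_support (F i)"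

lemma proper: "proper_tuple F" by (rule generic_tuple_proper[OF generic])

lemma fin_A: "finite (A i)" using proper by (simp add: proper_tuple_def)

lemma indep: "indep_tuple (supp_tuple F x)" using generic by (simp add: generic_tuple_def)

lemmas fin = finite_supp_tuple[OF proper]
lemmas ne = supp_tuple_nonempty[OF proper]
lemmas val_eq = local_support_val_eq[OF fin_A, folded supp_tuple_apply]
lemmas val_less = local_support_val_less[OF fin_A, folded supp_tuple_apply]
lemmas in_supp_iff = in_local_support_iff[OF fin_A, folded supp_tuple_apply]

lemma supp_sub: "supp_tuple F x i \<subseteq> A i"
  unfolding supp_tuple_apply by (rule local_support_subset)

lemma sum_card_edge:
  assumes "curve_segments j V" "card (V j) = 1"
  shows "Suc (\<Sum>i\<in>UNIV. card (V i) - 1) = CARD('n)"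
proof -
  have "(\<Sum>i\<in>UNIV. card (V i) - 1) = (card (V j) - 1) + (\<Sum>i\<in>UNIV - {j}. card (V i) - 1)"
    by (rule sum.remove) auto
  also have "(\<Sum>i\<in>UNIV - {j}. card (V i) - 1) = (\<Sum>i\<in>UNIV - {j}. 1)"
    using assms(1) by (intro sum.cong) (auto simp: curve_segments_def)
  finally show ?thesis using assms(2) by (simp add: card_Diff_singleton)
qed

text \<open>All ties of the edge persist at \<open>y\<close>, so the displacement is constant on
  each block. The n - 1 independent differences of an edge admit only one line of such directions,
  which the normal vector spans.\<close>

lemma edge_parallel:
  assumes S: "supp_tuple F x \<in> edge_tuples j F"
    and y: "\<And>i. supp_tuple F x i \<subseteq> supp_tuple F y i"
  obtains c where "y - x = c *\<^sub>R real_vec (edge_normal j (supp_tuple F x))"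
proof -
  let ?S = "supp_tuple F x" and ?v = "edge_normal j (supp_tuple F x)"
  have seg: "curve_segments j ?S" and one: "card (?S j) = 1" using S by (auto simp: edge_tuples_def)
  have "orth_tuple (real_vec ?v) ?S"
    unfolding orth_tuple_def
  proof (intro allI ballI)
    fix i a b assume ab: "a \<in> ?S i" "b \<in> ?S i"
    have "scalar_product ?v a = scalar_product ?v b"
    proof (cases "i = j")
      case True
      then have "a = b" using ab one by (auto simp: card_1_singleton_iff)
      then show ?thesis by simp
    qed (use edge_normal(2)[OF seg _ ab] in blast)
    then show "real_vec ?v \<bullet> real_vec a = real_vec ?v \<bullet> real_vec b" by (simp add: inner_real_vec)
  qed
  moreover have "orth_tuple (y - x) ?S"
    by (rule orth_tuple_translate[OF proper]) (use y in auto)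
  moreover have "real_vec ?v \<noteq> 0" by (rule odd_vec_nonzero[OF edge_normal(1)[OF seg]])
  ultimately show ?thesis
    using indep_tuple_orth_unique[OF indep fin ne, of x "real_vec ?v" "y - x"]
      sum_card_edge[OF seg one] that by (metis order_refl)
qed

lemma edge_dirs_const:
  assumes S: "supp_tuple F x \<in> edge_tuples j F" and u: "u \<in> edge_dirs j (supp_tuple F x)"
    and ab: "a \<in> supp_tuple F x i" "b \<in> supp_tuple F x i"
  shows "scalar_product u a = scalar_product u b"
proof (cases "i = j")
  case True
  then have "a = b" using ab S by (auto simp: edge_tuples_def card_1_singleton_iff)
  then show ?thesis by simp
next
  case False
  then show ?thesis
    using edge_dirs(2)[OF _ u False ab] S by (simp add: edge_tuples_def)
qed

text \<open>For an edge \<open>S\<close> these are the labels of its endpoints: on passing to the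
  boundary of a cell, exponents join the local supports.\<close>

definition enlarged :: "('n \<Rightarrow> (int ^ 'n) set) \<Rightarrow> ('n \<Rightarrow> (int ^ 'n) set) set" where
  "enlarged S = {V \<in> range (supp_tuple F). S \<le> V \<and> S \<noteq> V}"

lemma val_line:
  "trop_val (F i) a (x + s *\<^sub>R real_vec u) = trop_val (F i) a x + s * of_int (scalar_product u a)"
  by (simp add: trop_val_line inner_real_vec)

text \<open>The new exponent \<open>r\<close> lies strictly below \<open>p\<close> at
  \<open>x\<close> and ties with it after time \<open>s\<close>, so it grows faster along
  \<open>u\<close>; the gap at \<open>x\<close> is \<open>s\<close> times the difference of the
  slopes.\<close>

lemma enlarged_along:
  assumes S: "supp_tuple F x \<in> edge_tuples j F" and u: "u \<in> edge_dirs j (supp_tuple F x)"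
    and s: "0 < s" and V: "supp_tuple F (x + s *\<^sub>R real_vec u) \<in> enlarged (supp_tuple F x)"
    and r: "r \<in> supp_tuple F (x + s *\<^sub>R real_vec u) i - supp_tuple F x i" and p: "p \<in> supp_tuple F x i"
  shows "scalar_product u p < scalar_product u r"
    and "s * of_int (scalar_product u r - scalar_product u p) = trop_val (F i) p x - trop_val (F i) r x"
proof -
  have "p \<in> supp_tuple F (x + s *\<^sub>R real_vec u) i"
    using V p by (auto simp: enlarged_def le_fun_def)
  then have eq: "trop_val (F i) p (x + s *\<^sub>R real_vec u) = trop_val (F i) r (x + s *\<^sub>R real_vec u)"
    using val_eq r by blast
  then show eq': "s * of_int (scalar_product u r - scalar_product u p) = trop_val (F i) p x - trop_val (F i) r x"
    unfolding val_line by (simp add: algebra_simps)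
  have "trop_val (F i) r x < trop_val (F i) p x"
    using val_less[OF p, of r] r supp_sub by blast
  then have "0 < s * of_int (scalar_product u r - scalar_product u p)" unfolding eq' by simp
  then show "scalar_product u p < scalar_product u r"
    using s by (simp add: zero_less_mult_iff)
qed

lemma enlarged_witness:
  assumes "V \<in> enlarged S"
  obtains i r where "r \<in> V i - S i"
  using assms by (auto simp: enlarged_def le_fun_def fun_eq_iff)

lemma enlarged_not_end:
  assumes S: "supp_tuple F x \<in> edge_tuples j F" and u: "u \<in> edge_dirs j (supp_tuple F x)"
    and s: "0 < s" and V: "supp_tuple F (x + s *\<^sub>R real_vec u) \<in> enlarged (supp_tuple F x)"
  shows "u \<notin> edge_ends j F (supp_tuple F x)"
proof
  assume e: "u \<in> edge_ends j F (supp_tuple F x)"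
  obtain i r where r: "r \<in> supp_tuple F (x + s *\<^sub>R real_vec u) i - supp_tuple F x i"
    using enlarged_witness[OF V] by blast
  obtain p where p: "p \<in> supp_tuple F x i" using ne by blast
  have "scalar_product u r \<le> scalar_product u p"
    using e p r supp_sub unfolding edge_ends_def maximal_on_def by blast
  then show False using enlarged_along(1)[OF S u s V r p] by simp
qed

text \<open>An exponent that catches up at \<open>s\<close> would have strictly overtaken
  \<open>p\<close> at any later \<open>t\<close>, where \<open>p\<close> still attains the maximum.
  Used in both directions, this allows only one endpoint on each side.\<close>

lemma enlarged_le:
  assumes S: "supp_tuple F x \<in> edge_tuples j F" and u: "u \<in> edge_dirs j (supp_tuple F x)"
    and s: "0 < s" and V: "supp_tuple F (x + s *\<^sub>R real_vec u) \<in> enlarged (supp_tuple F x)"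
    and t: "0 < t" and W: "supp_tuple F (x + t *\<^sub>R real_vec u) \<in> enlarged (supp_tuple F x)"
  shows "t \<le> s"
proof (rule ccontr)
  assume less: "\<not> ?thesis"
  obtain i r where r: "r \<in> supp_tuple F (x + s *\<^sub>R real_vec u) i - supp_tuple F x i"
    using enlarged_witness[OF V] by blast
  obtain p where p: "p \<in> supp_tuple F x i" using ne by blast
  note * = enlarged_along[OF S u s V r p]
  have "s * of_int (scalar_product u r - scalar_product u p) < t * of_int (scalar_product u r - scalar_product u p)"
    using less *(1) by simp
  then have "trop_val (F i) p (x + t *\<^sub>R real_vec u) < trop_val (F i) r (x + t *\<^sub>R real_vec u)"
    unfolding val_line using *(2) by (simp add: algebra_simps)
  moreover have "p \<in> supp_tuple F (x + t *\<^sub>R real_vec u) i"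
    using W p by (auto simp: enlarged_def le_fun_def)
  moreover have "r \<in> A i" using r supp_sub by blast
  ultimately show False using in_supp_iff by (meson not_less)
qed

text \<open>As \<open>u\<close> is not an unbounded end, some exponent grows faster than those of
  the edge. The endpoint is reached when the first such exponent catches up.\<close>

lemma enlarged_exists:
  assumes S: "supp_tuple F x \<in> edge_tuples j F"
    and u: "u \<in> edge_dirs j (supp_tuple F x) - edge_ends j F (supp_tuple F x)"
  obtains s where "0 < s" "supp_tuple F (x + s *\<^sub>R real_vec u) \<in> enlarged (supp_tuple F x)"
proof -
  let ?S = "supp_tuple F x"
  obtain p where p: "\<And>i. p i \<in> ?S i"
    using that[of "\<lambda>i. SOME a. a \<in> ?S i"] ne by (metis some_in_eq)
  have u': "u \<in> edge_dirs j ?S" using u by blast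
  have const: "scalar_product u a = scalar_product u (p i)" if "a \<in> ?S i" for a i
    using edge_dirs_const[OF S u' that p] .
  define C where "C = {(i, r). r \<in> A i \<and> scalar_product u (p i) < scalar_product u r}"
  have finC: "finite C"
    by (rule finite_subset[of _ "SIGMA i:UNIV. A i"]) (auto simp: C_def fin_A)
  have "C \<noteq> {}"
  proof
    assume C: "C = {}"
    have "maximal_on u (A i) a" if "a \<in> ?S i" for a i
      using C that supp_sub const[OF that] unfolding maximal_on_def C_def by force
    then show False using u by (simp add: edge_ends_def)
  qed
  \<comment> \<open>The time at which \<open>r\<close> catches up with the edge: the gap at
    \<open>x\<close> divided by the difference of the slopes.\<close>
  define q where "q = (\<lambda>(i, r). (trop_val (F i) (p i) x - trop_val (F i) r x) /
    of_int (scalar_product u r - scalar_product u (p i)))"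
  define s where "s = Min (q ` C)"
  have notin: "r \<notin> ?S i" if "(i, r) \<in> C" for i r
    using const[of r i] that by (auto simp: C_def)
  have qpos: "0 < q m" if "m \<in> C" for m
  proof -
    obtain i r where m: "m = (i, r)" by (cases m)
    have "trop_val (F i) r x < trop_val (F i) (p i) x"
      using val_less[OF p, of r i] notin[of i r] that m by (auto simp: C_def)
    then show ?thesis using that m by (simp add: q_def C_def)
  qed
  have s: "0 < s" using finC \<open>C \<noteq> {}\<close> qpos by (simp add: s_def)
  have le: "trop_val (F i) r (x + s *\<^sub>R real_vec u) \<le> trop_val (F i) (p i) (x + s *\<^sub>R real_vec u)"
    if "r \<in> A i" for i r
  proof (cases "(i, r) \<in> C")
    case True
    then have "s \<le> q (i, r)" using finC by (simp add: s_def)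
    then have "s * of_int (scalar_product u r - scalar_product u (p i)) \<le> trop_val (F i) (p i) x - trop_val (F i) r x"
      using True by (simp add: q_def C_def pos_le_divide_eq)
    then show ?thesis unfolding val_line by (simp add: algebra_simps)
  next
    case False
    then have "s * of_int (scalar_product u r) \<le> s * of_int (scalar_product u (p i))"
      using that s by (intro mult_left_mono) (auto simp: C_def)
    moreover have "trop_val (F i) r x \<le> trop_val (F i) (p i) x"
      using p[of i] that by (simp add: in_supp_iff)
    ultimately show ?thesis unfolding val_line by linarith
  qed
  have sub: "?S i \<subseteq> supp_tuple F (x + s *\<^sub>R real_vec u) i" for i
  proof
    fix a assume a: "a \<in> ?S i"
    have "trop_val (F i) a (x + s *\<^sub>R real_vec u) = trop_val (F i) (p i) (x + s *\<^sub>R real_vec u)"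
      unfolding val_line using const[OF a] val_eq[OF a p] by simp
    then show "a \<in> supp_tuple F (x + s *\<^sub>R real_vec u) i"
      using a le supp_sub[of x i] by (auto simp: in_supp_iff)
  qed
  have "s \<in> q ` C" unfolding s_def using finC \<open>C \<noteq> {}\<close> by (intro Min_in) auto
  then obtain i r where ir: "(i, r) \<in> C" "s = q (i, r)" by auto
  then have "s * of_int (scalar_product u r - scalar_product u (p i)) = trop_val (F i) (p i) x - trop_val (F i) r x"
    by (simp add: q_def C_def)
  then have "trop_val (F i) r (x + s *\<^sub>R real_vec u) = trop_val (F i) (p i) (x + s *\<^sub>R real_vec u)"
    unfolding val_line by (simp add: algebra_simps)
  then have "r \<in> supp_tuple F (x + s *\<^sub>R real_vec u) i"
    using ir(1) le by (simp add: in_supp_iff C_def)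
  then have "?S \<noteq> supp_tuple F (x + s *\<^sub>R real_vec u)" using notin[OF ir(1)] by metis
  then have "supp_tuple F (x + s *\<^sub>R real_vec u) \<in> enlarged ?S"
    using sub by (simp add: enlarged_def le_fun_def)
  then show ?thesis using that s by blast
qed

lemma enlarged_on_line:
  assumes S: "supp_tuple F x \<in> edge_tuples j F" and V: "V \<in> enlarged (supp_tuple F x)"
  obtains u s where "u \<in> edge_dirs j (supp_tuple F x)" "0 < s" "V = supp_tuple F (x + s *\<^sub>R real_vec u)"
proof -
  let ?v = "edge_normal j (supp_tuple F x)"
  obtain y where y: "V = supp_tuple F y" using V by (auto simp: enlarged_def)
  obtain c where c: "y - x = c *\<^sub>R real_vec ?v"
    using edge_parallel[OF S, of y] V y by (auto simp: enlarged_def le_fun_def)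
  have neg: "real_vec (- ?v) = - real_vec ?v" by (simp add: real_vec_def vec_eq_iff)
  have yx: "y = x + c *\<^sub>R real_vec ?v" using c by (metis add_diff_cancel_left' diff_add_cancel add.commute)
  have "c \<noteq> 0" using V y yx by (auto simp: enlarged_def)
  then consider "0 < c" | "0 < - c" by linarith
  then show ?thesis
  proof cases
    case 1
    then show ?thesis using that[of ?v c] y yx by (simp add: edge_dirs_def)
  next
    case 2
    then show ?thesis using that[of "- ?v" "- c"] y yx by (simp add: edge_dirs_def neg)
  qed
qed

text \<open>An edge of the complex is a closed interval: in each of its two directions it either is
  unbounded or ends in exactly one vertex.\<close>

lemma card_enlarged_plus_ends:
  assumes S: "S \<in> edge_tuples j F"
  shows "card (enlarged S) + card (edge_ends j F S) = 2"
proof -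
  obtain x where x: "S = supp_tuple F x" using S by (auto simp: edge_tuples_def)
  note S' = S[unfolded x]
  let ?hit = "\<lambda>V u. u \<in> edge_dirs j S \<and> (\<exists>s>0. V = supp_tuple F (x + s *\<^sub>R real_vec u))"
  define g where "g = (\<lambda>V. SOME u. ?hit V u)"
  have g: "?hit V (g V)" if V: "V \<in> enlarged S" for V
  proof -
    obtain u where "?hit V u" using enlarged_on_line[OF S', of V] V unfolding x by blast
    then show ?thesis unfolding g_def by (rule someI)
  qed
  have unique: "V = W" if VW: "V \<in> enlarged S" "W \<in> enlarged S" "?hit V u" "?hit W u" for V W u
  proof -
    obtain s t where "0 < s" "0 < t" "V = supp_tuple F (x + s *\<^sub>R real_vec u)" "W = supp_tuple F (x + t *\<^sub>R real_vec u)"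
      using VW(3,4) by blast
    then show ?thesis
      using enlarged_le[OF S', of u s t] enlarged_le[OF S', of u t s] VW unfolding x by (metis order_antisym)
  qed
  have "bij_betw g (enlarged S) (edge_dirs j S - edge_ends j F S)"
    unfolding bij_betw_def
  proof (intro conjI inj_onI subset_antisym image_subsetI subsetI)
    show "V = W" if "V \<in> enlarged S" "W \<in> enlarged S" "g V = g W" for V W
      using unique[OF that(1,2)] g[OF that(1)] g[OF that(2)] that(3) by metis
    show "g V \<in> edge_dirs j S - edge_ends j F S" if V: "V \<in> enlarged S" for V
    proof -
      from g[OF V] obtain t where t: "g V \<in> edge_dirs j S" "0 < t" "V = supp_tuple F (x + t *\<^sub>R real_vec (g V))"
        by blast
      have "g V \<notin> edge_ends j F S"
        using enlarged_not_end[OF S', of "g V" t] t V unfolding x by metis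
      then show ?thesis using t(1) by blast
    qed
    fix u assume u: "u \<in> edge_dirs j S - edge_ends j F S"
    then obtain s where s: "0 < s" "supp_tuple F (x + s *\<^sub>R real_vec u) \<in> enlarged S"
      using enlarged_exists[OF S'] unfolding x by blast
    define V where "V = supp_tuple F (x + s *\<^sub>R real_vec u)"
    have V: "V \<in> enlarged S" using s by (simp add: V_def)
    from g[OF V] obtain t where gV: "g V \<in> edge_dirs j S" and t: "0 < t" "V = supp_tuple F (x + t *\<^sub>R real_vec (g V))"
      by blast
    have "g V = u"
    proof (rule ccontr)
      \<comment> \<open>One endpoint cannot be reached in both directions: its new exponent would
        have to grow faster than \<open>p\<close> along \<open>u\<close> and along the opposite of
        \<open>u\<close>.\<close>
      assume "g V \<noteq> u"
      then have op: "g V = - u" using gV u by (auto simp: edge_dirs_def)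
      obtain i r where r: "r \<in> V i - S i" using enlarged_witness[OF V] by blast
      obtain p where p: "p \<in> S i" using ne unfolding x by blast
      have "scalar_product u p < scalar_product u r"
        using enlarged_along(1)[OF S', of u s r i p] u s r p unfolding x V_def by blast
      moreover have "scalar_product (g V) p < scalar_product (g V) r"
        using enlarged_along(1)[OF S', of "g V" t r i p] gV t V r p unfolding x by metis
      ultimately show False by (simp add: op scalar_product_minus_left)
    qed
    then show "u \<in> g ` enlarged S" using V by blast
  qed
  then have "card (enlarged S) = card (edge_dirs j S - edge_ends j F S)"
    by (rule bij_betw_same_card)
  moreover have "edge_ends j F S \<subseteq> edge_dirs j S" by (auto simp: edge_ends_def)
  moreover have "card (edge_dirs j S) = 2" using S by (intro card_edge_dirs) (simp add: edge_tuples_def)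
  moreover have "finite (edge_dirs j S)" by (simp add: edge_dirs_def)
  ultimately show ?thesis
    by (metis card_Diff_subset card_mono finite_subset le_add_diff_inverse2)
qed

section \<open>Vertices of the subdivided curve and cancellation there\<close>

text \<open>A small step in the direction of \<open>indep_tuple_separate\<close> drops
  \<open>c\<close> from the maximum, keeps all other ties and, being small, all strict
  inequalities.\<close>

lemma remove_realized:
  assumes c: "c \<in> supp_tuple F x i" and rest: "supp_tuple F x i - {c} \<noteq> {}"
  shows "(supp_tuple F x)(i := supp_tuple F x i - {c}) \<in> range (supp_tuple F)"
proof -
  let ?V = "supp_tuple F x" and ?W = "(supp_tuple F x)(i := supp_tuple F x i - {c})"
  obtain y where y: "orth_tuple y ?W" "\<And>a. a \<in> ?V i - {c} \<Longrightarrow> y \<bullet> real_vec c < y \<bullet> real_vec a"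
    using indep_tuple_separate[OF indep fin ne c rest] by blast
  have "\<forall>\<^sub>F t in at_right 0. local_support (F m) (x + t *\<^sub>R y) = ?W m" for m
  proof (rule eventually_local_support_eq[OF fin_A[of m]])
    show "?W m \<subseteq> A m" using supp_sub[of x m] supp_sub[of x i] by auto
    show "?W m \<noteq> {}" using ne[of x m] rest by simp
    show "\<forall>\<^sub>F t in at_right 0. trop_val (F m) a (x + t *\<^sub>R y) = trop_val (F m) b (x + t *\<^sub>R y)"
      if "a \<in> ?W m" "b \<in> ?W m" for a b
    proof -
      have "a \<in> ?V m" "b \<in> ?V m" using that by (auto split: if_splits)
      then have "trop_val (F m) a x = trop_val (F m) b x" by (rule val_eq)
      moreover have "y \<bullet> real_vec a = y \<bullet> real_vec b"
        using y(1) that unfolding orth_tuple_def by blast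
      ultimately show ?thesis by (simp add: trop_val_line)
    qed
    show "\<forall>\<^sub>F t in at_right 0. trop_val (F m) b (x + t *\<^sub>R y) < trop_val (F m) a (x + t *\<^sub>R y)"
      if a: "a \<in> ?W m" and b: "b \<in> A m - ?W m" for a b
    proof (cases "b \<in> ?V m")
      case True
      then have "m = i" "b = c" using b by (auto split: if_splits)
      then have "trop_val (F m) b x = trop_val (F m) a x" "y \<bullet> real_vec b < y \<bullet> real_vec a"
        using val_eq[of c x i a] y(2) a c by auto
      then have "trop_val (F m) b (x + t *\<^sub>R y) < trop_val (F m) a (x + t *\<^sub>R y)" if "0 < t" for t
        using that by (simp add: trop_val_line)
      then show ?thesis by (intro eventually_at_right_less[THEN eventually_mono]) auto
    next
      case False
      have "a \<in> ?V m" using a by (auto split: if_splits)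
      then have less: "trop_val (F m) b x < trop_val (F m) a x" using val_less b False by blast
      have "((\<lambda>t. trop_val (F m) a (x + t *\<^sub>R y) - trop_val (F m) b (x + t *\<^sub>R y)) \<longlongrightarrow>
          (trop_val (F m) a x + 0 * (y \<bullet> real_vec a)) - (trop_val (F m) b x + 0 * (y \<bullet> real_vec b))) (at_right 0)"
        unfolding trop_val_line by (intro tendsto_intros)
      then have "\<forall>\<^sub>F t in at_right 0. 0 < trop_val (F m) a (x + t *\<^sub>R y) - trop_val (F m) b (x + t *\<^sub>R y)"
        by (rule order_tendstoD) (use less in simp)
      then show ?thesis by (rule eventually_mono) simp
    qed
  qed simp_all
  then have "\<forall>\<^sub>F t in at_right (0::real). \<forall>m. local_support (F m) (x + t *\<^sub>R y) = ?W m"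
    by (rule eventually_all_finite)
  from eventually_happens'[OF trivial_limit_at_right_real this]
  obtain t where t: "\<forall>m. local_support (F m) (x + t *\<^sub>R y) = ?W m" ..
  have "?W = supp_tuple F (x + t *\<^sub>R y)"
    by (rule ext) (simp only: supp_tuple_def t)
  then show ?thesis by simp
qed

text \<open>An edge has \<Sum>(card (S i) - 1) = n - 1, and by independence no label exceeds n in
  this sum. So exactly one exponent can join.\<close>

lemma enlarged_one_more:
  assumes S: "S \<in> edge_tuples j F" and V: "V \<in> enlarged S"
  obtains i b where "b \<notin> S i" "V = S(i := insert b (S i))"
proof -
  have VR: "V \<in> range (supp_tuple F)" and le: "\<And>m. S m \<subseteq> V m" and neq: "S \<noteq> V"
    using V by (auto simp: enlarged_def le_fun_def)
  obtain x where x: "V = supp_tuple F x" using VR by blast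
  have SR: "S \<in> range (supp_tuple F)" using S by (simp add: edge_tuples_def)
  obtain i b where b: "b \<in> V i - S i" using enlarged_witness[OF V] by blast
  define W where "W = S(i := insert b (S i))"
  have finS: "finite (S m)" and neS: "S m \<noteq> {}" and finV: "finite (V m)" for m
    using SR x fin ne by auto
  have WV: "W m \<subseteq> V m" and SW: "S m \<subseteq> W m" and finW: "finite (W m)" for m
    using le b finS by (auto simp: W_def)
  have "(\<Sum>m\<in>UNIV. card (W m) - 1) = CARD('n)"
  proof -
    have "(\<Sum>m\<in>UNIV. card (W m) - 1) = (\<Sum>m\<in>UNIV. (card (S m) - 1) + (if m = i then 1 else 0))"
    proof (rule sum.cong)
      fix m
      have "0 < card (S m)" using finS neS by (simp add: card_gt_0_iff)
      then show "card (W m) - 1 = (card (S m) - 1) + (if m = i then 1 else 0)"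
        using b finS by (auto simp: W_def)
    qed simp
    also have "\<dots> = Suc (\<Sum>m\<in>UNIV. card (S m) - 1)" by (simp add: sum.distrib)
    also have "\<dots> = CARD('n)" using S by (intro sum_card_edge) (auto simp: edge_tuples_def)
    finally show ?thesis .
  qed
  moreover have "(\<Sum>m\<in>UNIV. card (V m) - 1) \<le> CARD('n)"
    unfolding x by (rule indep_tuple_card_le[OF indep fin ne])
  ultimately have le': "(\<Sum>m\<in>UNIV. card (V m) - 1) \<le> (\<Sum>m\<in>UNIV. card (W m) - 1)" by simp
  have "W = V"
  proof (rule ccontr)
    assume "W \<noteq> V"
    then obtain m where m: "W m \<noteq> V m" by blast
    have "card (W m) - 1 \<le> card (V m) - 1" for m
      using card_mono[OF finV WV] by (rule diff_le_mono)
    moreover have "card (W m) - 1 < card (V m) - 1"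
    proof -
      have "card (W m) < card (V m)" using m WV finV by (intro psubset_card_mono) auto
      moreover have "0 < card (W m)" using neS SW finW by (metis card_gt_0_iff subset_empty)
      ultimately show ?thesis by linarith
    qed
    ultimately have "(\<Sum>m\<in>UNIV. card (W m) - 1) < (\<Sum>m\<in>UNIV. card (V m) - 1)"
      by (intro sum_strict_mono_ex1) auto
    then show False using le' by simp
  qed
  then show ?thesis using that[of b i] b by (simp add: W_def)
qed

text \<open>All edge labels have the same block sizes, so each edge at \<open>V\<close> lacks one
  element of the same block \<open>i\<close>. Conversely, every such removal is realized by a nearby
  point.\<close>

lemma edges_below:
  assumes S: "S \<in> edge_tuples j F" and V: "V \<in> enlarged S" and b: "b \<notin> S i" "V = S(i := insert b (S i))"
  shows "{T \<in> edge_tuples j F. V \<in> enlarged T} = (\<lambda>c. V(i := V i - {c})) ` V i"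
proof (rule subset_antisym[OF subsetI image_subsetI])
  fix T assume "T \<in> {T \<in> edge_tuples j F. V \<in> enlarged T}"
  then have T: "T \<in> edge_tuples j F" and VT: "V \<in> enlarged T" by auto
  have cardT: "card (T m) = card (S m)" for m
    using S T by (cases "m = j") (auto simp: edge_tuples_def curve_segments_def)
  have TV: "T m \<subseteq> V m" for m using VT by (auto simp: enlarged_def le_fun_def)
  have finV: "finite (V m)" for m using V fin by (auto simp: enlarged_def)
  have off: "T m = V m" if "m \<noteq> i" for m
    using that b(2) by (intro card_subset_eq[OF finV TV]) (simp add: cardT)
  have finS: "finite (S i)" using finV[of i] b(2) by simp
  have "card (V i) = Suc (card (T i))" using b finS by (simp add: cardT)
  then have "card (V i - T i) = 1"
    using TV finV by (metis Suc_eq_plus1_left add_diff_cancel_right' card_Diff_subset finite_subset)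
  then obtain c where c: "V i - T i = {c}" by (auto simp: card_1_singleton_iff)
  then have "T i = V i - {c}" using TV[of i] by blast
  then have "T = V(i := V i - {c})" using off by (simp add: fun_eq_iff)
  then show "T \<in> (\<lambda>c. V(i := V i - {c})) ` V i" using c by blast
next
  fix c assume c: "c \<in> V i"
  obtain x where x: "V = supp_tuple F x" using V by (auto simp: enlarged_def)
  let ?T = "V(i := V i - {c})"
  have finS: "finite (S i)" and neS: "S i \<noteq> {}" using S fin ne by (auto simp: edge_tuples_def)
  have card: "card (V i - {c}) = card (S i)"
    using b c finS by (simp add: card_Diff_singleton)
  then have "V i - {c} \<noteq> {}" using finS neS by (metis card_eq_0_iff card.empty)
  then have TR: "?T \<in> range (supp_tuple F)" using remove_realized[of c x i] c x by simp
  have "card (?T m) = card (S m)" for m using card b(2) by auto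
  then have "?T \<in> edge_tuples j F"
    using S TR by (simp add: edge_tuples_def curve_segments_def del: fun_upd_apply)
  moreover have "?T \<le> V" by (auto simp: le_fun_def)
  moreover have "?T \<noteq> V" using c by (metis DiffE fun_upd_same insertI1)
  moreover have "V \<in> range (supp_tuple F)" using x by blast
  ultimately show "?T \<in> {T \<in> edge_tuples j F. V \<in> enlarged T}"
    by (simp only: enlarged_def mem_Collect_eq simp_thms)
qed

text \<open>By additivity in slot \<open>i\<close>, removing \<open>c\<close> adds to the weight of
  \<open>V\<close> the determinant with \<open>mod2_vec c\<close> in that slot. Summing over
  \<open>c\<close> gives \<open>card (V i) + 1\<close> times the weight of \<open>V\<close>. The
  block has 2 elements if \<open>i = j\<close>, where \<open>V\<close> is an intersection point, and
  3 otherwise.\<close>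

lemma sum_weight_edges_below:
  assumes "V \<in> range (supp_tuple F)"
  shows "(\<Sum>S\<in>{S \<in> edge_tuples j F. V \<in> enlarged S}. weight \<zeta> S) = (if all_segments V then weight \<zeta> V else 0)"
proof (cases "{S \<in> edge_tuples j F. V \<in> enlarged S} = {}")
  \<comment> \<open>A label of an intersection point always has an edge below it: one exponent can
    be removed from slot \<open>j\<close>.\<close>
  case True
  have "\<not> all_segments V"
  proof
    assume seg: "all_segments V"
    then obtain a b where ab: "V j = {a, b}" "a \<noteq> b" unfolding all_segments_def card_2_iff by blast
    obtain x where x: "V = supp_tuple F x" using assms by blast
    let ?T = "V(j := V j - {a})"
    have "?T \<in> range (supp_tuple F)" using remove_realized[of a x j] ab x by auto
    then have "?T \<in> edge_tuples j F"
      using seg ab by (auto simp: edge_tuples_def curve_segments_def all_segments_def)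
    moreover have "V \<in> enlarged ?T" using assms ab by (auto simp: enlarged_def le_fun_def fun_eq_iff)
    ultimately show False using True by blast
  qed
  then show ?thesis using True by (simp only: sum.empty if_False)
next
  case False
  then obtain S where S: "S \<in> edge_tuples j F" "V \<in> enlarged S" by blast
  obtain i b where b: "b \<notin> S i" "V = S(i := insert b (S i))" using enlarged_one_more[OF S] by blast
  have finV: "finite (V m)" for m using assms fin by auto
  let ?k = "kvec \<zeta> V" and ?\<Sigma> = "\<Sum>a\<in>V i. mod2_vec a"
  have inj: "inj_on (\<lambda>c. V(i := V i - {c})) (V i)"
    by (rule inj_onI) (metis Diff_iff fun_upd_same insertI1 insert_iff empty_iff)
  have wV: "weight \<zeta> V = det2 (?k(Some i := ?\<Sigma>))"
    using weight_upd[of \<zeta> V i "V i"] by (simp only: fun_upd_triv)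
  have "(\<Sum>S\<in>{S \<in> edge_tuples j F. V \<in> enlarged S}. weight \<zeta> S) = (\<Sum>c\<in>V i. weight \<zeta> (V(i := V i - {c})))"
    unfolding edges_below[OF S b] by (rule sum.reindex[OF inj, unfolded o_def])
  also have "\<dots> = (\<Sum>c\<in>V i. weight \<zeta> V + det2 (?k(Some i := mod2_vec c)))"
  proof (rule sum.cong)
    fix c assume c: "c \<in> V i"
    have "?\<Sigma> = mod2_vec c + (\<Sum>a\<in>V i - {c}. mod2_vec a)" by (rule sum.remove[OF finV c])
    then have "(\<Sum>a\<in>V i - {c}. mod2_vec a) = ?\<Sigma> + mod2_vec c"
      by (metis add.commute add_diff_cancel_left' bit_vec_minus)
    then show "weight \<zeta> (V(i := V i - {c})) = weight \<zeta> V + det2 (?k(Some i := mod2_vec c))"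
      unfolding wV weight_upd by (simp only: det2_add)
  qed simp
  also have "\<dots> = of_nat (card (V i)) * weight \<zeta> V + (\<Sum>c\<in>V i. det2 (?k(Some i := mod2_vec c)))"
    by (simp only: sum.distrib sum_constant)
  also have "\<dots> = of_nat (card (V i)) * weight \<zeta> V + weight \<zeta> V"
    unfolding wV det2_sum[OF finV] ..
  also have "\<dots> = (if all_segments V then weight \<zeta> V else 0)"
  proof -
    have card: "card (V m) = (if m = i then 1 else 0) + (if m = j then 1 else 2)" for m
      using S(1) b finV[of i] by (auto simp: edge_tuples_def curve_segments_def)
    have "all_segments V \<longleftrightarrow> i = j"
      unfolding all_segments_def card by (cases "i = j") auto
    moreover have "card (V i) = (if i = j then 2 else 3)" by (simp add: card)
    ultimately show ?thesis by (cases "weight \<zeta> V") simp_all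
  qed
  finally show ?thesis .
qed

lemma finite_edge_tuples: "finite (edge_tuples j F)"
  unfolding edge_tuples_def using finite_range_supp_tuple[OF proper] by simp

text \<open>Double counting of incidences between edges and endpoints. Bounded and unbounded ends of
  an edge total 2, so their numbers have the same parity; the sum over bounded ends is regrouped by
  vertices.\<close>

lemma iota2_edge_ends: "iota2 F \<zeta> = (\<Sum>S\<in>edge_tuples j F. \<Sum>u\<in>edge_ends j F S. weight \<zeta> S)"
proof -
  let ?R = "range (supp_tuple F)"
  have finR: "finite ?R" by (rule finite_range_supp_tuple[OF proper])
  have "(\<Sum>u\<in>edge_ends j F S. weight \<zeta> S) = (\<Sum>V\<in>enlarged S. weight \<zeta> S)" if "S \<in> edge_tuples j F" for S
  proof -
    have "even (card (enlarged S) + card (edge_ends j F S))"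
      using card_enlarged_plus_ends[OF that] by simp
    then have "even (card (edge_ends j F S)) \<longleftrightarrow> even (card (enlarged S))" by simp
    then have "(of_nat (card (edge_ends j F S)) :: bit) = of_nat (card (enlarged S))"
      unfolding of_nat_bit_eq by simp
    then show ?thesis by (simp only: sum_constant)
  qed
  then have "(\<Sum>S\<in>edge_tuples j F. \<Sum>u\<in>edge_ends j F S. weight \<zeta> S) =
      (\<Sum>S\<in>edge_tuples j F. \<Sum>V\<in>enlarged S. weight \<zeta> S)"
    by (rule sum.cong[OF refl])
  also have "\<dots> = (\<Sum>S\<in>edge_tuples j F. \<Sum>V\<in>{V \<in> ?R. V \<in> enlarged S}. weight \<zeta> S)"
    by (intro sum.cong) (auto simp: enlarged_def)
  also have "\<dots> = (\<Sum>V\<in>?R. \<Sum>S\<in>{S \<in> edge_tuples j F. V \<in> enlarged S}. weight \<zeta> S)"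
    by (rule sum.swap_restrict[OF finite_edge_tuples finR])
  also have "\<dots> = (\<Sum>V\<in>?R. if all_segments V then weight \<zeta> V else 0)"
    by (rule sum.cong[OF refl sum_weight_edges_below])
  also have "\<dots> = (\<Sum>V\<in>point_tuples F. weight \<zeta> V)"
    unfolding point_tuples_def by (rule sum.inter_filter[OF finR, symmetric])
  also have "\<dots> = iota2 F \<zeta>"
    by (rule iota2_eq_sum_point_tuples[OF generic_tuple_transverse[OF generic] proper, symmetric])
  finally show ?thesis ..
qed

section \<open>Unbounded edges and the rays of the curve\<close>

text \<open>Far out on the ray only exponents maximizing \<open>u\<close> survive in slot
  \<open>j\<close>, so \<open>u\<close> is orthogonal to the whole label. The sum of the numbers
  \<open>card (V i) - 1\<close> is then below n, and the n - 1 other slots already use it up, which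
  leaves one exponent in slot \<open>j\<close>.\<close>

lemma ray_edge_exists:
  assumes "(e, u) \<in> curve_rays j F"
  obtains a where "e(j := {a}) \<in> edge_tuples j F" "u \<in> edge_ends j F (e(j := {a}))"
proof -
  from assms obtain x where e: "e j = {}" "curve_segments j e" "u \<in> edge_dirs j e"
    and x: "\<And>i. i \<noteq> j \<Longrightarrow> supp_tuple F x i = e i"
    and max: "\<And>i p. i \<noteq> j \<Longrightarrow> p \<in> e i \<Longrightarrow> maximal_on u (A i) p"
    unfolding curve_rays_def supp_tuple_def by blast
  have "A j \<noteq> {}" using proper by (simp add: proper_tuple_def)
  then obtain b where b: "maximal_on u (A j) b"
    by (rule maximal_on_exists[OF fin_A])
  let ?B = "{r \<in> A j. scalar_product u r = scalar_product u b}"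
  \<comment> \<open>For \<open>r\<close> outside \<open>?B\<close> this is the time after which the
    maximizer \<open>b\<close> exceeds \<open>r\<close> along the ray.\<close>
  let ?q = "\<lambda>r. (trop_val (F j) r x - trop_val (F j) b x) / of_int (scalar_product u b - scalar_product u r)"
  have "\<forall>\<^sub>F s in at_top. 0 < s \<and> (\<forall>r\<in>A j - ?B. ?q r < s)"
    using fin_A by (intro eventually_conj eventually_gt_at_top eventually_ball_finite ballI) auto
  then obtain s where s: "0 < s" and large: "\<And>r. r \<in> A j - ?B \<Longrightarrow> ?q r < s"
    using eventually_happens'[OF trivial_limit_at_top_linorder] by blast
  define V where "V = supp_tuple F (x + s *\<^sub>R real_vec u)"
  have off: "V i = e i" if "i \<noteq> j" for i
    unfolding V_def supp_tuple_apply
  proof (rule local_support_eqI[OF fin_A])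
    show "e i \<subseteq> A i" "e i \<noteq> {}" using x[OF that] supp_sub[of x i] ne[of x i] by auto
    show "trop_val (F i) a (x + s *\<^sub>R real_vec u) = trop_val (F i) c (x + s *\<^sub>R real_vec u)"
      if "a \<in> e i" "c \<in> e i" for a c
      using that val_eq[of a x i c] edge_dirs(2)[OF e(2,3) \<open>i \<noteq> j\<close> that] x[OF \<open>i \<noteq> j\<close>]
      by (simp add: val_line)
    show "trop_val (F i) c (x + s *\<^sub>R real_vec u) < trop_val (F i) a (x + s *\<^sub>R real_vec u)"
      if "a \<in> e i" "c \<in> A i - e i" for a c
    proof -
      have "trop_val (F i) c x < trop_val (F i) a x"
        using val_less[of a x i c] that x[OF \<open>i \<noteq> j\<close>] by simp
      moreover have "s * of_int (scalar_product u c) \<le> s * of_int (scalar_product u a)"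
        using max[OF \<open>i \<noteq> j\<close> that(1)] that(2) s by (intro mult_left_mono) (auto simp: maximal_on_def)
      ultimately show ?thesis unfolding val_line by linarith
    qed
  qed
  have Vj: "V j \<subseteq> ?B"
  proof (rule subsetI, rule ccontr)
    fix r assume r: "r \<in> V j" "r \<notin> ?B"
    then have rA: "r \<in> A j" using supp_sub unfolding V_def by blast
    have "scalar_product u r < scalar_product u b"
      using b r rA by (auto simp: maximal_on_def order_le_less)
    then have "trop_val (F j) r (x + s *\<^sub>R real_vec u) < trop_val (F j) b (x + s *\<^sub>R real_vec u)"
      using large[of r] r rA unfolding val_line by (simp add: divide_less_eq algebra_simps)
    moreover have "b \<in> A j" using b by (simp add: maximal_on_def)
    ultimately show False using r(1) unfolding V_def in_supp_iff by (meson not_less)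
  qed
  have "orth_tuple (real_vec u) V"
    unfolding orth_tuple_def inner_real_vec
  proof (intro allI ballI)
    fix i a c assume ac: "a \<in> V i" "c \<in> V i"
    have "scalar_product u a = scalar_product u c"
    proof (cases "i = j")
      case True
      then have "a \<in> ?B" "c \<in> ?B" using ac Vj by auto
      then show ?thesis by simp
    next
      case False
      then have "a \<in> e i" "c \<in> e i" using ac off by auto
      then show ?thesis by (rule edge_dirs(2)[OF e(2,3) False])
    qed
    then show "real_of_int (scalar_product u a) = real_of_int (scalar_product u c)" by simp
  qed
  then have "(\<Sum>i\<in>UNIV. card (V i) - 1) < CARD('n)"
    unfolding V_def by (intro indep_tuple_card_less[OF indep fin ne odd_vec_nonzero[OF edge_dirs(1)[OF e(2,3)]]])
  moreover have "(\<Sum>i\<in>UNIV. card (V i) - 1) = (card (V j) - 1) + (\<Sum>i\<in>UNIV - {j}. card (V i) - 1)"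
    by (rule sum.remove) auto
  moreover have "(\<Sum>i\<in>UNIV - {j}. card (V i) - 1) = (\<Sum>i\<in>UNIV - {j}. 1)"
    using e(2) off by (intro sum.cong) (auto simp: curve_segments_def)
  moreover have "0 < card (V j)" using fin ne by (simp add: V_def card_gt_0_iff)
  ultimately have "card (V j) = 1" by (simp add: card_Diff_singleton)
  then obtain a where a: "V j = {a}" by (auto simp: card_1_singleton_iff)
  have eV: "e(j := {a}) = V" using off a by (simp add: fun_eq_iff)
  show ?thesis
  proof (rule that[of a])
    show "e(j := {a}) \<in> edge_tuples j F"
      unfolding eV edge_tuples_def using e(2) off a by (auto simp: V_def curve_segments_def)
    have "maximal_on u (A j) a" using a Vj b by (auto simp: maximal_on_def)
    then show "u \<in> edge_ends j F (e(j := {a}))"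
      using e(3) max by (auto simp: edge_ends_def edge_dirs_upd simp del: fun_upd_apply)
        (auto split: if_splits)
  qed
qed

text \<open>Both exponents maximize \<open>u\<close>, so the difference of their affine functions is
  constant along the common direction of the two edges. Yet \<open>a\<close> is strictly ahead at
  \<open>x\<close> and \<open>b\<close> at \<open>y\<close>.\<close>

lemma edge_end_unique:
  assumes S: "e(j := {a}) \<in> edge_tuples j F" "u \<in> edge_ends j F (e(j := {a}))"
    and T: "e(j := {b}) \<in> edge_tuples j F" "u \<in> edge_ends j F (e(j := {b}))"
  shows "a = b"
proof (rule ccontr)
  assume ab: "a \<noteq> b"
  obtain x y where x: "e(j := {a}) = supp_tuple F x" and y: "e(j := {b}) = supp_tuple F y"
    using S T by (auto simp: edge_tuples_def)
  have "a \<in> A j" "b \<in> A j" "maximal_on u (A j) a" "maximal_on u (A j) b"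
    using S(2) T(2) unfolding edge_ends_def maximal_on_def by (force)+
  then have uab: "scalar_product u a = scalar_product u b"
    by (auto simp: maximal_on_def intro: antisym)
  let ?S = "supp_tuple F x" and ?v = "edge_normal j (supp_tuple F x)"
  have Sx: "?S \<in> edge_tuples j F" using S(1) unfolding x .
  then have seg: "curve_segments j ?S" and one: "card (?S j) = 1" by (simp_all add: edge_tuples_def)
  have off: "?S i = supp_tuple F y i" if "i \<noteq> j" for i
    using that by (simp flip: x y)
  have Sj: "?S j = {a}" by (simp flip: x)
  have "u \<in> edge_dirs j ?S" using S(2) unfolding x by (simp add: edge_ends_def)
  then have vab: "scalar_product ?v a = scalar_product ?v b"
    using uab unfolding edge_dirs_def by (auto simp: scalar_product_minus_left)
  have orth: "orth_tuple (y - x) ?S"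
    unfolding orth_tuple_def
  proof (intro allI ballI)
    fix i c d assume cd: "c \<in> ?S i" "d \<in> ?S i"
    show "(y - x) \<bullet> real_vec c = (y - x) \<bullet> real_vec d"
    proof (cases "i = j")
      case False
      then have "c \<in> supp_tuple F y i" "d \<in> supp_tuple F y i" using cd off by auto
      then have "trop_val (F i) c y = trop_val (F i) d y" by (rule val_eq)
      moreover have "trop_val (F i) c x = trop_val (F i) d x" using cd by (rule val_eq)
      ultimately show ?thesis using trop_val_diff[of "F i" c y x] trop_val_diff[of "F i" d y x] by linarith
    qed (use cd Sj in simp)
  qed
  have orthv: "orth_tuple (real_vec ?v) ?S"
    unfolding orth_tuple_def inner_real_vec
  proof (intro allI ballI)
    fix i c d assume "c \<in> ?S i" "d \<in> ?S i"
    moreover have "?v \<in> edge_dirs j ?S" by (simp add: edge_dirs_def)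
    ultimately show "real_of_int (scalar_product ?v c) = real_of_int (scalar_product ?v d)"
      using edge_dirs_const[OF Sx] by metis
  qed
  have "CARD('n) \<le> Suc (\<Sum>i\<in>UNIV. card (?S i) - 1)" using sum_card_edge[OF seg one] by simp
  from indep_tuple_orth_unique[OF indep fin ne this odd_vec_nonzero[OF edge_normal(1)[OF seg]] orthv orth]
  obtain c where c: "y - x = c *\<^sub>R real_vec ?v" .
  have "trop_val (F j) a y - trop_val (F j) b y = trop_val (F j) a x - trop_val (F j) b x"
    using trop_val_diff[of "F j" a y x] trop_val_diff[of "F j" b y x] vab
    unfolding c by (simp add: inner_real_vec)
  moreover have "trop_val (F j) b x < trop_val (F j) a x"
    using val_less[of a x j b] \<open>b \<in> A j\<close> ab x[symmetric] by auto
  moreover have "trop_val (F j) a y < trop_val (F j) b y"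
    using val_less[of b y j a] \<open>a \<in> A j\<close> ab y[symmetric] by auto
  ultimately show False by linarith
qed

text \<open>Each ray carries exactly one unbounded piece at its far end, so the sum over edge ends
  can be indexed by rays. The function \<open>a\<close> gives the exponent dominating at infinity
  and does not depend on \<zeta>.\<close>

lemma iota2_rays:
  obtains a where "\<And>r. r \<in> curve_rays j F \<Longrightarrow> maximal_on (snd r) (A j) (a r)"
    "\<And>\<zeta>. iota2 F \<zeta> = (\<Sum>r\<in>curve_rays j F. weight \<zeta> ((fst r)(j := {a r})))"
proof -
  define a where "a = (\<lambda>(e, u). SOME a. e(j := {a}) \<in> edge_tuples j F \<and> u \<in> edge_ends j F (e(j := {a})))"
  have a: "e(j := {a (e, u)}) \<in> edge_tuples j F" "u \<in> edge_ends j F (e(j := {a (e, u)}))"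
    if eu: "(e, u) \<in> curve_rays j F" for e u
  proof -
    obtain c where "e(j := {c}) \<in> edge_tuples j F \<and> u \<in> edge_ends j F (e(j := {c}))"
      using ray_edge_exists[OF eu] by blast
    then have "e(j := {a (e, u)}) \<in> edge_tuples j F \<and> u \<in> edge_ends j F (e(j := {a (e, u)}))"
      unfolding a_def prod.case by (rule someI)
    then show "e(j := {a (e, u)}) \<in> edge_tuples j F" "u \<in> edge_ends j F (e(j := {a (e, u)}))" by auto
  qed
  show ?thesis
  proof (rule that[of a])
    fix r assume "r \<in> curve_rays j F"
    then show "maximal_on (snd r) (A j) (a r)"
      using a(2)[of "fst r" "snd r"] unfolding edge_ends_def by force
  next
    fix \<zeta>
    have edge_ray: "(S(j := {}), u) \<in> curve_rays j F \<and> S(j := {a (S(j := {}), u)}) = S"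
      if S: "S \<in> edge_tuples j F" and u: "u \<in> edge_ends j F S" for S u
    proof
      obtain x where x: "S = supp_tuple F x" using S by (auto simp: edge_tuples_def)
      have "u \<in> edge_dirs j (S(j := {}))" using u by (simp add: edge_ends_def edge_dirs_upd)
      moreover have "\<forall>i. i \<noteq> j \<longrightarrow> local_support (F i) x = (S(j := {})) i"
        by (simp add: x supp_tuple_apply)
      ultimately show ray: "(S(j := {}), u) \<in> curve_rays j F"
        using S u unfolding curve_rays_def edge_ends_def edge_tuples_def curve_segments_def
        by auto
      obtain c where c: "S j = {c}" using S by (auto simp: edge_tuples_def card_1_singleton_iff)
      have sing: "S(j := {c}) = S" using c by (simp add: fun_eq_iff)
      let ?d = "a (S(j := {}), u)"
      have up: "(S(j := {}))(j := {d}) = S(j := {d})" for d by simp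
      have "?d = c"
        using edge_end_unique[of S ?d u c] a[OF ray] S u unfolding up sing by blast
      then show "S(j := {?d}) = S" using sing by simp
    qed
    have "iota2 F \<zeta> = (\<Sum>(S, u)\<in>(SIGMA S:edge_tuples j F. edge_ends j F S). weight \<zeta> S)"
      unfolding iota2_edge_ends
      by (rule sum.Sigma[OF finite_edge_tuples]) (auto simp: edge_ends_def edge_dirs_def)
    also have "\<dots> = (\<Sum>r\<in>curve_rays j F. weight \<zeta> ((fst r)(j := {a r})))"
    proof (rule sum.reindex_bij_witness[of _ "\<lambda>(e, u). (e(j := {a (e, u)}), u)" "\<lambda>(S, u). (S(j := {}), u)"])
      fix m assume "m \<in> (SIGMA S:edge_tuples j F. edge_ends j F S)"
      then obtain S u where m: "m = (S, u)" and S: "S \<in> edge_tuples j F" "u \<in> edge_ends j F S" by auto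
      note er = edge_ray[OF S]
      show "(case case m of (S, u) \<Rightarrow> (S(j := {}), u) of (e, u) \<Rightarrow> (e(j := {a (e, u)}), u)) = m"
        using er by (simp add: m)
      show "(case m of (S, u) \<Rightarrow> (S(j := {}), u)) \<in> curve_rays j F" using er by (simp add: m)
      show "weight \<zeta> ((fst (case m of (S, u) \<Rightarrow> (S(j := {}), u)))(j := {a (case m of (S, u) \<Rightarrow> (S(j := {}), u))})) =
          (case m of (S, u) \<Rightarrow> weight \<zeta> S)"
        using er by (simp add: m)
    next
      fix r assume r: "r \<in> curve_rays j F"
      obtain e u where eu: "r = (e, u)" by (cases r)
      have "e j = {}" using r by (simp add: eu curve_rays_def)
      then have "e(j := {}) = e" by (simp add: fun_eq_iff)
      then show "(case case r of (e, u) \<Rightarrow> (e(j := {a (e, u)}), u) of (S, u) \<Rightarrow> (S(j := {}), u)) = r"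
        by (simp add: eu)
      show "(case r of (e, u) \<Rightarrow> (e(j := {a (e, u)}), u)) \<in> (SIGMA S:edge_tuples j F. edge_ends j F S)"
        using a[of e u] r by (simp add: eu)
    qed
    finally show "iota2 F \<zeta> = (\<Sum>r\<in>curve_rays j F. weight \<zeta> ((fst r)(j := {a r})))" .
  qed
qed

end

subsection \<open>Generic perturbations\<close>

text \<open>For injective \<open>ix\<close> all coefficients are shifted by different powers of
  \<open>t\<close>. \<open>Suc\<close> makes the exponents positive, so \<open>t = 0\<close> gives
  back the tuple. The power depends on slot and exponent only, so perturbing commutes with replacing
  a member.\<close>

definition perturb_poly :: "('n \<times> (int ^ 'n) \<Rightarrow> nat) \<Rightarrow> real \<Rightarrow> 'n \<Rightarrow> 'n trop_poly \<Rightarrow> 'n trop_poly" where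
  "perturb_poly ix t i \<phi> = (trop_support \<phi>, \<lambda>a. trop_coeff \<phi> a + t ^ Suc (ix (i, a)))"

definition perturb ::
  "('n \<times> (int ^ 'n) \<Rightarrow> nat) \<Rightarrow> real \<Rightarrow> ('n \<Rightarrow> 'n trop_poly) \<Rightarrow> 'n \<Rightarrow> 'n trop_poly" where
  "perturb ix t F = (\<lambda>i. perturb_poly ix t i (F i))"

lemma trop_support_perturb: "trop_support (perturb ix t F i) = trop_support (F i)"
  by (simp add: perturb_def perturb_poly_def)

lemma perturb_0: "perturb ix 0 F = F"
  by (simp add: perturb_def perturb_poly_def)

lemma perturb_upd: "perturb ix t (F(j := \<phi>)) = (perturb ix t F)(j := perturb_poly ix t j \<phi>)"
  by (auto simp: perturb_def)

lemma trop_val_perturb: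
  "trop_val (perturb ix t F i) a x = trop_coeff (F i) a + t ^ Suc (ix (i, a)) + real_vec a \<bullet> x"
  by (simp add: trop_val_def perturb_def perturb_poly_def)

lemma proper_perturb: "proper_tuple F \<Longrightarrow> proper_tuple (perturb ix t F)"
  by (simp add: proper_tuple_def trop_support_perturb)

lemma ex_index: "\<exists>ix :: 'n::finite \<times> (int ^ 'n) \<Rightarrow> nat. inj ix"
proof -
  have "countable (UNIV \<times> UNIV :: ('n \<times> (int ^ 'n)) set)"
    by (intro countable_SIGMA countable_finite countableI_type) simp
  then show ?thesis by (auto simp: countable_def)
qed

text \<open>A linear dependence among the exponent vectors attaining the maxima at a common point turns into
  a linear relation between the coefficients, which is a nonzero polynomial condition on \<open>t\<close>.\<close>

lemma finite_not_generic:
  fixes F :: "'n::finite \<Rightarrow> 'n trop_poly"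
  assumes F: "proper_tuple F" and ix: "inj ix"
  shows "finite {t. \<not> generic_tuple (perturb ix t F)}"
proof -
  let ?T = "\<Pi>\<^sub>E i\<in>UNIV. Pow (trop_support (F i))"
  define dep where "dep = (\<lambda>(V :: 'n \<Rightarrow> (int ^ 'n) set) \<mu>. (\<forall>i. (\<Sum>a\<in>V i. \<mu> i a) = (0::real)) \<and>
    (\<Sum>i\<in>UNIV. \<Sum>a\<in>V i. \<mu> i a *\<^sub>R real_vec a) = 0 \<and> (\<exists>i. \<exists>a\<in>V i. \<mu> i a \<noteq> 0))"
  define \<mu> where "\<mu> = (\<lambda>V. SOME \<mu>. dep V \<mu>)"
  \<comment> \<open>The dependence \<mu> applied to the perturbed coefficients, read as a polynomial
    in \<open>t\<close>.\<close>
  define p where "p = (\<lambda>V. \<Sum>(i, a)\<in>Sigma UNIV V.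
     monom (\<mu> V i a * trop_coeff (F i) a) 0 + monom (\<mu> V i a) (Suc (ix (i, a))))"
  have finV: "finite (V i)" if "V \<in> ?T" for V i
    using that F by (auto simp: proper_tuple_def PiE_def Pi_def intro: finite_subset)
  have \<mu>: "dep V (\<mu> V)" if "\<not> indep_tuple V" for V
  proof -
    have "\<exists>\<mu>. dep V \<mu>" using that unfolding indep_tuple_def dep_def by blast
    then show ?thesis unfolding \<mu>_def by (rule someI_ex)
  qed
  have nonzero: "p V \<noteq> 0" if V: "V \<in> ?T" "\<not> indep_tuple V" for V
  proof -
    obtain i a where ia: "a \<in> V i" "\<mu> V i a \<noteq> 0" using \<mu>[OF V(2)] unfolding dep_def by blast
    have fin: "finite (Sigma UNIV V)" using finV[OF V(1)] by auto
    \<comment> \<open>Distinct positive exponents isolate a single coefficient of the dependence;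
      the unperturbed coefficients only enter the constant term.\<close>
    have "coeff (p V) (Suc (ix (i, a))) = (\<Sum>m\<in>Sigma UNIV V. if m = (i, a) then \<mu> V i a else 0)"
      unfolding p_def coeff_sum
    proof (rule sum.cong[OF refl])
      fix m assume "m \<in> Sigma UNIV V"
      obtain i' a' where m: "m = (i', a')" by (cases m)
      show "coeff (case m of (i, a) \<Rightarrow> monom (\<mu> V i a * trop_coeff (F i) a) 0 + monom (\<mu> V i a) (Suc (ix (i, a))))
          (Suc (ix (i, a))) = (if m = (i, a) then \<mu> V i a else 0)"
        by (cases "m = (i, a)") (auto simp: m inj_eq[OF ix])
    qed
    also have "\<dots> = \<mu> V i a" using fin ia(1) by simp
    finally show ?thesis using ia(2) by auto
  qed
  have root: "poly (p V) t = 0"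
    if V: "V = supp_tuple (perturb ix t F) x" "\<not> indep_tuple V" for V t x
  proof -
    have fin: "finite (V i)" for i unfolding V(1) by (rule finite_supp_tuple[OF proper_perturb[OF F]])
    have "V i \<noteq> {}" for i unfolding V(1) by (rule supp_tuple_nonempty[OF proper_perturb[OF F]])
    then obtain q where q: "\<And>i. q i \<in> V i"
      using that[of "\<lambda>i. SOME a. a \<in> V i"] by (simp add: some_in_eq)
    \<comment> \<open>The common value of block \<open>i\<close> at \<open>x\<close>. A perturbed
      coefficient is \<open>m i\<close> minus a linear term in \<open>a\<close>, and the two
      conditions in \<open>dep\<close> annihilate these two parts.\<close>
    define m where "m = (\<lambda>i. trop_val (perturb ix t F i) (q i) x)"
    have val: "trop_coeff (F i) a + t ^ Suc (ix (i, a)) = m i - real_vec a \<bullet> x" if a: "a \<in> V i" for i a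
    proof -
      have "finite (trop_support (perturb ix t F i))"
        using F by (simp add: proper_tuple_def trop_support_perturb)
      then have "trop_val (perturb ix t F i) a x = m i"
        unfolding m_def using local_support_val_eq a q V(1) unfolding supp_tuple_def by blast
      then show ?thesis unfolding trop_val_perturb by simp
    qed
    have "poly (p V) t = (\<Sum>(i, a)\<in>Sigma UNIV V. \<mu> V i a * (trop_coeff (F i) a + t ^ Suc (ix (i, a))))"
      unfolding p_def poly_sum by (rule sum.cong) (auto simp: poly_monom algebra_simps)
    also have "\<dots> = (\<Sum>i\<in>UNIV. \<Sum>a\<in>V i. \<mu> V i a * (trop_coeff (F i) a + t ^ Suc (ix (i, a))))"
      using fin by (simp add: sum.Sigma)
    also have "\<dots> = (\<Sum>i\<in>UNIV. \<Sum>a\<in>V i. \<mu> V i a * m i - (\<mu> V i a *\<^sub>R real_vec a) \<bullet> x)"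
      by (intro sum.cong refl) (simp only: val, simp add: right_diff_distrib)
    also have "\<dots> = (\<Sum>i\<in>UNIV. (\<Sum>a\<in>V i. \<mu> V i a) * m i) - (\<Sum>i\<in>UNIV. \<Sum>a\<in>V i. \<mu> V i a *\<^sub>R real_vec a) \<bullet> x"
      by (simp only: sum_subtractf sum_distrib_right inner_sum_left)
    also have "\<dots> = 0" using \<mu>[OF V(2)] by (simp add: dep_def)
    finally show ?thesis .
  qed
  have "{t. \<not> generic_tuple (perturb ix t F)} \<subseteq> (\<Union>V\<in>{V \<in> ?T. \<not> indep_tuple V}. {t. poly (p V) t = 0})"
  proof
    fix t assume "t \<in> {t. \<not> generic_tuple (perturb ix t F)}"
    then obtain x where x: "\<not> indep_tuple (supp_tuple (perturb ix t F) x)"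
      using proper_perturb[OF F] by (auto simp: generic_tuple_def)
    have "supp_tuple (perturb ix t F) x \<in> ?T"
      using local_support_subset[of "perturb ix t F _"] by (fastforce simp: supp_tuple_def trop_support_perturb)
    then show "t \<in> (\<Union>V\<in>{V \<in> ?T. \<not> indep_tuple V}. {t. poly (p V) t = 0})"
      using x root[OF refl x] by blast
  qed
  moreover have "finite (\<Union>V\<in>{V \<in> ?T. \<not> indep_tuple V}. {t. poly (p V) t = 0})"
  proof (rule finite_UN_I)
    have "finite ?T" using F by (intro finite_PiE) (auto simp: proper_tuple_def)
    then show "finite {V \<in> ?T. \<not> indep_tuple V}" by simp
    show "finite {t. poly (p V) t = 0}" if "V \<in> {V \<in> ?T. \<not> indep_tuple V}" for V
      using nonzero[of V] that by (intro poly_roots_finite) blast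
  qed
  ultimately show ?thesis by (rule finite_subset)
qed

lemma eventually_avoid_finite:
  fixes S :: "real set"
  assumes "finite S"
  shows "\<forall>\<^sub>F t in at_right 0. t \<notin> S"
proof -
  \<comment> \<open>The point 0 may belong to \<open>S\<close>; it is taken out first and excluded
    again by approaching from the right.\<close>
  have "closed (S - {0})" using assms by (simp add: finite_imp_closed)
  then have "open (- (S - {0}))" by (rule open_Compl)
  then have "\<forall>\<^sub>F t in nhds 0. t \<in> - (S - {0})" by (rule eventually_nhds_in_open) simp
  then have "\<forall>\<^sub>F t in at_right 0. t \<in> - (S - {0})"
    unfolding eventually_at_filter by (rule eventually_mono) blast
  moreover have "\<forall>\<^sub>F t in at_right (0::real). 0 < t" by (rule eventually_at_right_less)
  ultimately show ?thesis by eventually_elim auto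
qed

text \<open>A nonzero \<open>u\<close> would move the point along a short segment without changing
  any local support, giving infinitely many common points.\<close>

lemma transverse_no_orth:
  fixes F :: "'n::finite \<Rightarrow> 'n trop_poly"
  assumes F: "transverse F" "proper_tuple F" and V: "V \<in> point_tuples F" and u: "orth_tuple u V"
  shows "u = 0"
proof (rule ccontr)
  assume u0: "u \<noteq> 0"
  obtain x where x: "V = supp_tuple F x" and seg: "all_segments V" using V by (auto simp: point_tuples_def)
  have finA: "finite (trop_support (F i))" for i using F(2) by (simp add: proper_tuple_def)
  have "\<forall>\<^sub>F t in at_right 0. local_support (F i) (x + t *\<^sub>R u) = V i" for i
  proof (rule eventually_local_support_eq[OF finA[of i]])
    show "V i \<subseteq> trop_support (F i)" unfolding x supp_tuple_def by (rule local_support_subset)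
    show "V i \<noteq> {}" unfolding x by (rule supp_tuple_nonempty[OF F(2)])
    show "\<forall>\<^sub>F t in at_right 0. trop_val (F i) a (x + t *\<^sub>R u) = trop_val (F i) b (x + t *\<^sub>R u)"
      if ab: "a \<in> V i" "b \<in> V i" for a b
    proof -
      have "trop_val (F i) a x = trop_val (F i) b x"
        using ab by (intro local_support_val_eq[OF finA]) (simp_all add: x supp_tuple_def)
      moreover have "u \<bullet> real_vec a = u \<bullet> real_vec b" using u ab unfolding orth_tuple_def by blast
      ultimately show ?thesis by (simp add: trop_val_line)
    qed
    show "\<forall>\<^sub>F t in at_right 0. trop_val (F i) b (x + t *\<^sub>R u) < trop_val (F i) a (x + t *\<^sub>R u)"
      if "a \<in> V i" "b \<in> trop_support (F i) - V i" for a b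
    proof -
      have less: "trop_val (F i) b x < trop_val (F i) a x"
        using local_support_val_less[OF finA] that by (simp add: x supp_tuple_def)
      have "((\<lambda>t. trop_val (F i) a (x + t *\<^sub>R u) - trop_val (F i) b (x + t *\<^sub>R u)) \<longlongrightarrow>
          (trop_val (F i) a x + 0 * (u \<bullet> real_vec a)) - (trop_val (F i) b x + 0 * (u \<bullet> real_vec b))) (at_right 0)"
        unfolding trop_val_line by (intro tendsto_intros)
      then have "\<forall>\<^sub>F t in at_right 0. 0 < trop_val (F i) a (x + t *\<^sub>R u) - trop_val (F i) b (x + t *\<^sub>R u)"
        by (rule order_tendstoD) (use less in simp)
      then show ?thesis by (rule eventually_mono) simp
    qed
  qed simp_all
  then have "\<forall>\<^sub>F t in at_right (0::real). \<forall>i. local_support (F i) (x + t *\<^sub>R u) = V i"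
    by (rule eventually_all_finite)
  then obtain d where d: "0 < d" "\<And>t. 0 < t \<Longrightarrow> t < d \<Longrightarrow> \<forall>i. local_support (F i) (x + t *\<^sub>R u) = V i"
    unfolding eventually_at_right_field by blast
  have "(\<lambda>t. x + t *\<^sub>R u) ` {0<..<d} \<subseteq> (\<Inter>i. trop_hypersurface (F i))"
  proof (rule image_subsetI)
    fix t assume "t \<in> {0<..<d}"
    then have "supp_tuple F (x + t *\<^sub>R u) = V" using d(2) by (simp add: supp_tuple_def fun_eq_iff)
    then show "x + t *\<^sub>R u \<in> (\<Inter>i. trop_hypersurface (F i))"
      unfolding transverse_supp_tuple[OF F] using seg by simp
  qed
  moreover have "infinite ((\<lambda>t. x + t *\<^sub>R u) ` {0<..<d})"
    using u0 d(1) by (subst finite_image_iff) (auto simp: inj_on_def infinite_Ioo)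
  ultimately show False using F(1) finite_subset by (auto simp: transverse_def)
qed

text \<open>The ties between \<open>p i\<close> and \<open>q i\<close> form a square linear system
  with inverse \<open>B\<close>, so \<open>x\<close> is the only point that can have the label
  \<open>V\<close>.\<close>

lemma in_point_tuples_perturb_iff:
  fixes F :: "'n::finite \<Rightarrow> 'n trop_poly"
  assumes p: "\<And>i. V i = {p i, q i}" "\<And>i. p i \<noteq> q i" and F: "proper_tuple F"
    and B: "B ** (\<chi> i. real_vec (p i) - real_vec (q i)) = mat 1"
    and x: "x = B *v (\<chi> i. trop_coeff (F i) (q i) - trop_coeff (F i) (p i))"
  shows "V \<in> point_tuples F \<longleftrightarrow> supp_tuple F x = V"
proof
  let ?K = "\<chi> i. real_vec (p i) - real_vec (q i)"
  assume "V \<in> point_tuples F"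
  then obtain y where y: "V = supp_tuple F y" by (auto simp: point_tuples_def)
  have "?K *v y = (\<chi> i. trop_coeff (F i) (q i) - trop_coeff (F i) (p i))"
  proof -
    have "trop_val (F i) (p i) y = trop_val (F i) (q i) y" for i
    proof (rule local_support_val_eq)
      show "finite (trop_support (F i))" using F by (simp add: proper_tuple_def)
      show "p i \<in> local_support (F i) y" "q i \<in> local_support (F i) y"
        using fun_cong[OF y, of i] p(1)[of i] by (auto simp: supp_tuple_def)
    qed
    then have vals: "trop_coeff (F i) (p i) + real_vec (p i) \<bullet> y = trop_coeff (F i) (q i) + real_vec (q i) \<bullet> y" for i
      unfolding trop_val_def .
    have "(real_vec (p i) - real_vec (q i)) \<bullet> y = trop_coeff (F i) (q i) - trop_coeff (F i) (p i)" for i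
      unfolding inner_diff_left using vals[of i] by linarith
    then show ?thesis by (simp add: vec_eq_iff matrix_vector_mul_component)
  qed
  then have "x = B *v (?K *v y)" by (simp only: x)
  also have "\<dots> = y" by (simp only: matrix_vector_mul_assoc B matrix_vector_mul_lid)
  finally show "supp_tuple F x = V" using y by simp
next
  assume "supp_tuple F x = V"
  then show "V \<in> point_tuples F"
    using p by (auto simp: point_tuples_def all_segments_def)
qed

text \<open>The ties prescribed by \<open>V\<close> form a linear system. If it is singular,
  \<open>V\<close> labels no point of a transverse tuple, before or after a generic perturbation. If
  it is regular, its solution is continuous in \<open>t\<close>, and the strict inequalities at
  \<open>t = 0\<close> that decide about \<open>V\<close> persist.\<close>

lemma eventually_point_tuple_iff:
  fixes F :: "'n::finite \<Rightarrow> 'n trop_poly"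
  assumes F: "transverse F" "proper_tuple F" and ix: "inj ix"
  shows "\<forall>\<^sub>F t in at_right 0. generic_tuple (perturb ix t F) \<longrightarrow>
    (V \<in> point_tuples (perturb ix t F) \<longleftrightarrow> V \<in> point_tuples F)"
proof (cases "all_segments V \<and> (\<forall>i. V i \<subseteq> trop_support (F i))")
  case False
  have "V \<notin> point_tuples G" if "\<And>i. trop_support (G i) = trop_support (F i)" for G
    using False local_support_subset[of "G _"] that unfolding point_tuples_def supp_tuple_def by auto
  then have "V \<notin> point_tuples F" "V \<notin> point_tuples (perturb ix t F)" for t
    by (auto simp: trop_support_perturb)
  then show ?thesis by simp
next
  case True
  then have seg: "\<And>i. card (V i) = 2" and VA: "\<And>i. V i \<subseteq> trop_support (F i)" by (auto simp: all_segments_def)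
  have finA: "finite (trop_support (F i))" for i using F(2) by (simp add: proper_tuple_def)
  have "\<exists>f. \<forall>i. V i = {fst (f i), snd (f i)} \<and> fst (f i) \<noteq> snd (f i)"
    using seg unfolding card_2_iff by (intro choice allI) (metis fst_conv snd_conv)
  then obtain f where f: "\<And>i. V i = {fst (f i), snd (f i)}" "\<And>i. fst (f i) \<noteq> snd (f i)" by blast
  define p where "p = (\<lambda>i. fst (f i))"
  define q where "q = (\<lambda>i. snd (f i))"
  have pq: "\<And>i. V i = {p i, q i}" "\<And>i. p i \<noteq> q i" using f by (auto simp: p_def q_def)
  let ?K = "\<chi> i. real_vec (p i) - real_vec (q i)"
  show ?thesis
  proof (cases "\<exists>B. B ** ?K = mat 1")
    case False
    then obtain u where u: "?K *v u = 0" "u \<noteq> 0" unfolding matrix_left_invertible_ker by blast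
    have "u \<bullet> real_vec (p i) = u \<bullet> real_vec (q i)" for i
      using arg_cong[OF u(1), of "\<lambda>x. x $ i"]
      by (simp add: matrix_vector_mul_component inner_diff_left inner_commute[of u])
    then have orth: "orth_tuple u V"
      unfolding orth_tuple_def pq(1) by auto
    have "V \<notin> point_tuples F" using transverse_no_orth[OF F _ orth] u(2) by blast
    moreover have "V \<notin> point_tuples (perturb ix t F)" if "generic_tuple (perturb ix t F)" for t
      using transverse_no_orth[OF generic_tuple_transverse[OF that] generic_tuple_proper[OF that] _ orth] u(2) by blast
    ultimately show ?thesis by simp
  next
    case True
    then obtain B where B: "B ** ?K = mat 1" by blast
    define x where "x = (\<lambda>t. B *v (\<chi> i. trop_coeff (perturb ix t F i) (q i) - trop_coeff (perturb ix t F i) (p i)))"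
    have iff: "V \<in> point_tuples (perturb ix t F) \<longleftrightarrow> supp_tuple (perturb ix t F) (x t) = V" for t
      by (rule in_point_tuples_perturb_iff[OF pq proper_perturb[OF F(2)] B]) (simp add: x_def)
    have iff0: "V \<in> point_tuples F \<longleftrightarrow> supp_tuple F (x 0) = V"
      using iff[of 0] by (simp add: perturb_0)
    have x: "(x \<longlongrightarrow> x 0) (at_right 0)"
      unfolding x_def perturb_def perturb_poly_def
      by (intro bounded_linear.tendsto[OF matrix_vector_mul_bounded_linear] vec_tendstoI) (auto intro!: tendsto_eq_intros)
    have val: "((\<lambda>t. trop_val (perturb ix t F i) a (x t)) \<longlongrightarrow> trop_val (F i) a (x 0)) (at_right 0)" for i a
    proof -
      have "((\<lambda>t. trop_coeff (F i) a + t ^ Suc (ix (i, a)) + real_vec a \<bullet> x t) \<longlongrightarrow>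
          trop_coeff (F i) a + 0 ^ Suc (ix (i, a)) + real_vec a \<bullet> x 0) (at_right 0)"
        by (intro tendsto_intros x)
      then show ?thesis unfolding trop_val_perturb by (simp add: trop_val_def)
    qed
    have less: "\<forall>\<^sub>F t in at_right 0. trop_val (perturb ix t F i) b (x t) < trop_val (perturb ix t F i) a (x t)"
      if "trop_val (F i) b (x 0) < trop_val (F i) a (x 0)" for i a b
    proof -
      have "\<forall>\<^sub>F t in at_right 0. 0 < trop_val (perturb ix t F i) a (x t) - trop_val (perturb ix t F i) b (x t)"
        by (rule order_tendstoD(1)[OF tendsto_diff[OF val val]]) (use that in simp)
      then show ?thesis by (rule eventually_mono) simp
    qed
    have eq: "trop_val (perturb ix t F i) (p i) (x t) = trop_val (perturb ix t F i) (q i) (x t)" for t i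
    proof -
      have "B ** ?K = mat 1" by (rule B)
      then have "?K ** B = mat 1" by (metis matrix_left_right_inverse)
      then have "?K *v x t = (\<chi> i. trop_coeff (perturb ix t F i) (q i) - trop_coeff (perturb ix t F i) (p i))"
        unfolding x_def matrix_vector_mul_assoc by simp
      from arg_cong[OF this, of "\<lambda>x. x $ i"]
      show ?thesis by (simp add: matrix_vector_mul_component trop_val_def inner_diff_left)
    qed
    have eqV: "trop_val (perturb ix t F i) a (x t) = trop_val (perturb ix t F i) b (x t)"
      if "a \<in> V i" "b \<in> V i" for t i a b
      using that eq[of t i] by (auto simp: pq(1))
    show ?thesis
    proof (cases "V \<in> point_tuples F")
      case True
      then have V: "V i = local_support (F i) (x 0)" for i using iff0 by (auto simp: supp_tuple_def)
      have "\<forall>\<^sub>F t in at_right 0. local_support (perturb ix t F i) (x t) = V i" for i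
      proof (rule eventually_local_support_eq)
        show "finite (trop_support (F i))" by (rule finA)
        show "V i \<subseteq> trop_support (F i)" by (rule VA)
        show "trop_support (perturb ix t F i) = trop_support (F i)" for t by (rule trop_support_perturb)
        show "V i \<noteq> {}" by (simp add: pq(1))
        show "\<forall>\<^sub>F t in at_right 0. trop_val (perturb ix t F i) a (x t) = trop_val (perturb ix t F i) b (x t)"
          if "a \<in> V i" "b \<in> V i" for a b
          using eqV[OF that] by simp
        show "\<forall>\<^sub>F t in at_right 0. trop_val (perturb ix t F i) b (x t) < trop_val (perturb ix t F i) a (x t)"
          if "a \<in> V i" "b \<in> trop_support (F i) - V i" for a b
          using local_support_val_less[OF finA] that unfolding V by (intro less) blast
      qed
      then have "\<forall>\<^sub>F t in at_right 0. \<forall>i. local_support (perturb ix t F i) (x t) = V i"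
        by (rule eventually_all_finite)
      then show ?thesis
      proof (rule eventually_mono)
        fix t assume "\<forall>i. local_support (perturb ix t F i) (x t) = V i"
        then have "supp_tuple (perturb ix t F) (x t) = V" by (simp add: supp_tuple_def fun_eq_iff)
        then show "generic_tuple (perturb ix t F) \<longrightarrow>
            (V \<in> point_tuples (perturb ix t F) \<longleftrightarrow> V \<in> point_tuples F)"
          using iff True by simp
      qed
    next
      case False
      \<comment> \<open>Failure at \<open>t = 0\<close> is caused by a strict inequality: otherwise
        \<open>x 0\<close> would be a common point whose supports contain the blocks of
        \<open>V\<close>, hence equal them because the point is smooth.\<close>
      have "\<exists>i. \<exists>r\<in>trop_support (F i). trop_val (F i) (p i) (x 0) < trop_val (F i) r (x 0)"
      proof (rule ccontr)
        assume "\<not> ?thesis"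
        then have le: "\<And>i r. r \<in> trop_support (F i) \<Longrightarrow> trop_val (F i) r (x 0) \<le> trop_val (F i) (p i) (x 0)"
          by (meson not_less)
        have sub: "V i \<subseteq> local_support (F i) (x 0)" for i
        proof
          fix a assume a: "a \<in> V i"
          then have "trop_val (F i) a (x 0) = trop_val (F i) (p i) (x 0)"
            using eqV[of a i "p i" 0] by (simp add: perturb_0 pq(1))
          then show "a \<in> local_support (F i) (x 0)"
            using a VA le by (auto simp: in_local_support_iff[OF finA])
        qed
        have fin: "finite (local_support (F i) (x 0))" for i
          using finite_supp_tuple[OF F(2)] by (simp add: supp_tuple_def)
        have "x 0 \<in> (\<Inter>i. trop_hypersurface (F i))"
          using card_mono[OF fin sub] seg by (simp add: trop_hypersurface_def)
        then have "card (local_support (F i) (x 0)) = 2" for i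
          using transverse_supp_tuple[OF F] by (auto simp: all_segments_def supp_tuple_def)
        then have "V i = local_support (F i) (x 0)" for i
          using seg by (intro card_subset_eq[OF fin sub]) simp
        then have "supp_tuple F (x 0) = V" by (simp add: supp_tuple_def fun_eq_iff)
        then show False using False iff0 by simp
      qed
      then obtain i r where r: "r \<in> trop_support (F i)" "trop_val (F i) (p i) (x 0) < trop_val (F i) r (x 0)"
        by blast
      from less[OF r(2)] show ?thesis
      proof (rule eventually_mono)
        fix t assume t: "trop_val (perturb ix t F i) (p i) (x t) < trop_val (perturb ix t F i) r (x t)"
        have fin: "finite (trop_support (perturb ix t F i))" by (simp add: trop_support_perturb finA)
        have "p i \<notin> local_support (perturb ix t F i) (x t)"
          using t r(1) by (auto simp: in_local_support_iff[OF fin] trop_support_perturb not_le)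
        moreover have "p i \<in> V i" by (simp add: pq(1))
        ultimately have "supp_tuple (perturb ix t F) (x t) \<noteq> V" by (auto simp: supp_tuple_def)
        then show "generic_tuple (perturb ix t F) \<longrightarrow>
            (V \<in> point_tuples (perturb ix t F) \<longleftrightarrow> V \<in> point_tuples F)"
          using iff False by simp
      qed
    qed
  qed
qed

lemma eventually_iota2_perturb:
  fixes F :: "'n::finite \<Rightarrow> 'n trop_poly"
  assumes F: "transverse F" "proper_tuple F" and ix: "inj ix"
  shows "\<forall>\<^sub>F t in at_right 0. generic_tuple (perturb ix t F) \<and> iota2 (perturb ix t F) \<zeta> = iota2 F \<zeta>"
proof -
  let ?T = "\<Pi>\<^sub>E i\<in>UNIV. Pow (trop_support (F i))"
  have T: "point_tuples G \<subseteq> ?T" if "\<And>i. trop_support (G i) = trop_support (F i)" for G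
    using local_support_subset[of "G _"] that by (fastforce simp: point_tuples_def supp_tuple_def)
  have "finite ?T" using F by (intro finite_PiE) (auto simp: proper_tuple_def)
  then have "\<forall>\<^sub>F t in at_right 0. \<forall>V\<in>?T. generic_tuple (perturb ix t F) \<longrightarrow>
      (V \<in> point_tuples (perturb ix t F) \<longleftrightarrow> V \<in> point_tuples F)"
    using eventually_point_tuple_iff[OF F ix] by (intro eventually_ball_finite) auto
  moreover have "\<forall>\<^sub>F t in at_right 0. generic_tuple (perturb ix t F)"
    using eventually_avoid_finite[OF finite_not_generic[OF F(2) ix]] by simp
  ultimately show ?thesis
  proof eventually_elim
    case (elim t)
    have "point_tuples (perturb ix t F) = point_tuples F"
      using elim T[of F] T[of "perturb ix t F"] by (auto simp: trop_support_perturb)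
    moreover note iota2_eq_sum_point_tuples[OF F]
      iota2_eq_sum_point_tuples[OF generic_tuple_transverse[OF elim(2)] generic_tuple_proper[OF elim(2)]]
    ultimately show ?case using elim(2) by simp
  qed
qed

subsection \<open>Vertices and faces of lattice polytopes\<close>

lemma lattice_polytope_extreme_points:
  assumes "lattice_polytope P"
  shows "{x. x extreme_point_of P} = real_vec ` lattice_vertices P"
proof -
  obtain S where S: "finite S" "P = convex hull (real_vec ` S)"
    using assms by (auto simp: lattice_polytope_def)
  have "x \<in> real_vec ` S" if "x extreme_point_of P" for x
    using that extreme_point_of_convex_hull unfolding S(2) by blast
  then show ?thesis by (auto simp: lattice_vertices_def)
qed

lemma lattice_polytope_compact_convex:
  assumes "lattice_polytope P"
  shows "compact P" "convex P" "P \<noteq> {}"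
  using assms by (auto simp: lattice_polytope_def finite_imp_compact_convex_hull)

lemma lattice_polytope_hull:
  assumes "lattice_polytope P"
  shows "convex hull (real_vec ` lattice_vertices P) = P"
  using Krein_Milman_Minkowski[OF lattice_polytope_compact_convex(1,2)[OF assms]]
  unfolding lattice_polytope_extreme_points[OF assms] by simp

lemma lattice_vertices_nonempty: "lattice_polytope P \<Longrightarrow> lattice_vertices P \<noteq> {}"
  using lattice_polytope_hull lattice_polytope_compact_convex(3) by fastforce

lemma finite_lattice_vertices:
  assumes "lattice_polytope P"
  shows "finite (lattice_vertices P)"
proof -
  obtain S where S: "finite S" "P = convex hull (real_vec ` S)"
    using assms by (auto simp: lattice_polytope_def)
  have "a \<in> S" if "a \<in> lattice_vertices P" for a
    using that extreme_point_of_convex_hull[of "real_vec a" "real_vec ` S"]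
    unfolding S(2) lattice_vertices_def by (auto simp: real_vec_eq_iff)
  then show ?thesis using S(1) by (meson finite_subset subsetI)
qed

lemma maximal_on_vertices:
  assumes P: "lattice_polytope P" and a: "maximal_on u (lattice_vertices P) a" and y: "y \<in> P"
  shows "real_vec u \<bullet> y \<le> real_vec u \<bullet> real_vec a"
proof -
  have "convex hull (real_vec ` lattice_vertices P) \<subseteq> {y. real_vec u \<bullet> y \<le> real_vec u \<bullet> real_vec a}"
    using a by (intro hull_minimal convex_halfspace_le) (auto simp: maximal_on_def inner_real_vec)
  then show ?thesis using y lattice_polytope_hull[OF P] by blast
qed

lemma max_face_face:
  assumes P: "lattice_polytope P"
  shows "max_face u P face_of P" "max_face u P \<noteq> {}"
proof -
  obtain a where a: "maximal_on u (lattice_vertices P) a"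
    using maximal_on_exists[OF finite_lattice_vertices[OF P] lattice_vertices_nonempty[OF P]] .
  have aP: "real_vec a \<in> P"
    using a by (auto simp: maximal_on_def lattice_vertices_def extreme_point_of_def)
  note le = maximal_on_vertices[OF P a]
  have eq: "max_face u P = P \<inter> {x. real_vec u \<bullet> x = real_vec u \<bullet> real_vec a}"
    using le aP by (force simp: max_face_def)
  show "max_face u P face_of P" unfolding eq
    by (rule face_of_Int_supporting_hyperplane_le[OF lattice_polytope_compact_convex(2)[OF P] le])
  show "max_face u P \<noteq> {}" using aP eq by blast
qed

lemma lattice_vertices_max_face:
  assumes P: "lattice_polytope P"
  shows "lattice_vertices (max_face u P) = {a. maximal_on u (lattice_vertices P) a}"
proof -
  have ext: "real_vec a extreme_point_of max_face u P \<longleftrightarrow>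
      real_vec a extreme_point_of P \<and> real_vec a \<in> max_face u P" for a
    by (rule extreme_point_of_face[OF max_face_face(1)[OF P]])
  have "real_vec a \<in> max_face u P \<longleftrightarrow> maximal_on u (lattice_vertices P) a"
    if a: "a \<in> lattice_vertices P" for a
  proof
    assume max: "real_vec a \<in> max_face u P"
    have "scalar_product u r \<le> scalar_product u a" if "r \<in> lattice_vertices P" for r
    proof -
      have "real_vec r \<in> P" using that by (simp add: lattice_vertices_def extreme_point_of_def)
      then have "real_vec u \<bullet> real_vec r \<le> real_vec u \<bullet> real_vec a" using max by (simp add: max_face_def)
      then show ?thesis by (simp add: inner_real_vec)
    qed
    then show "maximal_on u (lattice_vertices P) a" using a by (simp add: maximal_on_def)
  next
    assume "maximal_on u (lattice_vertices P) a"
    from maximal_on_vertices[OF P this] show "real_vec a \<in> max_face u P"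
      using a by (simp add: max_face_def lattice_vertices_def extreme_point_of_def)
  qed
  then show ?thesis
    using ext by (auto simp: lattice_vertices_def maximal_on_def)
qed

lemma lattice_polytope_max_face:
  assumes P: "lattice_polytope P"
  shows "lattice_polytope (max_face u P)"
proof -
  let ?M = "max_face u P"
  note face = max_face_face(1)[OF P]
  have "x \<in> real_vec ` lattice_vertices ?M" if "x extreme_point_of ?M" for x
  proof -
    have "x extreme_point_of P" using that extreme_point_of_face[OF face] by blast
    then obtain a where "x = real_vec a" using lattice_polytope_extreme_points[OF P] by blast
    then show ?thesis using that by (simp add: lattice_vertices_def)
  qed
  then have ext: "{x. x extreme_point_of ?M} = real_vec ` lattice_vertices ?M"
    by (auto simp: lattice_vertices_def)
  have "compact ?M" "convex ?M"
    using face lattice_polytope_compact_convex[OF P] face_of_imp_compact face_of_imp_convex by blast+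
  then have hull: "?M = convex hull (real_vec ` lattice_vertices ?M)"
    using Krein_Milman_Minkowski[of ?M] unfolding ext by blast
  moreover have "finite (lattice_vertices ?M)"
    unfolding lattice_vertices_max_face[OF P]
    by (rule finite_subset[OF _ finite_lattice_vertices[OF P]]) (auto simp: maximal_on_def)
  moreover have "lattice_vertices ?M \<noteq> {}"
    using hull max_face_face(2)[OF P, of u] by force
  ultimately show ?thesis unfolding lattice_polytope_def by blast
qed

lemma two_vertex_max_face_iff:
  assumes P: "lattice_polytope P"
  shows "two_vertex (max_face u P) \<longleftrightarrow>
    (\<forall>a b. maximal_on u (lattice_vertices P) a \<longrightarrow> maximal_on u (lattice_vertices P) b \<longrightarrow> mod2_vec a = mod2_vec b)"
  unfolding two_vertex_def lattice_vertices_max_face[OF P] mod2_vec_eq_iff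
  using lattice_polytope_max_face[OF P] by blast

lemma lattice_polytope_plus:
  assumes "lattice_polytope P" "lattice_polytope Q"
  shows "lattice_polytope (P + Q)"
proof -
  obtain S T where S: "finite S" "S \<noteq> {}" "P = convex hull (real_vec ` S)"
    and T: "finite T" "T \<noteq> {}" "Q = convex hull (real_vec ` T)"
    using assms by (auto simp: lattice_polytope_def)
  have "real_vec ` S + real_vec ` T = real_vec ` (S + T)"
    by (auto simp: set_plus_def real_vec_add image_iff) (metis real_vec_add)+
  then have "P + Q = convex hull (real_vec ` (S + T))"
    unfolding S(3) T(3) by (metis convex_hull_set_plus)
  moreover have "finite (S + T)" using S T by (simp add: finite_set_plus)
  moreover have "S + T \<noteq> {}" using S T by (auto simp: set_plus_def)
  ultimately show ?thesis unfolding lattice_polytope_def by blast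
qed

text \<open>A segment in \<open>P\<close> through \<open>p\<close>, translated by \<open>q\<close>,
  is a segment in \<open>P + Q\<close> through \<open>p + q\<close>.\<close>

lemma extreme_point_of_plus:
  fixes P Q :: "(real ^ 'n) set"
  assumes "p + q extreme_point_of P + Q" "p \<in> P" "q \<in> Q"
  shows "p extreme_point_of P"
  unfolding extreme_point_of_def
proof (intro conjI ballI notI)
  fix b c assume b: "b \<in> P" and c: "c \<in> P" and pbc: "p \<in> open_segment b c"
  have "p + q \<in> open_segment (b + q) (c + q)"
  proof -
    obtain s where s: "b \<noteq> c" "0 < s" "s < 1" "p = (1 - s) *\<^sub>R b + s *\<^sub>R c"
      using pbc by (auto simp: in_segment)
    have "p + q = (1 - s) *\<^sub>R (b + q) + s *\<^sub>R (c + q)"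
      unfolding s(4) by (simp add: algebra_simps)
    then show ?thesis using s by (auto simp: in_segment)
  qed
  moreover have "b + q \<in> P + Q" "c + q \<in> P + Q" using b c assms(3) by (auto intro: set_plus_intro)
  ultimately show False using assms(1) by (auto simp: extreme_point_of_def)
qed (rule assms)

text \<open>A vertex of the sum splits into vertices of the summands. Maximality of the sum, tested
  with one summand held fixed, gives maximality of the other.\<close>

lemma maximal_on_plus:
  fixes P Q :: "(real ^ 'n) set"
  assumes P: "lattice_polytope P" and Q: "lattice_polytope Q"
    and a: "maximal_on u (lattice_vertices (P + Q)) a"
  obtains p q where "a = p + q" "maximal_on u (lattice_vertices P) p" "maximal_on u (lattice_vertices Q) q"
proof -
  have ext: "real_vec a extreme_point_of P + Q"
    using a by (simp add: maximal_on_def lattice_vertices_def)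
  then have "real_vec a \<in> P + Q" by (simp add: extreme_point_of_def)
  then obtain x y where xy: "real_vec a = x + y" "x \<in> P" "y \<in> Q" by (rule set_plus_elim)
  have "x extreme_point_of P" using extreme_point_of_plus[of x y P Q] ext xy by simp
  moreover have "y extreme_point_of Q"
    using extreme_point_of_plus[of y x Q P] ext xy by (simp add: add.commute)
  ultimately obtain p q where pq: "x = real_vec p" "p \<in> lattice_vertices P" "y = real_vec q" "q \<in> lattice_vertices Q"
    using lattice_polytope_extreme_points[OF P] lattice_polytope_extreme_points[OF Q] by blast
  have "real_vec a = real_vec (p + q)" using xy pq by (simp add: real_vec_add)
  then have apq: "a = p + q" by (simp only: real_vec_eq_iff)
  have le: "scalar_product u r + scalar_product u s \<le> scalar_product u p + scalar_product u q"
    if "r \<in> lattice_vertices P" "s \<in> lattice_vertices Q" for r s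
  proof -
    have "real_vec r + real_vec s \<in> P + Q"
      using that by (intro set_plus_intro) (auto simp: lattice_vertices_def extreme_point_of_def)
    from maximal_on_vertices[OF lattice_polytope_plus[OF P Q] a this]
    have "real_of_int (scalar_product u r + scalar_product u s) \<le> real_of_int (scalar_product u p + scalar_product u q)"
      unfolding apq real_vec_add inner_add_right inner_real_vec by simp
    then show ?thesis by linarith
  qed
  show ?thesis
  proof (rule that[OF apq])
    show "maximal_on u (lattice_vertices P) p" using pq le[of _ q] by (auto simp: maximal_on_def)
    show "maximal_on u (lattice_vertices Q) q" using pq le[of p] by (auto simp: maximal_on_def)
  qed
qed

text \<open>If one of the two given indices differs from \<open>j\<close>, that slot is shared with
  the new tuple. Otherwise the faces of both \<open>P\<close> and \<open>Q\<close> are 2-vertices,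
  and so is their sum, whose vertices split.\<close>

lemma two_developed_plus:
  fixes T :: "'n::finite \<Rightarrow> (real ^ 'n) set"
  assumes P: "two_developed (T(j := P)) \<zeta>" and Q: "two_developed (T(j := Q)) \<zeta>"
  shows "two_developed (T(j := P + Q)) \<zeta>"
proof -
  have lat: "lattice_polytope P" "lattice_polytope Q"
    using P Q unfolding two_developed_def by (metis fun_upd_same)+
  have lat': "lattice_polytope (T i)" if "i \<noteq> j" for i
    using P that unfolding two_developed_def by (metis fun_upd_other)
  have "\<exists>i. two_vertex (max_face v ((T(j := P + Q)) i))" if v: "odd (scalar_product v \<zeta>)" for v
  proof -
    obtain i k where i: "two_vertex (max_face v ((T(j := P)) i))" and k: "two_vertex (max_face v ((T(j := Q)) k))"
      using P Q v unfolding two_developed_def by blast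
    show ?thesis
    proof (cases "i = j \<and> k = j")
      case True
      then have 1: "two_vertex (max_face v P)" "two_vertex (max_face v Q)" using i k by auto
      have "two_vertex (max_face v (P + Q))"
        unfolding two_vertex_max_face_iff[OF lattice_polytope_plus[OF lat]]
      proof (intro allI impI)
        fix a b
        assume a: "maximal_on v (lattice_vertices (P + Q)) a" and b: "maximal_on v (lattice_vertices (P + Q)) b"
        obtain p q where p: "a = p + q" "maximal_on v (lattice_vertices P) p" "maximal_on v (lattice_vertices Q) q"
          using maximal_on_plus[OF lat a] .
        obtain r s where r: "b = r + s" "maximal_on v (lattice_vertices P) r" "maximal_on v (lattice_vertices Q) s"
          using maximal_on_plus[OF lat b] .
        have "mod2_vec p = mod2_vec r" "mod2_vec q = mod2_vec s"
          using 1 p r unfolding two_vertex_max_face_iff[OF lat(1)] two_vertex_max_face_iff[OF lat(2)] by blast+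
        then show "mod2_vec a = mod2_vec b" by (simp only: p(1) r(1) mod2_vec_add)
      qed
      then show ?thesis by (intro exI[of _ j]) simp
    next
      case False
      then have "(i \<noteq> j \<and> two_vertex (max_face v (T i))) \<or> (k \<noteq> j \<and> two_vertex (max_face v (T k)))"
        using i k by auto
      then show ?thesis by (metis fun_upd_other)
    qed
  qed
  then show ?thesis
    using lat lat' lattice_polytope_plus[OF lat] by (simp add: two_developed_def)
qed

subsection \<open>Invariance and additivity\<close>

lemma weight_upd_single: "weight \<zeta> (e(j := {a})) = det2 ((kvec \<zeta> e)(Some j := mod2_vec a))"
  unfolding weight_upd by simp

text \<open>Here \<open>m\<close> is the discrepancy between two choices of the dominating exponent
  in slot \<open>j\<close>. The alternative in \<open>dev\<close> reflects whether the 2-vertex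
  supplied by developedness sits in slot \<open>j\<close> or elsewhere.\<close>

lemma ray_det2_eq_0:
  fixes e :: "'n::finite \<Rightarrow> (int ^ 'n) set"
  assumes ray: "(e, u) \<in> curve_rays j F"
    and supp: "\<And>i. i \<noteq> j \<Longrightarrow> lattice_polytope (P i)" "\<And>i. i \<noteq> j \<Longrightarrow> trop_support (F i) = lattice_vertices (P i)"
    and dev: "odd (scalar_product u \<zeta>) \<Longrightarrow> mod2_vec m = 0 \<or> (\<exists>i. i \<noteq> j \<and> two_vertex (max_face u (P i)))"
    and m: "scalar_product u m = 0"
  shows "det2 ((kvec \<zeta> e)(Some j := mod2_vec m)) = 0"
proof -
  have seg: "curve_segments j e" and u: "u \<in> edge_dirs j e"
    and max: "\<And>i p. i \<noteq> j \<Longrightarrow> p \<in> e i \<Longrightarrow> maximal_on u (lattice_vertices (P i)) p"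
    using ray supp(2) unfolding curve_rays_def by auto
  let ?k = "(kvec \<zeta> e)(Some j := mod2_vec m)"
  have two: "\<exists>a b. a \<in> e i \<and> b \<in> e i \<and> ?k (Some i) = mod2_vec a + mod2_vec b" if i: "i \<noteq> j" for i
  proof -
    obtain a b where ab: "e i = {a, b}" "a \<noteq> b"
      using seg i unfolding curve_segments_def card_2_iff by blast
    have "?k (Some i) = mod2_vec a + mod2_vec b" using ab i by (simp add: kvec_def)
    then show ?thesis using ab by blast
  qed
  show ?thesis
  proof (cases "odd (scalar_product u \<zeta>)")
    case True
    then consider "mod2_vec m = 0" | i where "i \<noteq> j" "two_vertex (max_face u (P i))" using dev by blast
    then show ?thesis
    proof cases
      case 1
      then show ?thesis by (intro det2_zero[of _ "Some j"]) simp
    next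
      case (2 i)
      obtain a b where ab: "a \<in> e i" "b \<in> e i" "?k (Some i) = mod2_vec a + mod2_vec b" using two[OF 2(1)] by blast
      have "mod2_vec a = mod2_vec b"
        using 2(2) max[OF 2(1)] ab(1,2) unfolding two_vertex_max_face_iff[OF supp(1)[OF 2(1)]] by blast
      then have "?k (Some i) = 0" using ab(3) by (simp only: bit_vec_add_eq_0_iff)
      then show ?thesis by (rule det2_zero)
    qed
  next
    case False
    show ?thesis
    proof (rule det2_orthogonal_eq_0)
      obtain i where "odd (u $ i)" using edge_dirs(1)[OF seg u] by blast
      then have "mod2_vec u $ i \<noteq> 0" by (simp only: mod2_vec_def vec_lambda_beta of_int_bit_eq_0_iff) simp
      then show "mod2_vec u \<noteq> 0" by (metis zero_index)
      fix l
      consider "l = None" | "l = Some j" | i where "l = Some i" "i \<noteq> j" by (cases l) auto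
      then show "(\<Sum>i\<in>UNIV. mod2_vec u $ i * ?k l $ i) = 0"
      proof cases
        case 1
        then have "?k l = mod2_vec \<zeta>" by (simp add: kvec_def)
        then show ?thesis using False by (simp only: inner_mod2_vec of_int_bit_eq_0_iff) simp
      next
        case 2
        then have "?k l = mod2_vec m" by simp
        then show ?thesis by (simp only: inner_mod2_vec m) simp
      next
        case (3 i)
        obtain a b where ab: "a \<in> e i" "b \<in> e i" "?k l = mod2_vec a + mod2_vec b"
          using two[OF 3(2)] 3(1) by blast
        then have "?k l = mod2_vec (a - b)" by (simp only: mod2_vec_diff)
        moreover have "scalar_product u (a - b) = 0"
          using edge_dirs(2)[OF seg u 3(2) ab(1,2)] by (simp add: scalar_product_diff_right)
        ultimately show ?thesis by (simp only: inner_mod2_vec) simp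
      qed
    qed
  qed
qed

lemma iota2_ray_sum:
  assumes "generic_tuple (G(j := \<theta>))"
  obtains a where "\<And>r. r \<in> curve_rays j G \<Longrightarrow> maximal_on (snd r) (trop_support \<theta>) (a r)"
    "iota2 (G(j := \<theta>)) \<zeta> = (\<Sum>r\<in>curve_rays j G. weight \<zeta> ((fst r)(j := {a r})))"
proof -
  interpret generic_curve "G(j := \<theta>)" j by unfold_locales (rule assms)
  from iota2_rays obtain a where
    a: "\<And>r. r \<in> curve_rays j (G(j := \<theta>)) \<Longrightarrow> maximal_on (snd r) (trop_support ((G(j := \<theta>)) j)) (a r)"
      "\<And>\<zeta>. iota2 (G(j := \<theta>)) \<zeta> = (\<Sum>r\<in>curve_rays j (G(j := \<theta>)). weight \<zeta> ((fst r)(j := {a r})))"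
    by blast
  show ?thesis by (rule that[OF a[unfolded curve_rays_upd fun_upd_same]])
qed

lemma iota2_change_one:
  fixes G :: "'n::finite \<Rightarrow> 'n trop_poly"
  assumes dev: "two_developed P \<zeta>"
    and G: "generic_tuple G" "\<And>i. trop_support (G i) = lattice_vertices (P i)"
    and G': "generic_tuple (G(j := \<phi>))" "trop_support \<phi> = lattice_vertices (P j)"
  shows "iota2 (G(j := \<phi>)) \<zeta> = iota2 G \<zeta>"
proof -
  have "generic_tuple (G(j := G j))" using G(1) by simp
  from iota2_ray_sum[OF this, of \<zeta>] obtain a where
    a: "\<And>r. r \<in> curve_rays j G \<Longrightarrow> maximal_on (snd r) (lattice_vertices (P j)) (a r)"
      "iota2 G \<zeta> = (\<Sum>r\<in>curve_rays j G. weight \<zeta> ((fst r)(j := {a r})))"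
    unfolding G(2) fun_upd_triv by blast
  from iota2_ray_sum[OF G'(1), of \<zeta>] obtain b where
    b: "\<And>r. r \<in> curve_rays j G \<Longrightarrow> maximal_on (snd r) (lattice_vertices (P j)) (b r)"
      "iota2 (G(j := \<phi>)) \<zeta> = (\<Sum>r\<in>curve_rays j G. weight \<zeta> ((fst r)(j := {b r})))"
    unfolding G'(2) by blast
  have lat: "lattice_polytope (P i)" for i using dev by (simp add: two_developed_def)
  have "weight \<zeta> ((fst r)(j := {b r})) = weight \<zeta> ((fst r)(j := {a r}))" if r: "r \<in> curve_rays j G" for r
  proof -
    obtain e u where eu: "r = (e, u)" by (cases r)
    have max: "maximal_on u (lattice_vertices (P j)) (a r)" "maximal_on u (lattice_vertices (P j)) (b r)"
      using a(1)[OF r] b(1)[OF r] by (simp_all add: eu)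
    have "det2 ((kvec \<zeta> e)(Some j := mod2_vec (b r - a r))) = 0"
    proof (rule ray_det2_eq_0[OF r[unfolded eu] lat G(2)])
      show "scalar_product u (b r - a r) = 0"
        using max by (simp add: scalar_product_diff_right maximal_on_def order_antisym)
      assume "odd (scalar_product u \<zeta>)"
      then obtain i where i: "two_vertex (max_face u (P i))" using dev by (auto simp: two_developed_def)
      show "mod2_vec (b r - a r) = 0 \<or> (\<exists>i. i \<noteq> j \<and> two_vertex (max_face u (P i)))"
      proof (cases "i = j")
        case True
        then have "mod2_vec (b r) = mod2_vec (a r)"
          using i max unfolding two_vertex_max_face_iff[OF lat] by blast
        then have "mod2_vec (b r - a r) = 0" by (simp only: mod2_vec_diff bit_vec_add_eq_0_iff)
        then show ?thesis ..
      qed (use i in blast)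
    qed
    then show ?thesis
      unfolding mod2_vec_diff det2_add eu fst_conv weight_upd_single
      by (cases "det2 ((kvec \<zeta> e)(Some j := mod2_vec (a (e, u))))") simp_all
  qed
  then show ?thesis unfolding a(2) b(2) by (rule sum.cong[OF refl])
qed

section \<open>Independence of the choice of hypersurfaces\<close>

text \<open>One tuple is turned into the other by exchanging one member at a time. Mixtures of two
  transverse tuples may fail to be transverse, so every mixture is perturbed with one and the same
  \<open>t\<close>.\<close>

lemma iota2_invariant:
  fixes F :: "'n::finite \<Rightarrow> 'n trop_poly"
  assumes dev: "two_developed P \<zeta>"
    and F: "transverse F" "\<And>i. trop_support (F i) = lattice_vertices (P i)"
    and F': "transverse F'" "\<And>i. trop_support (F' i) = lattice_vertices (P i)"
  shows "iota2 F \<zeta> = iota2 F' \<zeta>"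
proof -
  have lat: "lattice_polytope (P i)" for i using dev by (simp add: two_developed_def)
  have proper: "proper_tuple G" if "\<And>i. trop_support (G i) = lattice_vertices (P i)" for G
    using that finite_lattice_vertices[OF lat] lattice_vertices_nonempty[OF lat] by (simp add: proper_tuple_def)
  obtain ix :: "'n \<times> (int ^ 'n) \<Rightarrow> nat" where ix: "inj ix" using ex_index by blast
  define mix where "mix = (\<lambda>J i. if i \<in> J then F' i else F i)"
  have mix: "trop_support (mix J i) = lattice_vertices (P i)" for J i
    by (simp add: mix_def F(2) F'(2))
  have "\<forall>\<^sub>F t in at_right 0. \<forall>J\<in>UNIV. generic_tuple (perturb ix t (mix J))"
    using eventually_avoid_finite[OF finite_not_generic[OF proper[OF mix] ix]]
    by (intro eventually_ball_finite ballI) simp_all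
  moreover note eventually_iota2_perturb[OF F(1) proper[OF F(2)] ix, of \<zeta>]
  moreover note eventually_iota2_perturb[OF F'(1) proper[OF F'(2)] ix, of \<zeta>]
  ultimately have "\<forall>\<^sub>F t in at_right 0. (\<forall>J\<in>UNIV. generic_tuple (perturb ix t (mix J))) \<and>
      iota2 (perturb ix t F) \<zeta> = iota2 F \<zeta> \<and> iota2 (perturb ix t F') \<zeta> = iota2 F' \<zeta>"
    by eventually_elim blast
  from eventually_happens'[OF trivial_limit_at_right_real this]
  obtain t where gen: "\<And>J. generic_tuple (perturb ix t (mix J))"
    and t: "iota2 (perturb ix t F) \<zeta> = iota2 F \<zeta>" "iota2 (perturb ix t F') \<zeta> = iota2 F' \<zeta>"
    by blast
  have "iota2 (perturb ix t (mix J)) \<zeta> = iota2 (perturb ix t F) \<zeta>" if "finite J" for J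
    using that
  proof (induction J rule: finite_induct)
    case empty
    have "mix {} = F" by (simp add: mix_def)
    then show ?case by simp
  next
    case (insert j J)
    have upd: "perturb ix t (mix (insert j J)) = (perturb ix t (mix J))(j := perturb_poly ix t j (F' j))"
    proof -
      have "mix (insert j J) = (mix J)(j := F' j)" by (auto simp: mix_def)
      then show ?thesis by (simp only: perturb_upd)
    qed
    have "iota2 (perturb ix t (mix (insert j J))) \<zeta> = iota2 (perturb ix t (mix J)) \<zeta>"
      unfolding upd
    proof (rule iota2_change_one[OF dev gen])
      show "trop_support (perturb ix t (mix J) i) = lattice_vertices (P i)" for i
        by (simp only: trop_support_perturb mix)
      show "generic_tuple ((perturb ix t (mix J))(j := perturb_poly ix t j (F' j)))"
        unfolding upd[symmetric] by (rule gen)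
      show "trop_support (perturb_poly ix t j (F' j)) = lattice_vertices (P j)"
        by (simp add: perturb_poly_def F'(2))
    qed
    then show ?case using insert.IH by simp
  qed
  from this[of UNIV] have "iota2 (perturb ix t (mix UNIV)) \<zeta> = iota2 (perturb ix t F) \<zeta>" by simp
  moreover have "mix UNIV = F'" by (simp add: mix_def)
  ultimately show ?thesis using t by simp
qed

lemma MV2_eq_iota2:
  fixes F :: "'n::finite \<Rightarrow> 'n trop_poly"
  assumes dev: "two_developed P \<zeta>"
    and F: "transverse F" "\<And>i. trop_support (F i) = lattice_vertices (P i)"
  shows "MV2_defined P \<zeta>" "MV2 P \<zeta> = iota2 F \<zeta>"
proof -
  have val: "is_MV2 P \<zeta> (iota2 F \<zeta>)"
    unfolding is_MV2_def using F iota2_invariant[OF dev _ _ F] by blast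
  then show "MV2_defined P \<zeta>" using dev by (auto simp: MV2_defined_def)
  show "MV2 P \<zeta> = iota2 F \<zeta>"
    unfolding MV2_def
  proof (rule the_equality)
    show "is_MV2 P \<zeta> (iota2 F \<zeta>)" by (rule val)
    show "b = iota2 F \<zeta>" if "is_MV2 P \<zeta> b" for b using that F unfolding is_MV2_def by blast
  qed
qed

lemma proper_tuple_lattice:
  assumes "\<And>i. lattice_polytope (P i)"
  shows "proper_tuple (\<lambda>i. (lattice_vertices (P i), \<lambda>_. 0))"
  using finite_lattice_vertices[OF assms] lattice_vertices_nonempty[OF assms] by (simp add: proper_tuple_def)

text \<open>Provides the tuple whose existence \<open>is_MV2\<close> requires, as a perturbation of
  zero coefficients.\<close>

lemma two_developed_transverse_exists:
  fixes P :: "'n::finite \<Rightarrow> (real ^ 'n) set"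
  assumes dev: "two_developed P \<zeta>"
  obtains F where "transverse F" "\<And>i. trop_support (F i) = lattice_vertices (P i)"
proof -
  obtain ix :: "'n \<times> (int ^ 'n) \<Rightarrow> nat" where ix: "inj ix" using ex_index by blast
  let ?F = "\<lambda>i. (lattice_vertices (P i), \<lambda>_. 0)"
  have "proper_tuple ?F" using dev by (intro proper_tuple_lattice) (simp add: two_developed_def)
  from ex_new_if_finite[OF infinite_UNIV_char_0 finite_not_generic[OF this ix]]
  obtain t where "generic_tuple (perturb ix t ?F)" by auto
  then show ?thesis
    by (intro that[of "perturb ix t ?F"] generic_tuple_transverse) (simp_all add: trop_support_perturb)
qed

section \<open>Symmetry\<close>

text \<open>The intersection is unchanged, and at each of its points the vectors are permuted by
  \<open>map_option s\<close>, which fixes the slot \<open>None\<close> of \<zeta>.\<close>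

lemma iota2_permute:
  fixes F :: "'n::finite \<Rightarrow> 'n trop_poly"
  assumes s: "bij s"
  shows "transverse (\<lambda>i. F (s i)) \<longleftrightarrow> transverse F" "iota2 (\<lambda>i. F (s i)) \<zeta> = iota2 F \<zeta>"
proof -
  have surj: "(\<forall>i. Q (s i)) \<longleftrightarrow> (\<forall>i. Q i)" for Q
    using bij_is_surj[OF s] by (metis surjD)
  have X: "(\<Inter>i. trop_hypersurface (F (s i))) = (\<Inter>i. trop_hypersurface (F i))"
    using surj[of "\<lambda>i. _ \<in> trop_hypersurface (F i)"] by auto
  show "transverse (\<lambda>i. F (s i)) \<longleftrightarrow> transverse F"
    unfolding transverse_def X using surj[of "\<lambda>i. smooth_point (F i) _"] by auto
  have bij: "bij (map_option s)"
  proof (rule o_bij)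
    show "map_option (inv s) \<circ> map_option s = id"
      by (simp add: fun_eq_iff option.map_comp o_def inv_f_f[OF bij_is_inj[OF s]] option.map_ident)
    show "map_option s \<circ> map_option (inv s) = id"
      by (simp add: fun_eq_iff option.map_comp o_def surj_f_inv_f[OF bij_is_surj[OF s]] option.map_ident)
  qed
  show "iota2 (\<lambda>i. F (s i)) \<zeta> = iota2 F \<zeta>"
    unfolding iota2_def X
  proof (rule sum.cong[OF refl])
    fix x
    let ?k = "\<lambda>j. case j of None \<Rightarrow> mod2_vec \<zeta> | Some i \<Rightarrow> segment_mod2 (local_newton (F i) x)"
    have "(\<lambda>j. case j of None \<Rightarrow> mod2_vec \<zeta> | Some i \<Rightarrow> segment_mod2 (local_newton (F (s i)) x)) = ?k \<circ> map_option s"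
      by (auto simp: fun_eq_iff split: option.split)
    then show "det2 (\<lambda>j. case j of None \<Rightarrow> mod2_vec \<zeta> | Some i \<Rightarrow> segment_mod2 (local_newton (F (s i)) x)) = det2 ?k"
      using det2_permute[OF bij, of ?k] by (simp only:)
  qed
qed

lemma MV2_permute:
  fixes P :: "'n::finite \<Rightarrow> (real ^ 'n) set"
  assumes dev: "two_developed P \<zeta>" and s: "bij s"
  shows "MV2_defined (\<lambda>i. P (s i)) \<zeta>" "MV2 (\<lambda>i. P (s i)) \<zeta> = MV2 P \<zeta>"
proof -
  obtain F where F: "transverse F" "\<And>i. trop_support (F i) = lattice_vertices (P i)"
    using two_developed_transverse_exists[OF dev] by blast
  have dev': "two_developed (\<lambda>i. P (s i)) \<zeta>"
    using dev bij_is_surj[OF s] unfolding two_developed_def by (metis surjD)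
  have F': "transverse (\<lambda>i. F (s i))" using iota2_permute(1)[OF s] F(1) by blast
  show "MV2_defined (\<lambda>i. P (s i)) \<zeta>" by (rule MV2_eq_iota2(1)[OF dev' F']) (rule F(2))
  have "MV2 (\<lambda>i. P (s i)) \<zeta> = iota2 (\<lambda>i. F (s i)) \<zeta>" by (rule MV2_eq_iota2(2)[OF dev' F']) (rule F(2))
  then show "MV2 (\<lambda>i. P (s i)) \<zeta> = MV2 P \<zeta>"
    using iota2_permute(2)[OF s] MV2_eq_iota2(2)[OF dev F] by simp
qed

section \<open>Additivity\<close>

text \<open>All three numbers are sums over the rays of \<open>G\<close>, so they are compared ray
  by ray. The exponent for \<open>P + Q\<close> splits into maximizers for \<open>P\<close> and
  \<open>Q\<close>, which may differ from the chosen ones; \<open>ray_det2_eq_0\<close> shows that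
  the discrepancy contributes 0.\<close>

lemma iota2_additive:
  fixes G :: "'n::finite \<Rightarrow> 'n trop_poly"
  assumes P: "two_developed (T(j := P)) \<zeta>" and Q: "two_developed (T(j := Q)) \<zeta>"
    and supp: "\<And>i. i \<noteq> j \<Longrightarrow> trop_support (G i) = lattice_vertices (T i)"
    and p: "trop_support \<phi> = lattice_vertices P" "generic_tuple (G(j := \<phi>))"
    and q: "trop_support \<psi> = lattice_vertices Q" "generic_tuple (G(j := \<psi>))"
    and r: "trop_support \<rho> = lattice_vertices (P + Q)" "generic_tuple (G(j := \<rho>))"
  shows "iota2 (G(j := \<rho>)) \<zeta> = iota2 (G(j := \<phi>)) \<zeta> + iota2 (G(j := \<psi>)) \<zeta>"
proof -
  have lat: "lattice_polytope P" "lattice_polytope Q"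
    using P Q unfolding two_developed_def by (metis fun_upd_same)+
  have lat': "lattice_polytope (T i)" if "i \<noteq> j" for i
    using P that unfolding two_developed_def by (metis fun_upd_other)
  from iota2_ray_sum[OF p(2), of \<zeta>] obtain a where
    a: "\<And>r. r \<in> curve_rays j G \<Longrightarrow> maximal_on (snd r) (lattice_vertices P) (a r)"
      "iota2 (G(j := \<phi>)) \<zeta> = (\<Sum>r\<in>curve_rays j G. weight \<zeta> ((fst r)(j := {a r})))"
    unfolding p(1) by blast
  from iota2_ray_sum[OF q(2), of \<zeta>] obtain b where
    b: "\<And>r. r \<in> curve_rays j G \<Longrightarrow> maximal_on (snd r) (lattice_vertices Q) (b r)"
      "iota2 (G(j := \<psi>)) \<zeta> = (\<Sum>r\<in>curve_rays j G. weight \<zeta> ((fst r)(j := {b r})))"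
    unfolding q(1) by blast
  from iota2_ray_sum[OF r(2), of \<zeta>] obtain c where
    c: "\<And>r. r \<in> curve_rays j G \<Longrightarrow> maximal_on (snd r) (lattice_vertices (P + Q)) (c r)"
      "iota2 (G(j := \<rho>)) \<zeta> = (\<Sum>r\<in>curve_rays j G. weight \<zeta> ((fst r)(j := {c r})))"
    unfolding r(1) by blast
  have "weight \<zeta> ((fst m)(j := {c m})) = weight \<zeta> ((fst m)(j := {a m})) + weight \<zeta> ((fst m)(j := {b m}))"
    if m: "m \<in> curve_rays j G" for m
  proof -
    obtain e u where eu: "m = (e, u)" by (cases m)
    have max: "maximal_on u (lattice_vertices P) (a m)" "maximal_on u (lattice_vertices Q) (b m)"
      "maximal_on u (lattice_vertices (P + Q)) (c m)"
      using a(1)[OF m] b(1)[OF m] c(1)[OF m] by (simp_all add: eu)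
    obtain x y where xy: "c m = x + y" "maximal_on u (lattice_vertices P) x" "maximal_on u (lattice_vertices Q) y"
      using maximal_on_plus[OF lat max(3)] .
    have "det2 ((kvec \<zeta> e)(Some j := mod2_vec (c m - (a m + b m)))) = 0"
    proof (rule ray_det2_eq_0[OF m[unfolded eu] lat' supp])
      have "scalar_product u x = scalar_product u (a m)" "scalar_product u y = scalar_product u (b m)"
        using max xy by (auto simp: maximal_on_def intro: order_antisym)
      then show "scalar_product u (c m - (a m + b m)) = 0"
        unfolding xy(1) by (simp add: scalar_product_def distrib_left right_diff_distrib sum.distrib sum_subtractf)
      assume odd: "odd (scalar_product u \<zeta>)"
      obtain i k where i: "two_vertex (max_face u ((T(j := P)) i))" and k: "two_vertex (max_face u ((T(j := Q)) k))"
        using P Q odd unfolding two_developed_def by blast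
      show "mod2_vec (c m - (a m + b m)) = 0 \<or> (\<exists>i. i \<noteq> j \<and> two_vertex (max_face u (T i)))"
      proof (cases "i = j \<and> k = j")
        case True
        then have "two_vertex (max_face u P)" "two_vertex (max_face u Q)" using i k by auto
        then have "mod2_vec x = mod2_vec (a m)" "mod2_vec y = mod2_vec (b m)"
          using max xy unfolding two_vertex_max_face_iff[OF lat(1)] two_vertex_max_face_iff[OF lat(2)] by blast+
        then have "mod2_vec (c m - (a m + b m)) = 0"
          by (simp only: xy(1) mod2_vec_diff mod2_vec_add bit_vec_add_eq_0_iff)
        then show ?thesis ..
      qed (use i k in \<open>auto split: if_splits\<close>)
    qed
    then have "weight \<zeta> (e(j := {c m})) + (weight \<zeta> (e(j := {a m})) + weight \<zeta> (e(j := {b m}))) = 0"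
      unfolding mod2_vec_diff mod2_vec_add det2_add weight_upd_single .
    then show ?thesis unfolding eu fst_conv by (metis right_minus_eq minus_bit_def)
  qed
  then show ?thesis
    unfolding a(2) b(2) c(2) sum.distrib[symmetric] by (rule sum.cong[OF refl])
qed

lemma MV2_additive:
  fixes T :: "'n::finite \<Rightarrow> (real ^ 'n) set"
  assumes P: "two_developed (T(j := P)) \<zeta>" and Q: "two_developed (T(j := Q)) \<zeta>"
  shows "MV2_defined (T(j := P + Q)) \<zeta>"
    and "MV2 (T(j := P + Q)) \<zeta> = MV2 (T(j := P)) \<zeta> + MV2 (T(j := Q)) \<zeta>"
proof -
  note R = two_developed_plus[OF P Q]
  obtain ix :: "'n \<times> (int ^ 'n) \<Rightarrow> nat" where ix: "inj ix" using ex_index by blast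
  define F where "F = (\<lambda>X i. (lattice_vertices ((T(j := X)) i), \<lambda>_ :: int ^ 'n. 0 :: real))"
  have bad: "finite {t. \<not> generic_tuple (perturb ix t (F X))}" if "two_developed (T(j := X)) \<zeta>" for X
    unfolding F_def using that
    by (intro finite_not_generic[OF proper_tuple_lattice ix]) (simp only: two_developed_def)
  \<comment> \<open>Outside these finitely many values one \<open>t\<close> serves all three tuples,
    which therefore agree in every slot other than \<open>j\<close>, as additivity along common rays
    demands.\<close>
  have "finite ({t. \<not> generic_tuple (perturb ix t (F P))} \<union> {t. \<not> generic_tuple (perturb ix t (F Q))} \<union>
      {t. \<not> generic_tuple (perturb ix t (F (P + Q)))})"
    using bad[OF P] bad[OF Q] bad[OF R] by simp
  from ex_new_if_finite[OF infinite_UNIV_char_0 this]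
  obtain t where t: "generic_tuple (perturb ix t (F P))" "generic_tuple (perturb ix t (F Q))"
    "generic_tuple (perturb ix t (F (P + Q)))"
    by blast
  define G where "G = perturb ix t (F P)"
  define \<phi> where "\<phi> = (\<lambda>X. perturb_poly ix t j (lattice_vertices X, \<lambda>_. 0))"
  have upd: "perturb ix t (F X) = G(j := \<phi> X)" for X
    unfolding G_def \<phi>_def perturb_upd[symmetric] by (rule arg_cong[where f = "perturb ix t"]) (auto simp: F_def)
  have supp: "trop_support (perturb ix t (F X) i) = lattice_vertices ((T(j := X)) i)" for X i
    by (simp only: trop_support_perturb F_def fst_conv)
  have mv: "MV2 (T(j := X)) \<zeta> = iota2 (G(j := \<phi> X)) \<zeta>"
    if "two_developed (T(j := X)) \<zeta>" "generic_tuple (perturb ix t (F X))" for X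
    using MV2_eq_iota2(2)[OF that(1) generic_tuple_transverse[OF that(2)] supp] unfolding upd .
  show "MV2_defined (T(j := P + Q)) \<zeta>"
    by (rule MV2_eq_iota2(1)[OF R generic_tuple_transverse[OF t(3)] supp])
  have "iota2 (G(j := \<phi> (P + Q))) \<zeta> = iota2 (G(j := \<phi> P)) \<zeta> + iota2 (G(j := \<phi> Q)) \<zeta>"
  proof (rule iota2_additive[OF P Q])
    show "trop_support (G i) = lattice_vertices (T i)" if "i \<noteq> j" for i
      using that supp[of P i] by (simp add: G_def)
  qed (use t in \<open>simp_all add: upd \<phi>_def perturb_poly_def\<close>)
  then show "MV2 (T(j := P + Q)) \<zeta> = MV2 (T(j := P)) \<zeta> + MV2 (T(j := Q)) \<zeta>"
    using mv P Q R t by simp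
qed

theorem proposition2p16:
  fixes \<zeta> :: "int ^ 'n"
  shows
    "(\<forall>(P :: 'n \<Rightarrow> (real ^ 'n) set) s.
        two_developed P \<zeta> \<and> s permutes UNIV \<longrightarrow>
          MV2_defined (\<lambda>i. P (s i)) \<zeta> \<and>
          MV2 (\<lambda>i. P (s i)) \<zeta> = MV2 P \<zeta>) \<and>
     (\<forall>(T :: 'n \<Rightarrow> (real ^ 'n) set) j P Q.
        two_developed (T(j := P)) \<zeta> \<and> two_developed (T(j := Q)) \<zeta> \<longrightarrow>
          MV2_defined (T(j := P + Q)) \<zeta> \<and>
          MV2 (T(j := P + Q)) \<zeta> = MV2 (T(j := P)) \<zeta> + MV2 (T(j := Q)) \<zeta>)"
  using MV2_permute MV2_additive permutes_bij by blast

end
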